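(* Let $k$ be an algebraically closed field of characteristic $p>3$. Let $\mathfrak{L}$ be one of the following non-restricted simple Lie algebras over $k$: $H(2;\underline{1};\Phi(\tau))^{(1)}$, or $W(m,\underline{n})$ with $\underline{n}\neq\underline{1}=(1,\dots,1)$. Then $\Lambda(\mathfrak{L},\mathfrak{t})=\mathrm{Lie}_p(\mathfrak{t},k)\setminus\{0\}$ for every torus $\mathfrak{t}$ in the minimal $p$-envelope $\mathfrak{L}_p$.
   Context: A torus of a restricted Lie algebra is an abelian subalgebra closed under $[p]$ and consisting of semisimple elements ($x$ is semisimple if $x\in\sum_{i\ge1}k\,x^{[p]^i}$). For a simple Lie algebra $\mathfrak{L}$, the minimal $p$-envelope $\mathfrak{L}_p$ is the restricted subalgebra of $\mathrm{Der}(\mathfrak{L})$ generated by $\mathrm{ad}\,\mathfrak{L}\cong\mathfrak{L}$. For a torus $\mathfrak{t}\subseteq\mathfrak{L}_p$, $\mathrm{Lie}_p(\mathfrak{t},k)=\{\alpha\in\mathfrak{t}^*:\ \alpha(t^{[p]})=\alpha(t)^p \text{ for all } t\in\mathfrak{t}\}$, and $\Lambda(\mathfrak{L},\mathfrak{t})$ is the set of nonzero weights of $\mathfrak{t}$ on $\mathfrak{L}$, i.e. of those $\alpha\in\mathfrak{t}^*\setminus\{0\}$ for which $\mathfrak{L}_\alpha=\{x\in\mathfrak{L}: [t,x]=\alpha(t)x\ \forall t\in\mathfrak{t}\}\neq 0$. Generalized Witt algebra. Let $m\ge1$, $\underline{n}=(n_1,\dots,n_m)$, $n_i\ge 1$.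 $A(m,\underline{n})$ is the divided power algebra with $k$-basis $x^{(a)}$, $a=(a_1,\dots,a_m)$, $0\le a_i<p^{n_i}$, and product $x^{(a)}x^{(b)}=\prod_i\binom{a_i+b_i}{a_i}x^{(a+b)}$ (zero if some $a_i+b_i\ge p^{n_i}$). The derivations $\partial_i$ are given by $\partial_i x^{(a)}=x^{(a-\epsilon_i)}$ (zero if $a_i=0$), with $\epsilon_i$ the $i$-th unit multi-index. $W(m,\underline{n})=\bigoplus_{i=1}^m A(m,\underline{n})\partial_i$ with the commutator bracket. The algebra $H(2;\underline{1};\Phi(\tau))^{(1)}$. Let $B_2=k[X_1,X_2]/(X_1^p,X_2^p)$ with generators $x_1,x_2$, let $W(2,\underline{1})=\mathrm{Der}(B_2)$, acting by Lie derivative on differential forms over $B_2$ (the exterior algebra on the free $B_2$-module with basis $dx_1,dx_2$). Put $\omega=(1+x_1^{p-1}x_2^{p-1})\,dx_1\wedge dx_2$. Then $H(2;\underline{1};\Phi(\tau))=\{D\in W(2,\underline{1}): D\omega=0\}$ and $H(2;\underline{1};\Phi(\tau))^{(1)}$ is its derived algebra, which equals $\{(1-x_1^{p-1}x_2^{p-1})(\partial_1(f)\partial_2-\partial_2(f)\partial_1): f\in B_2\}$. *)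

theory Defs
  imports Complex_Main "HOL-Library.Function_Algebras"
    "HOL-Computational_Algebra.Computational_Algebra"
begin

text \<open>
  Function types are abelian groups under the pointwise operations of
  \<^theory>\<open>HOL-Library.Function_Algebras\<close>.  A vector space over \<open>'k\<close> is a subset of a type
  carrying a scaling function \<open>s\<close>.  A linear map defined on a subset \<open>V\<close> is represented by
  the total function that is \<open>0\<close> outside \<open>V\<close>, so that equality of such maps is equality
  of functions.  The Lie algebras below consist of linear operators of this kind and
  their bracket is the commutator.
\<close>

section \<open>Linear maps and derivations on subsets\<close>

definition fscale :: "('k \<Rightarrow> 'b \<Rightarrow> 'b) \<Rightarrow> 'k \<Rightarrow> ('a \<Rightarrow> 'b) \<Rightarrow> ('a \<Rightarrow> 'b)" where
  "fscale s c f = (\<lambda>x. s c (f x))"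

lemma vector_space_mult: "vector_space ((*) :: 'k::field \<Rightarrow> 'k \<Rightarrow> 'k)"
  by unfold_locales (auto simp: algebra_simps)

lemma vector_space_fscale:
  assumes "vector_space s"
  shows "vector_space (fscale s :: 'k::field \<Rightarrow> ('a \<Rightarrow> 'b::ab_group_add) \<Rightarrow> _)"
proof -
  interpret vector_space s by fact
  show ?thesis
    by unfold_locales (auto simp: fscale_def fun_eq_iff scale_right_distrib scale_left_distrib)
qed

definition linear_maps ::
  "('k \<Rightarrow> 'a::ab_group_add \<Rightarrow> 'a) \<Rightarrow> ('k \<Rightarrow> 'b::ab_group_add \<Rightarrow> 'b) \<Rightarrow> 'a set \<Rightarrow> 'b set \<Rightarrow> ('a \<Rightarrow> 'b) set"
where
  "linear_maps s s' V W =
    {f. (\<forall>x\<in>V. f x \<in> W) \<and> (\<forall>x. x \<notin> V \<longrightarrow> f x = 0) \<and>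
        (\<forall>x\<in>V. \<forall>y\<in>V. f (x + y) = f x + f y) \<and> (\<forall>c. \<forall>x\<in>V. f (s c x) = s' c (f x))}"

definition dual_space :: "('k::field \<Rightarrow> 'a::ab_group_add \<Rightarrow> 'a) \<Rightarrow> 'a set \<Rightarrow> ('a \<Rightarrow> 'k) set" where
  "dual_space s V = linear_maps s (*) V UNIV"

definition derivations ::
  "('k \<Rightarrow> 'a::ab_group_add \<Rightarrow> 'a) \<Rightarrow> ('a \<Rightarrow> 'a \<Rightarrow> 'a) \<Rightarrow> 'a set \<Rightarrow> ('a \<Rightarrow> 'a) set"
where
  "derivations s mul A =
    {D \<in> linear_maps s s A A. \<forall>x\<in>A. \<forall>y\<in>A. D (mul x y) = mul (D x) y + mul x (D y)}"

definition commutator :: "('a \<Rightarrow> 'a) \<Rightarrow> ('a \<Rightarrow> 'a) \<Rightarrow> ('a \<Rightarrow> 'a::ab_group_add)" where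
  "commutator D E = (\<lambda>x. D (E x) - E (D x))"

section \<open>Restricted subalgebras, minimal \<open>p\<close>-envelope, tori and weights\<close>

text \<open>The \<open>[p]\<close>-map of a restricted Lie algebra of derivations is the \<open>p\<close>-th power of operators.\<close>

definition p_map :: "nat \<Rightarrow> ('a \<Rightarrow> 'a) \<Rightarrow> ('a \<Rightarrow> 'a)" where
  "p_map p D = D ^^ p"

definition restricted_subalgebra ::
  "('k::field \<Rightarrow> 'a::ab_group_add \<Rightarrow> 'a) \<Rightarrow> nat \<Rightarrow> ('a \<Rightarrow> 'a) set \<Rightarrow> bool"
where
  "restricted_subalgebra s p M \<longleftrightarrow> module.subspace (fscale s) M \<and>
     (\<forall>D\<in>M. \<forall>E\<in>M. commutator D E \<in> M) \<and> (\<forall>D\<in>M. p_map p D \<in> M)"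

text \<open>
  The derivations of an algebra form a restricted subalgebra of its endomorphisms.  In
  particular the intersection in \<open>p_envelope\<close> below is over a nonempty family.
\<close>

lemma restricted_subalgebra_derivations:
  fixes s :: "'k::field \<Rightarrow> 'a::ab_group_add \<Rightarrow> 'a"
  assumes s: "vector_space s" and A: "module.subspace s A" and p: "CHAR('k) = p" "p > 0"
    and cl: "\<And>x y. x \<in> A \<Longrightarrow> y \<in> A \<Longrightarrow> mul x y \<in> A"
    and al: "\<And>x x' y. x \<in> A \<Longrightarrow> x' \<in> A \<Longrightarrow> y \<in> A \<Longrightarrow> mul (x + x') y = mul x y + mul x' y"
    and ar: "\<And>x y y'. x \<in> A \<Longrightarrow> y \<in> A \<Longrightarrow> y' \<in> A \<Longrightarrow> mul x (y + y') = mul x y + mul x y'"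
    and sl: "\<And>c x y. x \<in> A \<Longrightarrow> y \<in> A \<Longrightarrow> mul (s c x) y = s c (mul x y)"
    and sr: "\<And>c x y. x \<in> A \<Longrightarrow> y \<in> A \<Longrightarrow> mul x (s c y) = s c (mul x y)"
  shows "restricted_subalgebra s p (derivations s mul A)"
proof -
  interpret vector_space s by fact
  interpret F: vector_space "fscale s :: 'k \<Rightarrow> ('a \<Rightarrow> 'a) \<Rightarrow> _"
    by (rule vector_space_fscale[OF s])
  have A0: "0 \<in> A" and Aa: "\<And>x y. x \<in> A \<Longrightarrow> y \<in> A \<Longrightarrow> x + y \<in> A"
    and As: "\<And>c x. x \<in> A \<Longrightarrow> s c x \<in> A"
    using A by (auto simp: subspace_def)
  have Am: "x - y \<in> A" if "x \<in> A" "y \<in> A" for x y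
    using subspace_diff[OF A that] .
  have ml: "mul (x - x') y = mul x y - mul x' y" if "x \<in> A" "x' \<in> A" "y \<in> A" for x x' y
    using al[of "x - x'" x' y] that Am by (simp add: algebra_simps)
  have mr: "mul y (x - x') = mul y x - mul y x'" if "x \<in> A" "x' \<in> A" "y \<in> A" for x x' y
    using ar[of y "x - x'" x'] that Am by (simp add: algebra_simps)
  have ml0: "mul 0 y = 0" and mr0: "mul y 0 = 0" if "y \<in> A" for y
    using al[of 0 0 y] ar[of y 0 0] that A0 by auto
  have I: "D \<in> derivations s mul A \<longleftrightarrow>
    (\<forall>x\<in>A. D x \<in> A) \<and> (\<forall>x. x \<notin> A \<longrightarrow> D x = 0) \<and>
    (\<forall>x\<in>A. \<forall>y\<in>A. D (x + y) = D x + D y) \<and> (\<forall>c. \<forall>x\<in>A. D (s c x) = s c (D x)) \<and>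
    (\<forall>x\<in>A. \<forall>y\<in>A. D (mul x y) = mul (D x) y + mul x (D y))" for D
    by (auto simp: derivations_def linear_maps_def)
  have dd: "D (x - y) = D x - D y" if D: "D \<in> derivations s mul A" and "x \<in> A" "y \<in> A" for D x y
  proof -
    have "D ((x - y) + y) = D (x - y) + D y"
      using D that Am unfolding I by blast
    then show ?thesis by (simp add: algebra_simps)
  qed
  have d0: "D 0 = 0" if D: "D \<in> derivations s mul A" for D
    using dd[OF D A0 A0] by simp
  have "F.subspace (derivations s mul A)"
    unfolding F.subspace_def
  proof (intro conjI ballI allI)
    show "0 \<in> derivations s mul A"
      by (auto simp: I A0 ml0 mr0)
  next
    fix D E assume "D \<in> derivations s mul A" "E \<in> derivations s mul A"
    then show "D + E \<in> derivations s mul A"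
      by (simp add: I Aa al ar scale_right_distrib algebra_simps)
  next
    fix c D assume "D \<in> derivations s mul A"
    then show "fscale s c D \<in> derivations s mul A"
      by (simp add: I As sl sr fscale_def scale_right_distrib mult.commute)
  qed
  moreover have "commutator D E \<in> derivations s mul A"
    if D: "D \<in> derivations s mul A" and E: "E \<in> derivations s mul A" for D E
  proof -
    have "D x \<in> A" "E x \<in> A" if "x \<in> A" for x
      using D E that unfolding I by auto
    moreover have "D (mul x y) = mul (D x) y + mul x (D y)" "E (mul x y) = mul (E x) y + mul x (E y)"
      "D (x + y) = D x + D y" "E (x + y) = E x + E y" if "x \<in> A" "y \<in> A" for x y
      using D E that unfolding I by auto
    moreover have "D (s c x) = s c (D x)" "E (s c x) = s c (E x)" if "x \<in> A" for x c
      using D E that unfolding I by auto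
    moreover have "D x = 0" "E x = 0" if "x \<notin> A" for x
      using D E that unfolding I by auto
    ultimately show ?thesis
      unfolding I commutator_def
      by (auto simp: Am cl ml mr d0[OF D] d0[OF E] scale_right_diff_distrib)
  qed
  moreover have "p_map p D \<in> derivations s mul A" if D: "D \<in> derivations s mul A" for D
  proof -
    have DA: "(D ^^ n) x \<in> A" if "x \<in> A" for n x
      using that D by (induction n) (auto simp: I)
    have out: "(D ^^ Suc n) x = 0" if "x \<notin> A" for n x
      using that D d0[OF D] by (induction n) (auto simp: I)
    have add: "(D ^^ n) (x + y) = (D ^^ n) x + (D ^^ n) y" if "x \<in> A" "y \<in> A" for n x y
      using that D DA by (induction n) (auto simp: I)
    have scl: "(D ^^ n) (s c x) = s c ((D ^^ n) x)" if "x \<in> A" for n c x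
      using that D DA by (induction n) (auto simp: I)
    have sumA: "(\<Sum>k\<in>K. f k) \<in> A" if "finite K" "\<And>k. k \<in> K \<Longrightarrow> f k \<in> A" for K :: "nat set" and f
      using that by (induction K rule: finite_induct) (auto simp: A0 Aa)
    have Dsum: "D (\<Sum>k\<in>K. f k) = (\<Sum>k\<in>K. D (f k))"
      if "finite K" "\<And>k. k \<in> K \<Longrightarrow> f k \<in> A" for K :: "nat set" and f
      using that
    proof (induction K rule: finite_induct)
      case (insert k K)
      then have "f k \<in> A" "sum f K \<in> A" by (auto intro: sumA)
      then have "D (f k + sum f K) = D (f k) + D (sum f K)" using D unfolding I by blast
      then show ?case using insert by auto
    qed (simp add: d0[OF D])
    have leib: "(D ^^ n) (mul x y) =
        (\<Sum>k\<le>n. s (of_nat (n choose k)) (mul ((D ^^ k) x) ((D ^^ (n - k)) y)))"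
      if xy: "x \<in> A" "y \<in> A" for n x y
    proof (induction n)
      case (Suc n)
      let ?m = "\<lambda>i j. mul ((D ^^ i) x) ((D ^^ j) y)"
      have mA: "?m i j \<in> A" for i j using xy by (simp add: cl DA)
      have Dm: "D (?m i j) = ?m (Suc i) j + ?m i (Suc j)" for i j
      proof -
        have "(D ^^ i) x \<in> A" "(D ^^ j) y \<in> A" using xy DA by auto
        then show ?thesis using D unfolding I by auto
      qed
      have "(D ^^ Suc n) (mul x y) = D (\<Sum>k\<le>n. s (of_nat (n choose k)) (?m k (n - k)))"
        using Suc by simp
      also have "\<dots> = (\<Sum>k\<le>n. D (s (of_nat (n choose k)) (?m k (n - k))))"
        by (rule Dsum) (auto intro: As mA)
      also have "\<dots> = (\<Sum>k\<le>n. s (of_nat (n choose k)) (D (?m k (n - k))))"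
      proof -
        have "D (s c (?m i j)) = s c (D (?m i j))" for c i j
          using D mA[of i j] unfolding I by blast
        then show ?thesis by simp
      qed
      also have "\<dots> = (\<Sum>k\<le>n. s (of_nat (n choose k)) (?m (Suc k) (n - k))) +
          (\<Sum>k\<le>n. s (of_nat (n choose k)) (?m k (Suc n - k)))"
        by (simp only: Dm scale_right_distrib sum.distrib)
           (intro arg_cong2[where f = "(+)"] sum.cong refl, auto simp: Suc_diff_le)
      also have "(\<Sum>k\<le>n. s (of_nat (n choose k)) (?m k (Suc n - k))) =
          (\<Sum>k\<le>Suc n. s (of_nat (n choose k)) (?m k (Suc n - k)))"
        by (simp add: binomial_eq_0)
      also have "\<dots> = ?m 0 (Suc n) + (\<Sum>k\<le>n. s (of_nat (n choose Suc k)) (?m (Suc k) (n - k)))"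
        by (subst sum.atMost_Suc_shift) simp
      also have "(\<Sum>k\<le>n. s (of_nat (n choose k)) (?m (Suc k) (n - k))) +
          (?m 0 (Suc n) + (\<Sum>k\<le>n. s (of_nat (n choose Suc k)) (?m (Suc k) (n - k)))) =
          ?m 0 (Suc n) + (\<Sum>k\<le>n. s (of_nat (Suc n choose Suc k)) (?m (Suc k) (n - k)))"
        by (simp add: scale_left_distrib sum.distrib algebra_simps)
      also have "\<dots> = (\<Sum>k\<le>Suc n. s (of_nat (Suc n choose k)) (?m k (Suc n - k)))"
        by (subst sum.atMost_Suc_shift) (simp del: binomial_Suc_Suc)
      finally show ?case .
    qed simp
    have pr: "prime p"
      using p prime_CHAR_semidom[where ?'a = 'k] by simp
    have mulp: "(D ^^ p) (mul x y) = mul ((D ^^ p) x) y + mul x ((D ^^ p) y)"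
      if "x \<in> A" "y \<in> A" for x y
    proof -
      have z: "(of_nat (p choose k) :: 'k) = 0" if "k \<in> {..p} - {0, p}" for k
        using that pr p(1) dvd_choose_prime[of k p] by (auto simp: of_nat_eq_0_iff_char_dvd)
      have "(D ^^ p) (mul x y) =
          (\<Sum>k\<in>{0, p}. s (of_nat (p choose k)) (mul ((D ^^ k) x) ((D ^^ (p - k)) y)))"
        unfolding leib[OF that] by (rule sum.mono_neutral_right) (auto simp: z)
      then show ?thesis using p(2) by (simp add: add.commute)
    qed
    obtain q where "p = Suc q" using p(2) by (cases p) auto
    then have "\<forall>x. x \<notin> A \<longrightarrow> (D ^^ p) x = 0" using out by blast
    then show ?thesis
      unfolding I p_map_def by (simp add: DA add scl mulp)
  qed
  ultimately show ?thesis
    unfolding restricted_subalgebra_def by blast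
qed

definition ad :: "('a \<Rightarrow> 'a::ab_group_add) set \<Rightarrow> ('a \<Rightarrow> 'a) \<Rightarrow> ('a \<Rightarrow> 'a) \<Rightarrow> ('a \<Rightarrow> 'a)" where
  "ad L x = (\<lambda>y. if y \<in> L then commutator x y else 0)"

definition p_envelope ::
  "('k::field \<Rightarrow> ('a \<Rightarrow> 'a) \<Rightarrow> ('a \<Rightarrow> 'a)) \<Rightarrow> nat \<Rightarrow> ('a \<Rightarrow> 'a::ab_group_add) set \<Rightarrow>
    (('a \<Rightarrow> 'a) \<Rightarrow> ('a \<Rightarrow> 'a)) set"
where
  "p_envelope s p L =
    \<Inter>{M. M \<subseteq> derivations s commutator L \<and> restricted_subalgebra s p M \<and> ad L ` L \<subseteq> M}"

definition semisimple_elt :: "('k::field \<Rightarrow> 'a::ab_group_add \<Rightarrow> 'a) \<Rightarrow> nat \<Rightarrow> ('a \<Rightarrow> 'a) \<Rightarrow> bool" where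
  "semisimple_elt s p x \<longleftrightarrow> x \<in> module.span (fscale s) {(p_map p ^^ i) x | i. i \<ge> 1}"

definition torus :: "('k::field \<Rightarrow> 'a::ab_group_add \<Rightarrow> 'a) \<Rightarrow> nat \<Rightarrow> ('a \<Rightarrow> 'a) set \<Rightarrow> bool" where
  "torus s p t \<longleftrightarrow> restricted_subalgebra s p t \<and>
     (\<forall>x\<in>t. \<forall>y\<in>t. commutator x y = 0) \<and> (\<forall>x\<in>t. semisimple_elt s p x)"

definition Lie_p ::
  "('k::field \<Rightarrow> 'a::ab_group_add \<Rightarrow> 'a) \<Rightarrow> nat \<Rightarrow> ('a \<Rightarrow> 'a) set \<Rightarrow> (('a \<Rightarrow> 'a) \<Rightarrow> 'k) set"
where
  "Lie_p s p t = {\<alpha> \<in> dual_space (fscale s) t. \<forall>h\<in>t. \<alpha> (p_map p h) = \<alpha> h ^ p}"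

text \<open>
  For \<open>h\<close> in the \<open>p\<close>-envelope and \<open>x\<close> in \<open>L\<close>, the bracket \<open>[h, x]\<close> is formed with \<open>x\<close>
  identified with \<open>ad L x\<close>.  It equals \<open>h x\<close>, as \<open>[h, ad x] = ad (h x)\<close>.
\<close>

lemma commutator_derivation_ad:
  assumes "0 \<in> L" "h \<in> derivations s commutator L" "x \<in> L" "x 0 = 0"
  shows "commutator h (ad L x) = ad L (h x)"
proof
  fix y
  have h0: "h 0 = 0"
    using assms(1,2) by (fastforce simp: derivations_def linear_maps_def)
  show "commutator h (ad L x) y = ad L (h x) y"
  proof (cases "y \<in> L")
    case True
    then have "h (commutator x y) = commutator (h x) y + commutator x (h y)" "h y \<in> L"
      using assms(2,3) by (auto simp: derivations_def linear_maps_def)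
    then show ?thesis
      using True by (simp add: commutator_def[of h] ad_def)
  next
    case False
    then have "h y = 0"
      using assms(2) by (auto simp: derivations_def linear_maps_def)
    moreover have "commutator x 0 = 0"
      using assms(4) by (simp add: commutator_def fun_eq_iff)
    ultimately show ?thesis
      using False h0 by (simp add: commutator_def[of h] ad_def assms(1))
  qed
qed

definition weight_space ::
  "('k::field \<Rightarrow> 'a::ab_group_add \<Rightarrow> 'a) \<Rightarrow> 'a set \<Rightarrow> ('a \<Rightarrow> 'a) set \<Rightarrow> (('a \<Rightarrow> 'a) \<Rightarrow> 'k) \<Rightarrow> 'a set"
where
  "weight_space s L t \<alpha> = {x \<in> L. \<forall>h\<in>t. h x = s (\<alpha> h) x}"

definition weights ::
  "('k::field \<Rightarrow> 'a::ab_group_add \<Rightarrow> 'a) \<Rightarrow> 'a set \<Rightarrow> ('a \<Rightarrow> 'a) set \<Rightarrow> (('a \<Rightarrow> 'a) \<Rightarrow> 'k) set"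
where
  "weights s L t = {\<alpha> \<in> dual_space (fscale s) t - {0}. weight_space s L t \<alpha> \<noteq> {0}}"

section \<open>Truncated polynomial algebras and divided power algebras\<close>

text \<open>
  The coordinates are numbered from \<open>0\<close>, and \<open>f a\<close> is the coefficient of the element \<open>f\<close>
  at the basis element with exponent \<open>a\<close>.
\<close>

type_synonym 'k coeffs = "(nat \<Rightarrow> nat) \<Rightarrow> 'k"

definition exponents :: "nat \<Rightarrow> nat \<Rightarrow> (nat \<Rightarrow> nat) \<Rightarrow> (nat \<Rightarrow> nat) set" where
  "exponents p m n = {a. (\<forall>i<m. a i < p ^ n i) \<and> (\<forall>i\<ge>m. a i = 0)}"

definition coeff_space :: "(nat \<Rightarrow> nat) set \<Rightarrow> 'k::field coeffs set" where
  "coeff_space I = {f. \<forall>a. a \<notin> I \<longrightarrow> f a = 0}"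

definition basis_elt :: "(nat \<Rightarrow> nat) \<Rightarrow> 'k::field coeffs" where
  "basis_elt a = (\<lambda>b. if b = a then 1 else 0)"

definition unit_exponent :: "nat \<Rightarrow> nat \<Rightarrow> nat" where
  "unit_exponent i = (\<lambda>j. if j = i then 1 else 0)"

abbreviation op_scale :: "'k::field \<Rightarrow> ('k coeffs \<Rightarrow> 'k coeffs) \<Rightarrow> ('k coeffs \<Rightarrow> 'k coeffs)" where
  "op_scale \<equiv> fscale (fscale (*))"

subsection \<open>The generalized Witt algebras\<close>

definition divided_power_mult ::
  "nat \<Rightarrow> nat \<Rightarrow> (nat \<Rightarrow> nat) \<Rightarrow> 'k::field coeffs \<Rightarrow> 'k coeffs \<Rightarrow> 'k coeffs"
where
  "divided_power_mult p m n f g = (\<lambda>c. if c \<in> exponents p m n then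
     \<Sum>(a, b) \<in> {(a, b). a \<in> exponents p m n \<and> b \<in> exponents p m n \<and> a + b = c}.
       of_nat (\<Prod>i<m. (a i + b i) choose a i) * f a * g b
     else 0)"

text \<open>
  As \<open>\<partial>\<^sub>i x\<^sup>(\<^sup>a\<^sup>) = x\<^sup>(\<^sup>a\<^sup>-\<^sup>\<epsilon>\<^sup>i\<^sup>)\<close>, the coefficient of \<open>\<partial>\<^sub>i f\<close> at \<open>a\<close> is that of \<open>f\<close> at \<open>a + \<epsilon>\<^sub>i\<close>.
\<close>

definition divided_power_partial :: "nat \<Rightarrow> 'k::field coeffs \<Rightarrow> 'k coeffs" where
  "divided_power_partial i f = (\<lambda>a. f (a + unit_exponent i))"

definition W :: "nat \<Rightarrow> nat \<Rightarrow> (nat \<Rightarrow> nat) \<Rightarrow> ('k::field coeffs \<Rightarrow> 'k coeffs) set" where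
  "W p m n =
    {(\<lambda>f. if f \<in> coeff_space (exponents p m n)
          then \<Sum>i<m. divided_power_mult p m n (u i) (divided_power_partial i f) else 0) | u.
     \<forall>i<m. u i \<in> coeff_space (exponents p m n)}"

subsection \<open>The Hamiltonian algebra of the form \<open>(1 + x\<^sub>1\<^sup>p\<^sup>-\<^sup>1 x\<^sub>2\<^sup>p\<^sup>-\<^sup>1) dx\<^sub>1 \<and> dx\<^sub>2\<close>\<close>

text \<open>The generators \<open>x\<^sub>1, x\<^sub>2\<close> of \<open>B\<^sub>2\<close> have the numbers \<open>0, 1\<close>.\<close>

abbreviation B2_exponents :: "nat \<Rightarrow> (nat \<Rightarrow> nat) set" where
  "B2_exponents p \<equiv> exponents p 2 (\<lambda>_. 1)"

definition B2 :: "nat \<Rightarrow> 'k::field coeffs set" where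
  "B2 p = coeff_space (B2_exponents p)"

definition B2_mult :: "nat \<Rightarrow> 'k::field coeffs \<Rightarrow> 'k coeffs \<Rightarrow> 'k coeffs" where
  "B2_mult p f g = (\<lambda>c. if c \<in> B2_exponents p then
     \<Sum>(a, b) \<in> {(a, b). a \<in> B2_exponents p \<and> b \<in> B2_exponents p \<and> a + b = c}. f a * g b
     else 0)"

definition B2_gen :: "nat \<Rightarrow> 'k::field coeffs" where
  "B2_gen i = basis_elt (unit_exponent i)"

definition B2_partial :: "nat \<Rightarrow> 'k::field coeffs \<Rightarrow> 'k coeffs" where
  "B2_partial i f = (\<lambda>a. of_nat (a i + 1) * f (a + unit_exponent i))"

definition W2 :: "nat \<Rightarrow> ('k::field coeffs \<Rightarrow> 'k coeffs) set" where
  "W2 p = derivations (fscale (*)) (B2_mult p) (B2 p)"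

text \<open>
  The pair \<open>(g\<^sub>1, g\<^sub>2)\<close> stands for the form \<open>g\<^sub>1 dx\<^sub>1 + g\<^sub>2 dx\<^sub>2\<close>, and a single function \<open>u\<close> for
  the form \<open>u dx\<^sub>1 \<and> dx\<^sub>2\<close>.  The Lie derivative along \<open>D\<close> is a derivation of the exterior
  algebra commuting with the exterior derivative, so that \<open>D (dx\<^sub>i) = d (D x\<^sub>i)\<close>.
\<close>

definition ext_deriv :: "'k::field coeffs \<Rightarrow> 'k coeffs \<times> 'k coeffs" where
  "ext_deriv f = (B2_partial 0 f, B2_partial 1 f)"

definition wedge ::
  "nat \<Rightarrow> 'k::field coeffs \<times> 'k coeffs \<Rightarrow> 'k coeffs \<times> 'k coeffs \<Rightarrow> 'k coeffs"
where
  "wedge p g h = B2_mult p (fst g) (snd h) - B2_mult p (snd g) (fst h)"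

definition lie_derivative_2form ::
  "nat \<Rightarrow> ('k::field coeffs \<Rightarrow> 'k coeffs) \<Rightarrow> 'k coeffs \<Rightarrow> 'k coeffs"
where
  "lie_derivative_2form p D u = D u + B2_mult p u
     (wedge p (ext_deriv (D (B2_gen 0))) (ext_deriv (B2_gen 1)) +
      wedge p (ext_deriv (B2_gen 0)) (ext_deriv (D (B2_gen 1))))"

definition omega_tau :: "nat \<Rightarrow> 'k::field coeffs" where
  "omega_tau p = basis_elt (\<lambda>_. 0) + basis_elt (\<lambda>i. if i < 2 then p - 1 else 0)"

definition H2_tau :: "nat \<Rightarrow> ('k::field coeffs \<Rightarrow> 'k coeffs) set" where
  "H2_tau p = {D \<in> W2 p. lie_derivative_2form p D (omega_tau p) = 0}"

definition derived_algebra ::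
  "('k::field \<Rightarrow> ('a \<Rightarrow> 'a) \<Rightarrow> ('a \<Rightarrow> 'a)) \<Rightarrow> ('a \<Rightarrow> 'a::ab_group_add) set \<Rightarrow> ('a \<Rightarrow> 'a) set"
where
  "derived_algebra s L = module.span s {commutator D E | D E. D \<in> L \<and> E \<in> L}"

definition H2_tau_derived :: "nat \<Rightarrow> ('k::field coeffs \<Rightarrow> 'k coeffs) set" where
  "H2_tau_derived p = derived_algebra op_scale (H2_tau p)"

end

theory Submission
  imports Defs "HOL-Number_Theory.Cong"
begin

text \<open>
  Both algebras consist of derivations of a commutative local algebra \<open>A\<close>, the divided power
  algebra or \<open>B\<^sub>2\<close>, and their minimal \<open>p\<close>-envelopes act on \<open>A\<close> in the same way.  A torus thus becomes a
  torus \<open>T\<close> of derivations of \<open>A\<close>, and the heart of the matter is that every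
  \<open>\<alpha> \<in> Lie\<^sub>p(T, k)\<close> is a weight on \<open>A\<close> (\<open>weight_in_algebra\<close>).

  For this, \<open>A\<close> is spanned by weight vectors, since the elements of \<open>T\<close> are roots of separable
  polynomials and commute.  Let a coordinate be a weight vector with nonzero differential at the
  maximal ideal.  By Nakayama's lemma a derivation in \<open>T\<close> that kills all coordinates is \<open>0\<close>, so
  \<open>\<alpha>\<close> is a linear combination of weights of coordinates; as \<open>\<alpha>\<close> and the weights turn the
  \<open>[p]\<close>-map into the \<open>p\<close>-th power, a minimal such combination has its coefficients in the prime
  field.  It remains to see that the weights on \<open>A\<close> are stable under addition of the weight \<open>\<lambda>\<close> of a
  coordinate \<open>x\<close>.  If \<open>f\<close> has weight \<open>\<beta>\<close> and \<open>x f \<noteq> 0\<close>, then \<open>x f\<close> has weight \<open>\<beta> + \<lambda>\<close>.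
  Otherwise \<open>f = x\<^sup>p\<^sup>-\<^sup>1 g\<close>, because in characteristic \<open>p\<close> the annihilator of a coordinate
  consists of multiples of its \<open>(p-1)\<close>-st power, and some component of \<open>g\<close> has weight
  \<open>\<beta> - (p-1) \<lambda> = \<beta> + \<lambda>\<close>.

  The two algebras are then reached from \<open>A\<close> in different ways.  \<open>W(m,n)\<close> is a free
  \<open>A\<close>-module, and multiplying a weight vector of it that is nonzero at the origin by weight
  vectors of \<open>A\<close> yields all characters.  The Hamiltonian algebra is, up to constants, \<open>B\<^sub>2\<close> with the
  Poisson bracket of \<open>\<omega>\<close>, and \<open>f \<mapsto> {f, -}\<close> is equivariant and kills no vector of nonzero weight.
\<close>

section \<open>Semisimple operators and joint eigenvectors\<close>

context vector_space
begin

text \<open>The operator \<open>q(h)\<close> applied to \<open>v\<close>, evaluated by Horner's rule.\<close>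

definition operator_poly :: "('b \<Rightarrow> 'b) \<Rightarrow> 'a poly \<Rightarrow> 'b \<Rightarrow> 'b" where
  "operator_poly h q v = fold_coeffs (\<lambda>c w. scale c v + h w) q 0"

end

text \<open>
  The elements of a Lie algebra are functions on the whole type, but they are linear only on a
  subspace.  Eigenspaces are again such subspaces, which is why the locale speaks of the
  behaviour on \<open>V\<close> only.
\<close>

locale linear_on = vector_space scale
  for scale :: "'k::field \<Rightarrow> 'b::ab_group_add \<Rightarrow> 'b" +
  fixes V :: "'b set" and h :: "'b \<Rightarrow> 'b"
  assumes V: "subspace V"
    and closed: "x \<in> V \<Longrightarrow> h x \<in> V"
    and add: "x \<in> V \<Longrightarrow> y \<in> V \<Longrightarrow> h (x + y) = h x + h y"
    and scl: "x \<in> V \<Longrightarrow> h (scale c x) = scale c (h x)"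
begin

lemma V0: "0 \<in> V" and Va: "x \<in> V \<Longrightarrow> y \<in> V \<Longrightarrow> x + y \<in> V" and Vs: "x \<in> V \<Longrightarrow> scale c x \<in> V"
  and Vd: "x \<in> V \<Longrightarrow> y \<in> V \<Longrightarrow> x - y \<in> V"
  using V subspace_diff[OF V] by (auto simp: subspace_def)

lemma zero: "h 0 = 0"
  using scl[OF V0, of 0] by simp

lemma diff: "x \<in> V \<Longrightarrow> y \<in> V \<Longrightarrow> h (x - y) = h x - h y"
  using add[of "x - y" y] Vd by (simp add: algebra_simps)

lemma sum_mem: "(\<And>i. i \<in> K \<Longrightarrow> f i \<in> V) \<Longrightarrow> sum f K \<in> V"
  using subspace_sum[OF V] by blast

lemma sum: "(\<And>i. i \<in> K \<Longrightarrow> f i \<in> V) \<Longrightarrow> h (sum f K) = (\<Sum>i\<in>K. h (f i))"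
  by (induction K rule: infinite_finite_induct) (auto simp: zero add sum_mem)

lemma funpow_closed: "x \<in> V \<Longrightarrow> (h ^^ n) x \<in> V"
  by (induction n) (auto simp: closed)

lemma funpow_linear_on: "linear_on scale V (h ^^ n)"
proof (unfold_locales, rule V)
  show "(h ^^ n) (x + y) = (h ^^ n) x + (h ^^ n) y" if "x \<in> V" "y \<in> V" for x y
    using that by (induction n) (auto simp: funpow_closed add)
  show "(h ^^ n) (scale c x) = scale c ((h ^^ n) x)" if "x \<in> V" for c x
    using that by (induction n) (auto simp: funpow_closed scl)
qed (rule funpow_closed)

lemma operator_poly_0 [simp]: "operator_poly h 0 v = 0"
  by (simp add: operator_poly_def)

lemma operator_poly_pCons: "operator_poly h (pCons c q) v = scale c v + h (operator_poly h q v)"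
  by (cases "c = 0 \<and> q = 0") (auto simp: operator_poly_def zero)

lemma operator_poly_closed: "v \<in> V \<Longrightarrow> operator_poly h q v \<in> V"
  by (induction q) (auto simp: V0 operator_poly_pCons Va Vs closed)

lemma operator_poly_add:
  "v \<in> V \<Longrightarrow> operator_poly h (q + r) v = operator_poly h q v + operator_poly h r v"
  by (induction q r rule: poly_induct2)
     (auto simp: operator_poly_pCons add operator_poly_closed scale_left_distrib)

lemma operator_poly_smult: "v \<in> V \<Longrightarrow> operator_poly h (smult c q) v = scale c (operator_poly h q v)"
  by (induction q) (auto simp: operator_poly_pCons operator_poly_closed scale_right_distrib scl)

lemma operator_poly_diff:
  "v \<in> V \<Longrightarrow> operator_poly h (q - r) v = operator_poly h q v - operator_poly h r v"
  using operator_poly_add[of v q "smult (-1) r"] operator_poly_smult[of v "-1" r] by simp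

lemma operator_poly_monom: "v \<in> V \<Longrightarrow> operator_poly h (monom c n) v = scale c ((h ^^ n) v)"
  by (induction n) (auto simp: monom_0 monom_Suc operator_poly_pCons zero scl funpow_closed)

lemma operator_poly_linear_factor:
  "v \<in> V \<Longrightarrow> operator_poly h ([:- r, 1:] * q) v = h (operator_poly h q v) - scale r (operator_poly h q v)"
  using operator_poly_add[of v "smult (- r) q" "pCons 0 q"] operator_poly_smult[of v "- r" q]
  by (simp add: operator_poly_pCons)

lemma operator_poly_arg:
  assumes "v \<in> V"
  shows "operator_poly h q (h v - scale r v) = operator_poly h ([:- r, 1:] * q) v"
  using assms
proof (induction q)
  case 0
  then show ?case by simp
next
  case (pCons c q)
  note cl = operator_poly_closed[OF pCons.prems] closed Vs Vd
  have e: "operator_poly h ([:- r, 1:] * pCons c q) v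
      = h (operator_poly h (pCons c q) v) - scale r (operator_poly h (pCons c q) v)"
    by (rule operator_poly_linear_factor[OF pCons.prems])
  have "operator_poly h (pCons c q) (h v - scale r v)
      = scale c (h v - scale r v) + h (operator_poly h ([:- r, 1:] * q) v)"
    by (simp add: operator_poly_pCons pCons.IH[OF pCons.prems])
  also have "\<dots> = h (operator_poly h (pCons c q) v) - scale r (operator_poly h (pCons c q) v)"
    unfolding operator_poly_linear_factor[OF pCons.prems] operator_poly_pCons
    using pCons.prems
    by (simp add: add scl diff cl scale_right_distrib scale_right_diff_distrib mult.commute
        algebra_simps)
  finally show ?case using e by simp
qed

lemma span_image_subset:
  assumes "S \<subseteq> V" "subspace U" "\<And>x. x \<in> S \<Longrightarrow> h x \<in> U" "x \<in> span S"
  shows "h x \<in> U"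
proof -
  have "x \<in> V \<and> h x \<in> U"
    using assms(4)
  proof (induction rule: span_induct_alt)
    case base
    show ?case using assms(2) by (simp add: zero V0 subspace_0)
  next
    case (step c x y)
    then show ?case using assms
      by (auto simp: add scl Va Vs subset_iff intro!: subspace_add subspace_scale)
  qed
  then show ?thesis ..
qed

text \<open>
  Leibniz' formula for the family \<open>X i j\<close> of the products of an \<open>i\<close>-th and a \<open>j\<close>-th derivative;
  the product may be any bilinear operation.
\<close>

lemma leibniz:
  assumes "\<And>i j. X i j \<in> V" "\<And>i j. h (X i j) = X (Suc i) j + X i (Suc j)"
  shows "(h ^^ n) (X 0 0) = (\<Sum>k\<le>n. scale (of_nat (n choose k)) (X k (n - k)))"
proof (induction n)
  case (Suc n)
  have "(h ^^ Suc n) (X 0 0) = (\<Sum>k\<le>n. h (scale (of_nat (n choose k)) (X k (n - k))))"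
    using Suc sum[of "{..n}" "\<lambda>k. scale (of_nat (n choose k)) (X k (n - k))"] by (simp add: Vs assms(1))
  also have "\<dots> = (\<Sum>k\<le>n. scale (of_nat (n choose k)) (X (Suc k) (n - k))) +
      (\<Sum>k\<le>n. scale (of_nat (n choose k)) (X k (Suc n - k)))"
    by (simp add: scl assms scale_right_distrib sum.distrib Suc_diff_le)
  also have "(\<Sum>k\<le>n. scale (of_nat (n choose k)) (X k (Suc n - k))) =
      (\<Sum>k\<le>Suc n. scale (of_nat (n choose k)) (X k (Suc n - k)))"
    by (simp add: binomial_eq_0)
  also have "\<dots> = X 0 (Suc n) + (\<Sum>k\<le>n. scale (of_nat (n choose Suc k)) (X (Suc k) (n - k)))"
    by (subst sum.atMost_Suc_shift) simp
  also have "(\<Sum>k\<le>n. scale (of_nat (n choose k)) (X (Suc k) (n - k))) + \<dots> =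
      X 0 (Suc n) + (\<Sum>k\<le>n. scale (of_nat (Suc n choose Suc k)) (X (Suc k) (n - k)))"
    by (simp add: scale_left_distrib sum.distrib algebra_simps)
  also have "\<dots> = (\<Sum>k\<le>Suc n. scale (of_nat (Suc n choose k)) (X k (Suc n - k)))"
    by (subst sum.atMost_Suc_shift) (simp del: binomial_Suc_Suc)
  finally show ?case .
qed simp

lemma leibniz_char:
  assumes "CHAR('k) = p" "p > 0"
    and "\<And>i j. X i j \<in> V" "\<And>i j. h (X i j) = X (Suc i) j + X i (Suc j)"
  shows "(h ^^ p) (X 0 0) = X p 0 + X 0 p"
proof -
  have pr: "prime p" using assms(1,2) prime_CHAR_semidom[where ?'a = 'k] by simp
  have z: "(of_nat (p choose k) :: 'k) = 0" if "k \<in> {..p} - {0, p}" for k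
    using that pr assms(1) dvd_choose_prime[of k p] by (auto simp: of_nat_eq_0_iff_char_dvd)
  have "(h ^^ p) (X 0 0) = (\<Sum>k\<in>{0, p}. scale (of_nat (p choose k)) (X k (p - k)))"
    unfolding leibniz[of X, OF assms(3,4)] by (rule sum.mono_neutral_right) (auto simp: z)
  then show ?thesis using assms(2) by (simp add: add.commute)
qed

text \<open>
  The eigencomponents come from dividing by \<open>h - r\<close> on the sum of the eigenspaces for the
  other roots, where it is invertible.
\<close>

lemma distinct_roots_span_eigenvectors:
  assumes "finite R" "v \<in> V" "operator_poly h (\<Prod>r\<in>R. [:- r, 1:]) v = 0"
  shows "v \<in> span {u \<in> V. \<exists>c\<in>R. h u = scale c u}"
  using assms
proof (induction R arbitrary: v rule: finite_induct)
  case empty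
  then have "v = 0" by (simp add: operator_poly_pCons one_pCons zero)
  then show ?case by (simp add: span_zero)
next
  case (insert r R)
  let ?E = "{u \<in> V. \<exists>c\<in>R. h u = scale c u}"
  have w: "h v - scale r v \<in> span ?E"
  proof (rule insert.IH)
    show "h v - scale r v \<in> V" using insert.prems by (simp add: closed Vs Vd)
    show "operator_poly h (\<Prod>r\<in>R. [:- r, 1:]) (h v - scale r v) = 0"
      using insert by (simp add: operator_poly_arg del: mult_pCons_left)
  qed
  have "\<exists>v'\<in>span ?E. v' \<in> V \<and> h v' - scale r v' = w" if "w \<in> span ?E" for w
    using that
  proof (induction rule: span_induct_alt)
    case base
    show ?case by (rule bexI[of _ 0]) (auto simp: zero span_zero V0)
  next
    case (step c x y)
    then obtain y' where y': "y' \<in> span ?E" "y' \<in> V" "h y' - scale r y' = y" by blast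
    obtain a where a: "a \<in> R" "h x = scale a x" and x: "x \<in> V" using step by auto
    have ar: "a - r \<noteq> 0" using a insert by auto
    have "scale (c / (a - r)) x + y' \<in> span ?E"
      using step(1) y' by (intro span_add span_scale) (auto intro: span_base)
    moreover have "h (scale (c / (a - r)) x + y') - scale r (scale (c / (a - r)) x + y')
        = scale (c / (a - r) * (a - r)) x + y"
      using a x y' by (simp add: add scl Vs scale_right_distrib scale_left_diff_distrib
          right_diff_distrib diff_divide_distrib mult.commute flip: y'(3))
    ultimately show ?case
      using ar x y'(2) by (intro bexI[of _ "scale (c / (a - r)) x + y'"]) (auto simp: Va Vs)
  qed
  then obtain v' where v': "v' \<in> span ?E" "v' \<in> V" "h v' - scale r v' = h v - scale r v"
    using w by blast
  have sub: "?E \<subseteq> {u \<in> V. \<exists>c\<in>insert r R. h u = scale c u}" by auto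
  have "h (v - v') = scale r (v - v')"
    unfolding diff[OF insert.prems(1) v'(2)] scale_right_diff_distrib
    using v'(3) by (simp add: algebra_simps)
  then have "v - v' \<in> span {u \<in> V. \<exists>c\<in>insert r R. h u = scale c u}"
    using Vd[OF insert.prems(1) v'(2)] by (intro span_base) auto
  from span_add[OF this subsetD[OF span_mono[OF sub] v'(1)]] show ?case by simp
qed

end

lemma p_map_funpow: "(p_map p ^^ i) h = h ^^ (p ^ i)"
  by (induction i arbitrary: h) (auto simp: p_map_def funpow_mult mult.commute)

text \<open>A polynomial with derivative \<open>1\<close> has no multiple root.\<close>

lemma separable_factorization:
  fixes Q :: "'k::alg_closed_field poly"
  assumes "pderiv Q = 1"
  obtains c R where "finite R" "c \<noteq> 0" "Q = smult c (\<Prod>r\<in>R. [:- r, 1:])"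
proof -
  have Q0: "Q \<noteq> 0" using assms by auto
  then obtain A where A: "Q = smult (lead_coeff Q) (\<Prod>x\<in>#A. [:-x, 1:])"
    using alg_closed_imp_factorization by blast
  have c1: "count A x \<le> 1" for x
  proof (rule ccontr)
    assume "\<not> count A x \<le> 1"
    then have "{#x, x#} \<subseteq># A" by (auto simp: subseteq_mset_def)
    then obtain B where B: "A = {#x, x#} + B" by (auto simp: subset_mset.le_iff_add)
    define r where "r = smult (lead_coeff Q) (\<Prod>x\<in>#B. [:-x, 1:])"
    have "Q = [:-x, 1:] * ([:-x, 1:] * r)"
      by (subst A) (simp add: B r_def del: mult_pCons_left)
    then have "poly (pderiv Q) x = 0"
      by (simp add: pderiv_mult del: mult_pCons_left)
    then show False using assms by simp
  qed
  have "A = mset_set (set_mset A)"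
  proof (rule multiset_eqI)
    fix x show "count A x = count (mset_set (set_mset A)) x"
      using c1[of x] by (cases "x \<in># A") (auto simp: le_Suc_eq count_eq_zero_iff)
  qed
  then have "(\<Prod>x\<in>#A. [:-x, 1:]) = (\<Prod>x\<in>set_mset A. [:-x, 1:])"
    by (metis prod_unfold_prod_mset)
  with A Q0 show ?thesis using that[of "set_mset A" "lead_coeff Q"] by auto
qed

text \<open>
  An element of the span of its \<open>[p]\<close>-powers is annihilated by \<open>X - \<Sum>\<^sub>i c\<^sub>i X\<^sup>p\<^sup>i\<close> with \<open>i \<ge> 1\<close>,
  a polynomial with derivative \<open>1\<close>.
\<close>

lemma semisimple_span_eigenvectors:
  fixes scale :: "'k::alg_closed_field \<Rightarrow> 'b::ab_group_add \<Rightarrow> 'b"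
  assumes h: "linear_on scale V h" and p: "CHAR('k) = p" and ss: "semisimple_elt scale p h"
  shows "V \<subseteq> module.span scale {u \<in> V. \<exists>c. h u = scale c u}"
proof
  interpret linear_on scale V h by (rule h)
  fix v assume v: "v \<in> V"
  interpret F: vector_space "fscale scale :: 'k \<Rightarrow> ('b \<Rightarrow> 'b) \<Rightarrow> _"
    by (rule vector_space_fscale) (rule vector_space_axioms)
  have "\<exists>q. pderiv q = 0 \<and> (\<forall>v\<in>V. operator_poly h q v = g v)"
    if "g \<in> F.span {(p_map p ^^ i) h | i. i \<ge> 1}" for g
    using that
  proof (induction rule: F.span_induct_alt)
    case base
    show ?case by (rule exI[of _ 0]) auto
  next
    case (step c x y)
    then obtain i where i: "i \<ge> 1" "x = h ^^ (p ^ i)" by (auto simp: p_map_funpow)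
    obtain q where q: "pderiv q = 0" "\<And>v. v \<in> V \<Longrightarrow> operator_poly h q v = y v" using step by blast
    have "(of_nat (p ^ i) :: 'k) = 0" using i p by (simp add: of_nat_eq_0_iff_char_dvd)
    then have "pderiv (monom c (p ^ i) + q) = 0"
      by (simp add: pderiv_add pderiv_monom q del: of_nat_power)
    then show ?case
      using q(2) by (intro exI[of _ "monom c (p ^ i) + q"])
        (auto simp: operator_poly_add operator_poly_monom i fscale_def)
  qed
  then obtain q where q: "pderiv q = 0" "\<And>v. v \<in> V \<Longrightarrow> operator_poly h q v = h v"
    using ss unfolding semisimple_elt_def by blast
  let ?Q = "[:0, 1:] - q"
  have "pderiv ?Q = 1" by (simp add: pderiv_diff q pderiv_pCons one_pCons)
  then obtain c R where R: "finite R" "c \<noteq> 0" "?Q = smult c (\<Prod>r\<in>R. [:- r, 1:])"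
    by (rule separable_factorization)
  have "operator_poly h ?Q v = 0"
    using v q by (simp add: operator_poly_diff operator_poly_pCons zero)
  then have "operator_poly h (\<Prod>r\<in>R. [:- r, 1:]) v = 0"
    unfolding R(3) using R(2) v by (simp add: operator_poly_smult)
  from distinct_roots_span_eigenvectors[OF R(1) v this]
  show "v \<in> span {u \<in> V. \<exists>c. h u = scale c u}"
    by (rule subsetD[OF span_mono, rotated]) auto
qed

text \<open>
  A further operator preserves each joint eigenspace of the operators it commutes with, and
  splits it by the preceding lemma.
\<close>

lemma commuting_semisimple_span_joint_eigenvectors:
  fixes scale :: "'k::alg_closed_field \<Rightarrow> 'b::ab_group_add \<Rightarrow> 'b" and B :: "('b \<Rightarrow> 'b) set"
  assumes "vector_space scale" and p: "CHAR('k) = p"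
    and "finite B"
    and lin: "\<And>b. b \<in> B \<Longrightarrow> linear_on scale V b"
    and comm: "\<And>b b' x. b \<in> B \<Longrightarrow> b' \<in> B \<Longrightarrow> x \<in> V \<Longrightarrow> b (b' x) = b' (b x)"
    and ss: "\<And>b. b \<in> B \<Longrightarrow> semisimple_elt scale p b"
  shows "V \<subseteq> module.span scale {u \<in> V. \<forall>b\<in>B. \<exists>c. b u = scale c u}"
  using \<open>finite B\<close> lin comm ss
proof (induction B rule: finite_induct)
  case empty
  interpret vector_space scale by fact
  show ?case by (auto intro: span_base)
next
  case (insert b B)
  interpret vector_space scale by fact
  let ?E = "{u \<in> V. \<forall>b\<in>insert b B. \<exists>c. b u = scale c u}"
  interpret b: linear_on scale V b by (rule insert.prems) simp
  have lin: "linear_on scale V b'" if "b' \<in> B" for b' using insert.prems(1) that by simp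
  have "u \<in> span ?E" if u: "u \<in> V" "\<forall>b\<in>B. \<exists>c. b u = scale c u" for u
  proof -
    obtain c where c: "\<And>b. b \<in> B \<Longrightarrow> b u = scale (c b) u" using u(2) by metis
    let ?U = "{w \<in> V. \<forall>b\<in>B. b w = scale (c b) w}"
    interpret U: linear_on scale ?U b
    proof
      show "subspace ?U"
        using b.V0 b.Va b.Vs
        by (auto simp: subspace_def scale_right_distrib linear_on.zero[OF lin]
            linear_on.add[OF lin] linear_on.scl[OF lin] mult.commute)
      show "b x \<in> ?U" if "x \<in> ?U" for x
      proof -
        have "b' (b x) = scale (c b') (b x)" if "b' \<in> B" for b'
        proof -
          have "b' x = scale (c b') x" "x \<in> V" using \<open>x \<in> ?U\<close> that by auto
          then show ?thesis using that insert.prems(2)[of b' b x] by (simp add: b.scl)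
        qed
        then show ?thesis using \<open>x \<in> ?U\<close> by (simp add: b.closed)
      qed
    qed (auto simp: b.add b.scl)
    have "?U \<subseteq> span {w \<in> ?U. \<exists>c. b w = scale c w}"
      by (rule semisimple_span_eigenvectors[OF U.linear_on_axioms p]) (auto intro: insert.prems)
    also have "\<dots> \<subseteq> span ?E" by (rule span_mono) auto
    finally show ?thesis using u c by blast
  qed
  then have "{u \<in> V. \<forall>b\<in>B. \<exists>c. b u = scale c u} \<subseteq> span ?E" by auto
  then have "span {u \<in> V. \<forall>b\<in>B. \<exists>c. b u = scale c u} \<subseteq> span ?E"
    by (simp add: span_minimal)
  moreover have "V \<subseteq> span {u \<in> V. \<forall>b\<in>B. \<exists>c. b u = scale c u}"
    by (rule insert.IH) (auto intro: insert.prems)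
  ultimately show ?case by blast
qed

lemma (in vector_space) eigenvector_of_span:
  assumes "D \<in> module.span (fscale scale) B" "\<And>b. b \<in> B \<Longrightarrow> \<exists>c. b u = scale c u"
  shows "\<exists>c. D u = scale c u"
proof -
  interpret F: vector_space "fscale scale :: 'a \<Rightarrow> ('c \<Rightarrow> 'b) \<Rightarrow> _"
    by (rule vector_space_fscale) (rule vector_space_axioms)
  show ?thesis
    using assms(1)
  proof (induction rule: F.span_induct_alt)
    case base
    show ?case by (rule exI[of _ 0]) simp
  next
    case (step c x y)
    then obtain a a' where "x u = scale a u" "y u = scale a' u" using assms(2) by blast
    then show ?case
      by (intro exI[of _ "c * a + a'"]) (simp add: fscale_def scale_left_distrib)
  qed
qed

lemma (in vector_space) finite_subset_span:
  assumes "v \<in> span X"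
  obtains Y where "finite Y" "Y \<subseteq> X" "v \<in> span Y"
  using assms by (auto simp: span_explicit intro: span_sum span_scale span_base)

text \<open>Linear independence of distinct weight spaces, in the form in which it is used below.\<close>

lemma (in vector_space) weight_occurs_in_span:
  assumes lin: "\<And>h. h \<in> T \<Longrightarrow> linear_on scale V h"
    and X: "X \<subseteq> V" "\<And>x. x \<in> X \<Longrightarrow> \<exists>\<gamma>\<in>\<Gamma>. \<forall>h\<in>T. h x = scale (\<gamma> h) x"
    and v: "v \<in> span X" "v \<in> V" "v \<noteq> 0" "\<forall>h\<in>T. h v = scale (\<beta> h) v"
  shows "\<exists>\<gamma>\<in>\<Gamma>. \<forall>h\<in>T. \<gamma> h = \<beta> h"
proof (rule ccontr)
  assume neg: "\<not> ?thesis"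
  have "v = 0" if "finite Y" "Y \<subseteq> X" "v \<in> span Y" "v \<in> V" "\<forall>h\<in>T. h v = scale (\<beta> h) v" for Y v
    using that
  proof (induction Y arbitrary: v rule: finite_induct)
    case empty
    then show ?case by simp
  next
    case (insert x Y)
    obtain \<gamma> where \<gamma>: "\<gamma> \<in> \<Gamma>" "\<And>h. h \<in> T \<Longrightarrow> h x = scale (\<gamma> h) x" using X(2) insert.prems by blast
    then obtain h where h: "h \<in> T" "\<gamma> h \<noteq> \<beta> h" using neg by blast
    interpret h: linear_on scale V h by (rule lin) fact
    obtain c where c: "v - scale c x \<in> span Y" using insert.prems(2) by (auto simp: span_breakdown_eq)
    have xV: "x \<in> V" and YV: "Y \<subseteq> V" using insert.prems X(1) by auto
    have sp: "h w \<in> span Y \<and> w \<in> V" if "w \<in> span Y" for w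
      using that
    proof (induction rule: span_induct_alt)
      case base show ?case by (simp add: h.zero span_zero h.V0)
    next
      case (step a y w)
      then have "y \<in> X" "y \<in> V" using insert.prems YV by auto
      then obtain a' where "h y = scale a' y" using X(2) h(1) by blast
      then show ?case using step \<open>y \<in> V\<close>
        by (auto simp: h.add h.scl h.Va h.Vs intro!: span_add span_scale intro: span_base)
    qed
    let ?r = "v - scale c x"
    have "h ?r - scale (\<gamma> h) ?r \<in> span Y"
      by (rule span_diff[OF conjunct1[OF sp[OF c]] span_scale[OF c]])
    moreover have "h ?r - scale (\<gamma> h) ?r = scale (\<beta> h - \<gamma> h) v"
      using insert.prems \<gamma>(2)[OF h(1)] h(1) xV
      by (simp add: h.diff h.Vs h.scl scale_right_diff_distrib scale_left_diff_distrib mult.commute)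
    ultimately have "scale (inverse (\<beta> h - \<gamma> h)) (scale (\<beta> h - \<gamma> h) v) \<in> span Y"
      by (metis span_scale)
    then have "v \<in> span Y" using h(2) by simp
    then show ?case using insert by auto
  qed
  moreover obtain Y where "finite Y" "Y \<subseteq> X" "v \<in> span Y"
    using v(1) finite_subset_span by metis
  ultimately show False using v by blast
qed

section \<open>Tori of derivations of a local algebra\<close>

lemma sum_apply: "(\<Sum>i\<in>K. f i) x = (\<Sum>i\<in>K. f i x)"
  for f :: "'i \<Rightarrow> 'a \<Rightarrow> 'b::ab_group_add"
  by (induction K rule: infinite_finite_induct) auto

text \<open>
  The \<open>p\<close> elements of the prime field are roots of \<open>X\<^sup>p - X\<close>, which has no more than \<open>p\<close> roots.
\<close>

lemma prime_field_fixed_points: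
  fixes c :: "'k::field"
  assumes "CHAR('k) = p" "prime p" "c ^ p = c"
  shows "\<exists>a. c = of_nat a"
proof -
  let ?q = "monom 1 p - [:0, 1:] :: 'k poly"
  have "coeff ?q p = 1"
    using prime_gt_1_nat[OF assms(2)] by (simp add: coeff_pCons split: nat.split)
  then have q0: "?q \<noteq> 0" by (metis coeff_0 zero_neq_one)
  have "degree ?q \<le> p"
    using prime_gt_1_nat[OF assms(2)] by (intro degree_diff_le) (auto simp: degree_monom_le)
  then have card: "card {x. poly ?q x = 0} \<le> p"
    using card_poly_roots_bound[OF q0] by linarith
  have roots: "{x. poly ?q x = 0} = {x. x ^ p = x}" by (auto simp: poly_monom)
  have inj: "inj_on (of_nat :: nat \<Rightarrow> 'k) {..<p}"
  proof (rule linorder_inj_onI)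
    fix i j assume ij: "i < j" "i \<in> {..<p}" "j \<in> {..<p}"
    show "(of_nat i :: 'k) \<noteq> of_nat j"
    proof
      assume "(of_nat i :: 'k) = of_nat j"
      then have "(of_nat (j - i) :: 'k) = 0" using ij by (simp add: of_nat_diff)
      then have "p dvd j - i" using assms(1) by (simp only: of_nat_eq_0_iff_char_dvd)
      then show False using ij by (auto dest: dvd_imp_le)
    qed
  qed auto
  have fermat: "(of_nat a :: 'k) ^ p = of_nat a" for a
  proof (induction a)
    case (Suc a)
    have "(of_nat a + 1 :: 'k) ^ p = of_nat a ^ p + 1 ^ p"
      using assms(1,2) by (simp add: freshmans_dream)
    then show ?case using Suc by (simp add: add.commute)
  qed (use assms(2) in \<open>simp add: prime_gt_0_nat\<close>)
  have "of_nat ` {..<p} = {x :: 'k. x ^ p = x}"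
  proof (rule card_seteq)
    show "finite {x :: 'k. x ^ p = x}" using poly_roots_finite[OF q0] roots by simp
    show "card {x :: 'k. x ^ p = x} \<le> card (of_nat ` {..<p} :: 'k set)"
      using card roots card_image[OF inj] by simp
  qed (use fermat in auto)
  then show ?thesis using assms(3) by blast
qed

text \<open>
  A finite-dimensional commutative local algebra \<open>A\<close> with residue field \<open>k\<close>, filtered by ideals \<open>F k\<close>
  containing the powers of the maximal ideal \<open>F 1\<close>.  It has generators \<open>y j\<close> and as many derivations
  \<open>d j\<close>, which are dual to the generators modulo the maximal ideal.
\<close>

locale nilpotent_local_algebra = vector_space scale
  for scale :: "'k::alg_closed_field \<Rightarrow> 'b::ab_group_add \<Rightarrow> 'b" +
  fixes p :: nat and A :: "'b set" and mul :: "'b \<Rightarrow> 'b \<Rightarrow> 'b" and one :: 'b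
    and F :: "nat \<Rightarrow> 'b set" and K :: nat and Bs :: "'b set"
    and J :: "'j set" and d :: "'j \<Rightarrow> 'b \<Rightarrow> 'b" and y :: "'j \<Rightarrow> 'b"
  assumes p: "CHAR('k) = p" "p > 0"
    and A: "subspace A"
    and mul_closed [simp]: "mul a b \<in> A"
    and mul_comm: "mul a b = mul b a"
    and mul_assoc: "mul (mul a b) c = mul a (mul b c)"
    and mul_add: "mul a (b + c) = mul a b + mul a c"
    and mul_scale: "mul a (scale r b) = scale r (mul a b)"
    and one: "one \<in> A" "one \<noteq> 0" and mul_one: "a \<in> A \<Longrightarrow> mul one a = a"
    and F: "subspace (F k)" and F_anti: "F (Suc k) \<subseteq> F k" and F0: "F 0 = A" and FK: "F K = {0}"
    and F_mul: "a \<in> F (Suc 0) \<Longrightarrow> b \<in> F k \<Longrightarrow> mul a b \<in> F (Suc k)"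
    and residue: "a \<in> A \<Longrightarrow> \<exists>c. a - scale c one \<in> F (Suc 0)"
    and Bs: "finite Bs" "Bs \<subseteq> A" "A \<subseteq> span Bs"
    and J: "finite J"
    and d: "j \<in> J \<Longrightarrow> d j \<in> derivations scale mul A"
    and y: "j \<in> J \<Longrightarrow> y j \<in> A"
    and dy: "i \<in> J \<Longrightarrow> j \<in> J \<Longrightarrow> d i (y j) - (if i = j then one else 0) \<in> F (Suc 0)"
    and generated: "D \<in> derivations scale mul A \<Longrightarrow> (\<And>j. j \<in> J \<Longrightarrow> D (y j) = 0) \<Longrightarrow> x \<in> A \<Longrightarrow> D x = 0"
begin

abbreviation "\<mm> \<equiv> F (Suc 0)"
abbreviation "Der \<equiv> derivations scale mul A"

interpretation Op: vector_space "fscale scale :: 'k \<Rightarrow> ('b \<Rightarrow> 'b) \<Rightarrow> _"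
  by (rule vector_space_fscale) (rule vector_space_axioms)

lemma A_closed [simp]: "0 \<in> A" "a \<in> A \<Longrightarrow> b \<in> A \<Longrightarrow> a + b \<in> A" "a \<in> A \<Longrightarrow> scale c a \<in> A"
  "a \<in> A \<Longrightarrow> b \<in> A \<Longrightarrow> a - b \<in> A"
  using A subspace_diff[OF A] by (auto simp: subspace_def)

lemma F_A: "a \<in> F k \<Longrightarrow> a \<in> A"
  using F_anti F0 by (induction k) auto

lemma mul_add2: "mul (a + b) c = mul a c + mul b c"
  using mul_add[of c a b] by (simp add: mul_comm)

lemma mul_scale2: "mul (scale r a) b = scale r (mul a b)"
  using mul_scale[of b r a] by (simp add: mul_comm)

lemma mul_0 [simp]: "mul a 0 = 0" "mul 0 a = 0"
  using mul_scale[of a 0 0] mul_scale2[of 0 0 a] by auto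

lemma mul_diff: "mul a (b - c) = mul a b - mul a c"
  using mul_add[of a "b - c" c] by (simp add: algebra_simps)

lemma mul_diff2: "mul (a - b) c = mul a c - mul b c"
  using mul_diff[of c a b] by (simp add: mul_comm)

lemma mul_left_comm: "mul a (mul b c) = mul b (mul a c)"
  by (metis mul_assoc mul_comm)

lemma mul_sum: "mul a (sum f S) = (\<Sum>i\<in>S. mul a (f i))"
  by (induction S rule: infinite_finite_induct) (auto simp: mul_add)

lemma mul_linear_on: "linear_on scale A (mul a)"
  by unfold_locales (auto simp: A mul_add mul_scale)

lemma mul_one_right: "a \<in> A \<Longrightarrow> mul a one = a"
  using mul_one mul_comm by metis

lemma prime_p: "prime p"
  using p prime_CHAR_semidom[where ?'a = 'k] by simp

lemma Der_iff: "D \<in> Der \<longleftrightarrow> linear_on scale A D \<and> (\<forall>x. x \<notin> A \<longrightarrow> D x = 0) \<and>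
    (\<forall>a\<in>A. \<forall>b\<in>A. D (mul a b) = mul (D a) b + mul a (D b))"
  unfolding derivations_def linear_maps_def linear_on_def linear_on_axioms_def mem_Collect_eq
  using A vector_space_axioms by blast

lemma Der_linear: "D \<in> Der \<Longrightarrow> linear_on scale A D"
  by (simp only: Der_iff)

lemma Der_mul: "D \<in> Der \<Longrightarrow> a \<in> A \<Longrightarrow> b \<in> A \<Longrightarrow> D (mul a b) = mul (D a) b + mul a (D b)"
  by (simp only: Der_iff)

lemma Der_outside: "D \<in> Der \<Longrightarrow> a \<notin> A \<Longrightarrow> D a = 0"
  by (simp add: derivations_def linear_maps_def)

lemma Der_restricted: "restricted_subalgebra scale p Der"
  by (rule restricted_subalgebra_derivations[OF vector_space_axioms A p])
     (auto simp: mul_add mul_add2 mul_scale mul_scale2)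

lemma Der_subspace: "Op.subspace Der"
  using Der_restricted by (simp add: restricted_subalgebra_def)

lemma Der_closed: "D \<in> Der \<Longrightarrow> D x \<in> A"
  using linear_on.closed[OF Der_linear] by (cases "x \<in> A") (auto simp: Der_outside)

lemma Der_one: "D \<in> Der \<Longrightarrow> D one = 0"
  using Der_mul[of D one one] one Der_closed[of D one] by (simp add: mul_one mul_one_right)

text \<open>The inverse is a geometric series, finite because \<open>\<mm>\<close> is nilpotent.\<close>

lemma unit:
  assumes u: "u \<in> A" "u \<notin> \<mm>"
  obtains v where "v \<in> A" "mul u v = one"
proof -
  obtain c where c: "u - scale c one \<in> \<mm>" using residue u by blast
  have c0: "c \<noteq> 0" using c u by auto
  define g where "g = one - scale (inverse c) u"
  have "g = scale (- inverse c) (u - scale c one)"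
    using c0 by (simp add: g_def scale_right_diff_distrib)
  then have g: "g \<in> \<mm>" using subspace_scale[OF F c] by metis
  have ug: "u = scale c (one - g)" using c0 by (simp add: g_def)
  have pow: "(mul g ^^ i) one \<in> F i" for i
    by (induction i) (auto simp: F0 one F_mul[OF g])
  define v where "v = (\<Sum>i<K. (mul g ^^ i) one)"
  have v: "v \<in> A" unfolding v_def by (rule subspace_sum[OF A]) (use pow F_A in blast)
  have "mul (one - g) v = (\<Sum>i<K. (mul g ^^ i) one - (mul g ^^ Suc i) one)"
    unfolding v_def mul_sum mul_diff2
    by (rule sum.cong) (use F_A[OF pow] in \<open>auto simp: mul_one\<close>)
  also have "\<dots> = one - (mul g ^^ K) one" by (subst sum_lessThan_telescope') simp
  also have "\<dots> = one" using pow[of K] FK by simp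
  finally have "mul u (scale (inverse c) v) = one"
    using c0 by (simp add: ug mul_scale mul_scale2)
  then show thesis using that[of "scale (inverse c) v"] v by simp
qed

text \<open>
  Nakayama's lemma for the matrix \<open>(d i (z j))\<close>, which is the identity modulo the nilpotent
  ideal \<open>\<mm>\<close>.
\<close>

lemma nakayama:
  assumes z: "\<And>i j. i \<in> J \<Longrightarrow> j \<in> J \<Longrightarrow> d i (z j) - (if i = j then one else 0) \<in> \<mm>"
    and u: "\<And>j. j \<in> J \<Longrightarrow> u j \<in> A"
    and zero: "\<And>j. j \<in> J \<Longrightarrow> (\<Sum>i\<in>J. mul (u i) (d i (z j))) = 0"
    and j: "j \<in> J"
  shows "u j = 0"
proof -
  have "\<forall>j\<in>J. u j \<in> F k" for k
  proof (induction k)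
    case 0
    then show ?case using u by (simp add: F0)
  next
    case (Suc k)
    show ?case
    proof
      fix j assume j: "j \<in> J"
      have "(\<Sum>i\<in>J. mul (u i) (d i (z j) - (if i = j then one else 0)))
          = (\<Sum>i\<in>J. mul (u i) (d i (z j))) - (\<Sum>i\<in>J. if i = j then mul (u i) one else 0)"
        by (simp add: mul_diff sum_subtractf if_distrib[of "mul _"] cong: if_cong)
      also have "\<dots> = - u j"
        using j J u zero by (simp add: mul_one_right)
      finally have e: "u j = - (\<Sum>i\<in>J. mul (u i) (d i (z j) - (if i = j then one else 0)))" by simp
      have "(\<Sum>i\<in>J. mul (u i) (d i (z j) - (if i = j then one else 0))) \<in> F (Suc k)"
        using Suc j z F_mul by (intro subspace_sum[OF F]) (metis mul_comm)
      then show "u j \<in> F (Suc k)" by (subst e) (rule subspace_neg[OF F])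
    qed
  qed
  from this[of K] show ?thesis using FK j by auto
qed

lemma multiple_in_Der:
  assumes D: "D \<in> Der"
  shows "(\<lambda>x. mul a (D x)) \<in> Der"
proof -
  interpret D: linear_on scale A D by (rule Der_linear) fact
  show ?thesis
    unfolding Der_iff
  proof (intro conjI allI impI ballI)
    show "linear_on scale A (\<lambda>x. mul a (D x))"
      by unfold_locales (simp_all add: A D.add D.scl mul_add mul_scale)
    show "mul a (D x) = 0" if "x \<notin> A" for x
      using that by (simp add: Der_outside[OF D])
    show "mul a (D (mul b c)) = mul (mul a (D b)) c + mul b (mul a (D c))"
      if "b \<in> A" "c \<in> A" for b c
      using that by (simp add: Der_mul[OF D] mul_add mul_assoc mul_left_comm[of b a])
  qed
qed

lemma combination_in_Der:
  "(\<lambda>x. \<Sum>j\<in>J. mul (u j) (d j x)) \<in> Der"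
proof -
  have "(\<Sum>j\<in>J. (\<lambda>x. mul (u j) (d j x))) \<in> Der"
    by (intro Op.subspace_sum[OF Der_subspace] multiple_in_Der d)
  moreover have "(\<Sum>j\<in>J. (\<lambda>x. mul (u j) (d j x))) = (\<lambda>x. \<Sum>j\<in>J. mul (u j) (d j x))"
    by (rule ext) (simp only: sum_apply)
  ultimately show ?thesis by simp
qed

text \<open>
  The coefficients are found by successive approximation: what is still missing at the generator
  \<open>y j\<close> is added to the \<open>j\<close>-th coefficient, which raises the order of the remainder by one.
\<close>

lemma derivation_combination:
  assumes D: "D \<in> Der"
  shows "\<exists>u. (\<forall>j\<in>J. u j \<in> A) \<and> D = (\<lambda>x. \<Sum>j\<in>J. mul (u j) (d j x))"
proof -
  have "\<exists>u. (\<forall>j\<in>J. u j \<in> A) \<and> (\<forall>l\<in>J. D (y l) - (\<Sum>j\<in>J. mul (u j) (d j (y l))) \<in> F k)" for k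
  proof (induction k)
    case 0
    show ?case using D by (intro exI[of _ "\<lambda>_. 0"]) (auto simp: F0 Der_closed)
  next
    case (Suc k)
    then obtain u where u: "\<forall>j\<in>J. u j \<in> A"
      and r: "\<And>l. l \<in> J \<Longrightarrow> D (y l) - (\<Sum>j\<in>J. mul (u j) (d j (y l))) \<in> F k" by blast
    define r' where "r' l = D (y l) - (\<Sum>j\<in>J. mul (u j) (d j (y l)))" for l
    have rA: "r' l \<in> A" "r' l \<in> F k" if "l \<in> J" for l using r[OF that] F_A by (auto simp: r'_def)
    have "D (y l) - (\<Sum>j\<in>J. mul (u j + r' j) (d j (y l))) \<in> F (Suc k)" if l: "l \<in> J" for l
    proof -
      have "(\<Sum>j\<in>J. mul (r' j) (d j (y l) - (if j = l then one else 0)))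
          = (\<Sum>j\<in>J. mul (r' j) (d j (y l))) - (\<Sum>j\<in>J. if j = l then mul (r' j) one else 0)"
        by (simp add: mul_diff sum_subtractf if_distrib[of "mul _"] cong: if_cong)
      also have "(\<Sum>j\<in>J. if j = l then mul (r' j) one else 0) = r' l"
        using l J rA by (simp add: mul_one_right)
      finally have "D (y l) - (\<Sum>j\<in>J. mul (u j + r' j) (d j (y l)))
          = - (\<Sum>j\<in>J. mul (r' j) (d j (y l) - (if j = l then one else 0)))"
        by (simp add: mul_add2 sum.distrib r'_def)
      also have "\<dots> \<in> F (Suc k)"
        using rA dy l F_mul by (intro subspace_neg[OF F] subspace_sum[OF F]) (metis mul_comm)
      finally show ?thesis .
    qed
    then show ?case using u rA by (intro exI[of _ "\<lambda>j. u j + r' j"]) auto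
  qed
  from this[of K] obtain u where u: "\<And>j. j \<in> J \<Longrightarrow> u j \<in> A"
    and e: "\<And>l. l \<in> J \<Longrightarrow> D (y l) = (\<Sum>j\<in>J. mul (u j) (d j (y l)))"
    using FK by auto
  let ?E = "\<lambda>x. \<Sum>j\<in>J. mul (u j) (d j x)"
  have E: "?E \<in> Der" by (rule combination_in_Der)
  have "D - ?E \<in> Der" by (rule Op.subspace_diff[OF Der_subspace D E])
  then have "(D - ?E) x = 0" if "x \<in> A" for x
    by (rule generated[OF _ _ that]) (use e in auto)
  then have "D = ?E"
    using Der_outside[OF D] Der_outside[OF E] by (metis (no_types, lifting) ext diff_eq_diff_eq
        eq_iff_diff_eq_0 fun_diff_def)
  with u show ?thesis by blast
qed

text \<open>
  Finite dimensionality of the Lie algebra of derivations reduces the joint diagonalization of a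
  torus to finitely many operators.
\<close>

lemma Der_finite_span:
  "Der \<subseteq> Op.span ((\<lambda>(b, j) x. mul b (d j x)) ` (Bs \<times> J))" (is "_ \<subseteq> Op.span ?S")
proof
  fix D assume "D \<in> Der"
  then obtain u where u: "\<And>j. j \<in> J \<Longrightarrow> u j \<in> A" "D = (\<lambda>x. \<Sum>j\<in>J. mul (u j) (d j x))"
    using derivation_combination by blast
  have "(\<lambda>x. mul w (d j x)) \<in> Op.span ?S" if "w \<in> span Bs" "j \<in> J" for w j
    using that(1)
  proof (induction rule: span_induct_alt)
    case base
    show ?case using Op.span_zero by (simp add: zero_fun_def)
  next
    case (step c b w)
    have "(\<lambda>x. mul (scale c b + w) (d j x)) = fscale scale c (\<lambda>x. mul b (d j x)) + (\<lambda>x. mul w (d j x))"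
      by (auto simp: fun_eq_iff mul_add2 mul_scale2 fscale_def)
    then show ?case
      using step that(2) by (auto intro!: Op.span_add Op.span_scale intro: Op.span_base)
  qed
  then have "(\<Sum>j\<in>J. (\<lambda>x. mul (u j) (d j x))) \<in> Op.span ?S"
    using u(1) Bs(3) by (intro Op.span_sum) auto
  moreover have "(\<Sum>j\<in>J. (\<lambda>x. mul (u j) (d j x))) = D"
    by (auto simp: u(2) sum_apply fun_eq_iff)
  ultimately show "D \<in> Op.span ?S" by simp
qed

lemma finite_spanning_subset:
  assumes "T \<subseteq> Der"
  obtains B where "finite B" "B \<subseteq> T" "T \<subseteq> Op.span B"
proof -
  obtain B where B: "B \<subseteq> T" "Op.independent B" "T \<subseteq> Op.span B"
    using Op.maximal_independent_subset[of T] by metis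
  have "finite B"
    using Op.independent_span_bound[OF _ B(2)] B(1) assms Der_finite_span Bs(1) J
    by (meson finite_SigmaI finite_imageI order_trans)
  then show thesis using B that by blast
qed

text \<open>
  If some derivation \<open>D\<close> maps \<open>x\<close> to a unit \<open>u\<close>, the annihilator of \<open>x\<close> consists of multiples of
  \<open>x\<^sup>p\<^sup>-\<^sup>1\<close>, as for a variable in a truncated polynomial algebra.  Indeed, applying \<open>D\<close>
  repeatedly to \<open>x f = 0\<close> gives \<open>x\<^sup>i D\<^sup>i f = (-1)\<^sup>i i! u\<^sup>i f\<close>, and \<open>(p-1)!\<close> is invertible.
\<close>

lemma annihilator_of_coordinate:
  assumes D: "D \<in> Der" and x: "x \<in> A" "D x \<notin> \<mm>" and f: "f \<in> A" "mul x f = 0"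
  obtains g where "g \<in> A" "f = (mul x ^^ (p - 1)) g"
proof -
  interpret D: linear_on scale A D by (rule Der_linear) fact
  define u where "u = D x"
  have uA: "u \<in> A" unfolding u_def using x D.closed by simp
  have xA: "(mul x ^^ i) w \<in> A" if "w \<in> A" for i w using that by (induction i) auto
  have uAi: "(mul u ^^ i) w \<in> A" if "w \<in> A" for i w using that by (induction i) auto
  have comm: "(mul x ^^ i) (mul a w) = mul a ((mul x ^^ i) w)" for i a w
    by (induction i) (auto simp: mul_left_comm)
  have commu: "(mul u ^^ i) (mul a w) = mul a ((mul u ^^ i) w)" for i a w
    by (induction i) (auto simp: mul_left_comm)
  have xs: "(mul x ^^ i) (scale c w) = scale c ((mul x ^^ i) w)" for i c w
    by (induction i) (auto simp: mul_scale)
  have Dpow: "D ((mul x ^^ Suc i) w)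
      = (mul x ^^ Suc i) (D w) + scale (of_nat (Suc i)) (mul u ((mul x ^^ i) w))"
    if w: "w \<in> A" for i w
  proof (induction i)
    case 0
    show ?case using w x by (simp add: Der_mul[OF D] u_def add.commute)
  next
    case (Suc i)
    have "D ((mul x ^^ Suc (Suc i)) w) = mul u ((mul x ^^ Suc i) w) + mul x (D ((mul x ^^ Suc i) w))"
      using Der_mul[OF D x(1) xA[OF w, of "Suc i"]] by (simp add: u_def)
    also have "\<dots> = (mul x ^^ Suc (Suc i)) (D w) +
        scale (of_nat (Suc (Suc i))) (mul u ((mul x ^^ Suc i) w))"
      unfolding Suc using scale_left_distrib[of 1 1]
      by (simp add: mul_add mul_scale scale_left_distrib mul_left_comm[of x u])
    finally show ?case .
  qed
  have Df: "(D ^^ i) f \<in> A" for i using D.funpow_closed f by simp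
  have main: "(mul x ^^ i) ((D ^^ i) f) = scale ((- 1) ^ i * of_nat (fact i)) ((mul u ^^ i) f)" for i
  proof (induction i)
    case 0
    show ?case by simp
  next
    case (Suc i)
    have "(mul x ^^ Suc i) ((D ^^ i) f) = mul x (scale ((- 1) ^ i * of_nat (fact i)) ((mul u ^^ i) f))"
      by (simp flip: Suc)
    also have "\<dots> = scale ((- 1) ^ i * of_nat (fact i)) ((mul u ^^ i) (mul x f))"
      by (simp add: mul_scale commu)
    also have "\<dots> = 0" using f commu[of i 0] by simp
    finally have "D ((mul x ^^ Suc i) ((D ^^ i) f)) = 0" using D.zero by simp
    then have "(mul x ^^ Suc i) ((D ^^ Suc i) f)
        = - scale (of_nat (Suc i)) (mul u ((mul x ^^ i) ((D ^^ i) f)))"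
      unfolding Dpow[OF Df] by (simp add: eq_neg_iff_add_eq_0)
    also have "\<dots> = scale ((- 1) ^ Suc i * of_nat (fact (Suc i))) ((mul u ^^ Suc i) f)"
      unfolding Suc by (simp add: mul_scale mult.commute mult.left_commute distrib_left distrib_right flip: scale_minus_left)
    finally show ?case .
  qed
  define c where "c = (- 1 :: 'k) ^ (p - 1) * of_nat (fact (p - 1))"
  have "\<not> p dvd fact (p - 1)"
    using prime_p by (auto simp: prime_dvd_fact_iff prime_gt_0_nat dest: prime_gt_0_nat)
  then have "(of_nat (fact (p - 1)) :: 'k) \<noteq> 0" using p by (simp add: of_nat_eq_0_iff_char_dvd del: of_nat_fact)
  then have c: "c \<noteq> 0" by (simp add: c_def)
  obtain v where v: "v \<in> A" "mul u v = one" using unit uA x by (metis u_def)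
  have inv: "(mul v ^^ i) ((mul u ^^ i) w) = w" if w: "w \<in> A" for i w
    using w
  proof (induction i arbitrary: w)
    case (Suc i)
    have "(mul v ^^ Suc i) ((mul u ^^ Suc i) w) = mul v ((mul v ^^ i) ((mul u ^^ i) (mul u w)))"
      by (simp add: funpow_swap1)
    also have "\<dots> = w"
      using Suc by (simp add: mul_comm[of v u] v mul_one flip: mul_assoc)
    finally show ?case .
  qed simp
  let ?g = "scale (inverse c) ((mul v ^^ (p - 1)) ((D ^^ (p - 1)) f))"
  have cv: "(mul x ^^ i) ((mul v ^^ j) w) = (mul v ^^ j) ((mul x ^^ i) w)" for i j w
    by (induction j) (auto simp: comm)
  have vs: "(mul v ^^ i) (scale c w) = scale c ((mul v ^^ i) w)" for i c w
    by (induction i) (auto simp: mul_scale)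
  have "(mul v ^^ i) w \<in> A" if "w \<in> A" for i w using that by (induction i) auto
  then have "?g \<in> A" using Df by auto
  moreover have "(mul x ^^ (p - 1)) ?g = f"
    using f c main[of "p - 1"] unfolding c_def[symmetric] by (simp add: xs cv vs inv)
  ultimately show thesis using that by metis
qed


lemma torus_span_joint_eigenvectors:
  assumes T: "torus scale p T" "T \<subseteq> Der"
  shows "A \<subseteq> span {u \<in> A. \<forall>D\<in>T. \<exists>c. D u = scale c u}"
proof -
  obtain B where B: "finite B" "B \<subseteq> T" "T \<subseteq> Op.span B" using finite_spanning_subset T(2) by blast
  have "A \<subseteq> span {u \<in> A. \<forall>b\<in>B. \<exists>c. b u = scale c u}"
  proof (rule commuting_semisimple_span_joint_eigenvectors[OF vector_space_axioms p(1) B(1)])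
    show "linear_on scale A b" if "b \<in> B" for b using that B T Der_linear by blast
    show "b (b' x) = b' (b x)" if "b \<in> B" "b' \<in> B" for b b' x
    proof -
      have "commutator b b' = 0" using that B(2) T(1) unfolding torus_def by blast
      then have "commutator b b' x = 0" by simp
      then show ?thesis by (simp add: commutator_def)
    qed
    show "semisimple_elt scale p b" if "b \<in> B" for b using that B T by (auto simp: torus_def)
  qed
  also have "\<dots> \<subseteq> span {u \<in> A. \<forall>D\<in>T. \<exists>c. D u = scale c u}"
    using eigenvector_of_span B(3) by (intro span_mono) blast
  finally show ?thesis .
qed


text \<open>
  Elements of \<open>E\<close> with zero differential at the maximal ideal may be dropped from the
  generators \<open>y j\<close> without changing the matrix \<open>(d i (y j))\<close> modulo \<open>\<mm>\<close>, so that Nakayama's lemma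
  applies to what is left.
\<close>

lemma zero_on_coordinates_imp_zero:
  assumes E: "E \<subseteq> A" "\<And>j. j \<in> J \<Longrightarrow> y j \<in> span E"
    and D: "D \<in> Der" "\<And>x. x \<in> E \<Longrightarrow> (\<exists>i\<in>J. d i x \<notin> \<mm>) \<Longrightarrow> D x = 0"
  shows "D = 0"
proof -
  define S where "S = {x \<in> E. \<exists>i\<in>J. d i x \<notin> \<mm>}"
  define N where "N = {x \<in> E. \<forall>i\<in>J. d i x \<in> \<mm>}"
  have SN: "E = S \<union> N" "S \<subseteq> A" "N \<subseteq> A" using E(1) by (auto simp: S_def N_def)
  have "\<exists>z z'. y j = z + z' \<and> z \<in> span S \<and> z' \<in> span N" if "j \<in> J" for j
    using E(2)[OF that] unfolding SN(1) span_Un by auto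
  then obtain z z' where z: "\<And>j. j \<in> J \<Longrightarrow> y j = z j + z' j" "\<And>j. j \<in> J \<Longrightarrow> z j \<in> span S"
    "\<And>j. j \<in> J \<Longrightarrow> z' j \<in> span N" by metis
  have zA: "z j \<in> A" "z' j \<in> A" if "j \<in> J" for j
    using z(2,3)[OF that] span_minimal[OF SN(2) A] span_minimal[OF SN(3) A] by auto
  obtain u where u: "\<And>j. j \<in> J \<Longrightarrow> u j \<in> A" "D = (\<lambda>x. \<Sum>j\<in>J. mul (u j) (d j x))"
    using derivation_combination[OF D(1)] by blast
  have "u j = 0" if "j \<in> J" for j
  proof (rule nakayama[OF _ u(1) _ that])
    fix i j assume ij: "i \<in> J" "j \<in> J"
    interpret di: linear_on scale A "d i" by (rule Der_linear) (rule d[OF ij(1)])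
    have "d i (z' j) \<in> \<mm>"
      by (rule di.span_image_subset[OF _ F _ z(3)[OF ij(2)]]) (use SN(3) ij in \<open>auto simp: N_def\<close>)
    moreover have "d i (z j) - (if i = j then one else 0)
        = (d i (y j) - (if i = j then one else 0)) - d i (z' j)"
      using z(1)[OF ij(2)] zA[OF ij(2)] by (simp add: di.add)
    ultimately show "d i (z j) - (if i = j then one else 0) \<in> \<mm>"
      using subspace_diff[OF F dy[OF ij]] by (simp only:)
  next
    fix j assume j: "j \<in> J"
    interpret D: linear_on scale A D by (rule Der_linear) (rule D)
    have "D (z j) \<in> {0}"
      by (rule D.span_image_subset[OF _ subspace_single_0 _ z(2)[OF j]]) (use SN(2) D(2) in \<open>auto simp: S_def\<close>)
    then show "(\<Sum>i\<in>J. mul (u i) (d i (z j))) = 0" by (simp add: u(2))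
  qed
  then show ?thesis by (auto simp: u(2) fun_eq_iff)
qed

text \<open>
  Call a weight vector a coordinate if its differential is nonzero at \<open>\<mm>\<close>, and let \<open>S\<close> be a
  minimal set of coordinates such that \<open>\<alpha>\<close> vanishes on every \<open>D \<in> T\<close> that kills \<open>S\<close>.  By minimality \<open>T\<close> contains a dual family
  \<open>h\<close>, and \<open>\<alpha> = \<Sum>\<^sub>x \<alpha>(h\<^sub>x) wt\<^sub>x\<close>.  As both \<open>\<alpha>\<close> and the weights commute with the \<open>p\<close>-th power
  maps, \<open>\<alpha>(h\<^sub>x)\<^sup>p = \<alpha>(h\<^sub>x)\<close>.  So \<open>\<alpha>\<close> is a sum of weights of coordinates, with
  multiplicities, and by the lemma \<open>annihilator_of_coordinate\<close> the set of weights on \<open>A\<close> is closed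
  under addition of the weight of a coordinate.
\<close>

theorem weight_in_algebra:
  assumes T: "torus scale p T" "T \<subseteq> Der" and \<alpha>: "\<alpha> \<in> Lie_p scale p T"
  shows "\<exists>x\<in>A. x \<noteq> 0 \<and> (\<forall>D\<in>T. D x = scale (\<alpha> D) x)"
proof -
  define E where "E = {u \<in> A. \<forall>D\<in>T. \<exists>c. D u = scale c u}"
  define wt where "wt u D = (SOME c. D u = scale c u)" for u and D :: "'b \<Rightarrow> 'b"
  have wt: "D u = scale (wt u D) u" if "u \<in> E" "D \<in> T" for u D
    unfolding wt_def by (rule someI_ex) (use that in \<open>auto simp: E_def\<close>)
  have EA: "E \<subseteq> A" by (auto simp: E_def)
  have spanE: "A \<subseteq> span E" unfolding E_def by (rule torus_span_joint_eigenvectors[OF T])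
  have lin: "linear_on scale A D" if "D \<in> T" for D using that T(2) Der_linear by blast
  have subT: "Op.subspace T" and powT: "\<And>D. D \<in> T \<Longrightarrow> p_map p D \<in> T"
    using T(1) by (auto simp: torus_def restricted_subalgebra_def)
  have \<alpha>_add: "\<alpha> (D + D') = \<alpha> D + \<alpha> D'" if "D \<in> T" "D' \<in> T" for D D'
    using \<alpha> that by (auto simp: Lie_p_def dual_space_def linear_maps_def)
  have \<alpha>_scale: "\<alpha> (fscale scale c D) = c * \<alpha> D" if "D \<in> T" for c D
    using \<alpha> that by (auto simp: Lie_p_def dual_space_def linear_maps_def)
  have \<alpha>_pow: "\<alpha> (p_map p D) = \<alpha> D ^ p" if "D \<in> T" for D
    using \<alpha> that by (auto simp: Lie_p_def)
  have \<alpha>0: "\<alpha> 0 = 0" using \<alpha>_scale[OF Op.subspace_0[OF subT], of 0] by simp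
  have \<alpha>_sum: "\<alpha> (\<Sum>x\<in>S. f x) = (\<Sum>x\<in>S. \<alpha> (f x)) \<and> (\<Sum>x\<in>S. f x) \<in> T"
    if "\<And>x. x \<in> S \<Longrightarrow> f x \<in> T" "finite S" for S :: "'b set" and f
    using that(2,1)
    by (induction S rule: finite_induct) (auto simp: \<alpha>0 \<alpha>_add Op.subspace_0[OF subT] Op.subspace_add[OF subT])
  have "\<exists>Y. finite Y \<and> Y \<subseteq> E \<and> y j \<in> span Y" if "j \<in> J" for j
    using finite_subset_span[OF subsetD[OF spanE y[OF that]]] by metis
  then obtain Y where Y: "\<And>j. j \<in> J \<Longrightarrow> finite (Y j)" "\<And>j. j \<in> J \<Longrightarrow> Y j \<subseteq> E"
    "\<And>j. j \<in> J \<Longrightarrow> y j \<in> span (Y j)" by metis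
  define E0 where "E0 = (\<Union>j\<in>J. Y j)"
  have E0: "finite E0" "E0 \<subseteq> E" using Y J by (auto simp: E0_def)
  have E0y: "y j \<in> span E0" if "j \<in> J" for j
    using Y(3)[OF that] span_mono[of "Y j" E0] that by (auto simp: E0_def)
  define S0 where "S0 = {x \<in> E0. \<exists>i\<in>J. d i x \<notin> \<mm>}"
  have faithful: "D = 0" if "D \<in> T" "\<And>x. x \<in> S0 \<Longrightarrow> D x = 0" for D
    by (rule zero_on_coordinates_imp_zero[OF _ E0y]) (use that T(2) E0 EA in \<open>auto simp: S0_def\<close>)
  define P where "P S \<longleftrightarrow> S \<subseteq> S0 \<and> (\<forall>D\<in>T. (\<forall>x\<in>S. D x = 0) \<longrightarrow> \<alpha> D = 0)" for S
  have "P S0" using faithful \<alpha>0 by (auto simp: P_def)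
  then obtain S where S: "P S" "\<And>S'. P S' \<Longrightarrow> card S \<le> card S'"
    using ex_has_least_nat[of P S0 card] by blast
  have SS0: "S \<subseteq> S0" using S(1) by (simp add: P_def)
  then have SE: "S \<subseteq> E" and finS: "finite S" using E0 by (auto simp: S0_def dest: finite_subset)
  have S_coord: "\<exists>i\<in>J. d i x \<notin> \<mm>" if "x \<in> S" for x using that SS0 by (auto simp: S0_def)
  have S0x: "x \<noteq> 0" if "x \<in> S" for x
  proof
    assume "x = 0"
    moreover obtain i where "i \<in> J" "d i x \<notin> \<mm>" using S_coord[OF \<open>x \<in> S\<close>] by blast
    ultimately show False
      using linear_on.zero[OF Der_linear[OF d]] subspace_0[OF F] by auto
  qed
  have "\<forall>x\<in>S. \<exists>D\<in>T. D x = x \<and> (\<forall>x'\<in>S - {x}. D x' = 0)"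
  proof
    fix x assume x: "x \<in> S"
    then have "\<not> card S \<le> card (S - {x})" using finS card_Diff1_less by (metis not_le)
    then have "\<not> P (S - {x})" using S(2) by blast
    then obtain D where D: "D \<in> T" "\<forall>x'\<in>S - {x}. D x' = 0" "\<alpha> D \<noteq> 0"
      using SS0 by (auto simp: P_def)
    define c where "c = wt x D"
    have Dx: "D x = scale c x" using wt D(1) x SE by (auto simp: c_def)
    have "D x \<noteq> 0" using S(1) D by (auto simp: P_def)
    then have "c \<noteq> 0" using Dx by auto
    then show "\<exists>D\<in>T. D x = x \<and> (\<forall>x'\<in>S - {x}. D x' = 0)"
      using D Dx Op.subspace_scale[OF subT D(1), of "inverse c"]
      by (intro bexI[of _ "fscale scale (inverse c) D"]) (auto simp: fscale_def)
  qed
  then obtain h where h: "\<And>x. x \<in> S \<Longrightarrow> h x \<in> T" "\<And>x. x \<in> S \<Longrightarrow> h x x = x"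
    "\<And>x x'. x \<in> S \<Longrightarrow> x' \<in> S \<Longrightarrow> x' \<noteq> x \<Longrightarrow> h x x' = 0" by (metis DiffI singletonD)
  have \<alpha>_eq: "\<alpha> D = (\<Sum>x\<in>S. wt x D * \<alpha> (h x))" if D: "D \<in> T" for D
  proof -
    let ?f = "\<lambda>x. fscale scale (wt x D) (h x)"
    have f: "?f x \<in> T" if "x \<in> S" for x using Op.subspace_scale[OF subT h(1)[OF that]] .
    have sumT: "(\<Sum>x\<in>S. ?f x) \<in> T" using \<alpha>_sum[of S ?f, OF f finS] by blast
    have "(D - (\<Sum>x\<in>S. ?f x)) x' = 0" if x': "x' \<in> S" for x'
    proof -
      have "(\<Sum>x\<in>S. ?f x) x' = (\<Sum>x\<in>S. if x = x' then D x' else 0)"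
        unfolding sum_apply using x' h wt[OF subsetD[OF SE x'] D]
        by (intro sum.cong) (auto simp: fscale_def)
      then show ?thesis using x' finS by simp
    qed
    then have "\<alpha> (D - (\<Sum>x\<in>S. ?f x)) = 0"
      using S(1) Op.subspace_diff[OF subT D sumT] by (auto simp: P_def)
    then have "\<alpha> D = \<alpha> (\<Sum>x\<in>S. ?f x)"
      using \<alpha>_add[OF Op.subspace_diff[OF subT D sumT] sumT] by simp
    also have "\<dots> = (\<Sum>x\<in>S. wt x D * \<alpha> (h x))"
      using \<alpha>_sum[of S ?f, OF f finS] h(1) by (auto simp: \<alpha>_scale)
    finally show ?thesis .
  qed
  have "\<exists>a. \<alpha> (h x) = of_nat a" if x: "x \<in> S" for x
  proof (rule prime_field_fixed_points[OF p(1) prime_p])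
    have hp: "(h x ^^ n) x = x" for n using h(2)[OF x] by (induction n) auto
    have hp0: "(h x ^^ p) x' = 0" if "x' \<in> S" "x' \<noteq> x" for x'
    proof -
      have "(h x ^^ Suc n) x' = 0" for n
        using h(3)[OF x that] linear_on.zero[OF lin[OF h(1)[OF x]]] by (induction n) auto
      then show ?thesis using p(2) by (metis Suc_pred)
    qed
    have w: "wt x' (p_map p (h x)) = (if x' = x then 1 else 0)" if x': "x' \<in> S" for x'
    proof -
      have "scale (wt x' (p_map p (h x))) x' = p_map p (h x) x'"
        using wt SE x' powT[OF h(1)[OF x]] by (metis subsetD)
      also have "\<dots> = scale (if x' = x then 1 else 0) x'" using hp hp0 x' by (simp add: p_map_def)
      finally show ?thesis using S0x[OF x'] by (simp only: scale_cancel_right) auto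
    qed
    have "\<alpha> (h x) ^ p = \<alpha> (p_map p (h x))" using \<alpha>_pow h(1) x by simp
    also have "\<dots> = (\<Sum>x'\<in>S. (if x' = x then \<alpha> (h x') else 0))"
      unfolding \<alpha>_eq[OF powT[OF h(1)[OF x]]] by (intro sum.cong) (auto simp: w)
    also have "\<dots> = \<alpha> (h x)" using x finS by simp
    finally show "\<alpha> (h x) ^ p = \<alpha> (h x)" .
  qed
  then obtain a where a: "\<And>x. x \<in> S \<Longrightarrow> \<alpha> (h x) = of_nat (a x)" by metis
  define G where "G \<beta> \<longleftrightarrow> (\<exists>v\<in>A. v \<noteq> 0 \<and> (\<forall>D\<in>T. D v = scale (\<beta> D) v))" for \<beta>
  have G_add: "G (\<lambda>D. \<beta> D + wt x D)" if \<beta>: "G \<beta>" and x: "x \<in> S" for \<beta> x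
  proof -
    obtain v where v: "v \<in> A" "v \<noteq> 0" "\<And>D. D \<in> T \<Longrightarrow> D v = scale (\<beta> D) v" using \<beta> by (auto simp: G_def)
    obtain i where i: "i \<in> J" "d i x \<notin> \<mm>" using S_coord[OF x] by blast
    have xE: "x \<in> E" and xA: "x \<in> A" using x SE EA by auto
    have shift: "D (mul x w) = scale (b + wt x D) (mul x w)"
      if "D \<in> T" "w \<in> A" "D w = scale b w" for D w b
      using that Der_mul[OF subsetD[OF T(2)], of D x w] wt[OF xE, of D] xA
      by (simp add: mul_scale mul_scale2 scale_left_distrib add.commute)
    show ?thesis
    proof (cases "mul x v = 0")
      case False
      then show ?thesis using shift v unfolding G_def by (intro bexI[of _ "mul x v"]) auto
    next
      case True
      obtain g where g: "g \<in> A" "v = (mul x ^^ (p - 1)) g"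
        using annihilator_of_coordinate[OF d[OF i(1)] xA i(2) v(1) True] by blast
      interpret m: linear_on scale A "mul x ^^ (p - 1)"
        by (rule linear_on.funpow_linear_on[OF mul_linear_on])
      have mA: "(mul x ^^ n) w \<in> A" if "w \<in> A" for n w using that by (induction n) auto
      let ?X = "(mul x ^^ (p - 1)) ` (E - {0})"
      let ?\<Gamma> = "(\<lambda>e D. wt e D + of_nat (p - 1) * wt x D) ` (E - {0})"
      have pow: "D ((mul x ^^ n) e) = scale (wt e D + of_nat n * wt x D) ((mul x ^^ n) e)"
        if "D \<in> T" "e \<in> E" for D e n
      proof (induction n)
        case 0
        show ?case using wt that by simp
      next
        case (Suc n)
        from shift[OF that(1) mA[OF subsetD[OF EA that(2)]] Suc]
        show ?case by (simp add: algebra_simps)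
      qed
      have "\<exists>\<gamma>\<in>?\<Gamma>. \<forall>D\<in>T. \<gamma> D = \<beta> D"
      proof (rule weight_occurs_in_span[OF lin])
        show "?X \<subseteq> A" using mA EA by auto
        show "\<exists>\<gamma>\<in>?\<Gamma>. \<forall>D\<in>T. D w = scale (\<gamma> D) w" if "w \<in> ?X" for w
        proof -
          obtain e where e: "e \<in> E - {0}" "w = (mul x ^^ (p - 1)) e" using \<open>w \<in> ?X\<close> by blast
          then have "\<forall>D\<in>T. D w = scale (wt e D + of_nat (p - 1) * wt x D) w"
            using pow by blast
          then show ?thesis using e(1)
            by (intro bexI[of _ "\<lambda>D. wt e D + of_nat (p - 1) * wt x D"]) blast+
        qed
        have "g \<in> span (E - {0})" using g(1) spanE by auto
        moreover have "E - {0} \<subseteq> A" using EA by blast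
        moreover have "(mul x ^^ (p - 1)) e \<in> span ?X" if "e \<in> E - {0}" for e
          using that by (intro span_base imageI)
        ultimately show "v \<in> span ?X" unfolding g(2)
          using m.span_image_subset[OF _ subspace_span] by blast
      qed (use v in auto)
      then obtain e where e: "e \<in> E" "e \<noteq> 0" "\<And>D. D \<in> T \<Longrightarrow> wt e D + of_nat (p - 1) * wt x D = \<beta> D"
        by auto
      (* The (p - 1)-fold weight of x is its negative, so e has the weight sought. *)
      have "(of_nat (p - 1) :: 'k) = - 1"
        using p of_nat_CHAR[where ?'a = 'k] by (simp add: of_nat_diff)
      then have "wt e D = \<beta> D + wt x D" if "D \<in> T" for D using e(3)[OF that] by (simp add: algebra_simps)
      then have "D e = scale (\<beta> D + wt x D) e" if "D \<in> T" for D using wt[OF e(1) that] that by metis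
      then show ?thesis using e(1,2) EA unfolding G_def by (intro bexI[of _ e]) auto
    qed
  qed
  have G_mult: "G (\<lambda>D. \<beta> D + of_nat n * wt x D)" if "G \<beta>" "x \<in> S" for \<beta> n x
  proof (induction n)
    case (Suc n)
    from G_add[OF Suc that(2)] show ?case by (simp add: algebra_simps)
  qed (use that in simp)
  have "G (\<lambda>D. \<Sum>x\<in>S'. of_nat (a x) * wt x D)" if "S' \<subseteq> S" for S'
    using finite_subset[OF that finS] that
  proof (induction S' rule: finite_induct)
    case empty
    show ?case unfolding G_def using one T(2) Der_one by (intro bexI[of _ one]) auto
  next
    case (insert x S')
    then have "G (\<lambda>D. \<Sum>x\<in>S'. of_nat (a x) * wt x D)" and x: "x \<in> S" by auto
    from G_mult[OF this, of "a x"] show ?case using insert by (simp add: add.commute)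
  qed
  from this[of S] obtain v where "v \<in> A" "v \<noteq> 0"
    and v: "\<And>D. D \<in> T \<Longrightarrow> D v = scale (\<Sum>x\<in>S. of_nat (a x) * wt x D) v" by (auto simp: G_def)
  moreover have "\<alpha> D = (\<Sum>x\<in>S. of_nat (a x) * wt x D)" if "D \<in> T" for D
    unfolding \<alpha>_eq[OF that] by (intro sum.cong) (auto simp: a mult.commute)
  ultimately show ?thesis by auto
qed

end

section \<open>From the \<open>p\<close>-envelope to derivations of the coordinate algebra\<close>

lemma weights_subset_Lie_p:
  fixes s :: "'k::field \<Rightarrow> 'a::ab_group_add \<Rightarrow> 'a"
  assumes s: "vector_space s" and L: "module.subspace s L"
    and t: "t \<subseteq> linear_maps s s L L" "\<And>h. h \<in> t \<Longrightarrow> p_map p h \<in> t"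
  shows "weights s L t \<subseteq> Lie_p s p t - {0}"
proof
  interpret vector_space s by fact
  fix \<alpha> assume "\<alpha> \<in> weights s L t"
  then have \<alpha>: "\<alpha> \<in> dual_space (fscale s) t" "\<alpha> \<noteq> 0" and w: "weight_space s L t \<alpha> \<noteq> {0}"
    by (auto simp: weights_def)
  have lin: "linear_on s L h" if "h \<in> t" for h
    using that t(1) L s by (auto simp: linear_maps_def linear_on_def linear_on_axioms_def)
  have "0 \<in> weight_space s L t \<alpha>"
    using linear_on.zero[OF lin] subspace_0[OF L] by (auto simp: weight_space_def)
  then obtain x where x: "x \<in> L" "x \<noteq> 0" "\<And>h. h \<in> t \<Longrightarrow> h x = s (\<alpha> h) x"
    using w by (auto simp: weight_space_def)
  have "\<alpha> (p_map p h) = \<alpha> h ^ p" if h: "h \<in> t" for h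
  proof -
    have "(h ^^ n) x = s (\<alpha> h ^ n) x" for n
      using linear_on.scl[OF lin[OF h] x(1)] x(3)[OF h] by (induction n) (auto simp: mult.commute)
    from this[of p] have "s (\<alpha> (p_map p h)) x = s (\<alpha> h ^ p) x"
      using x(3)[OF t(2)[OF h]] by (metis p_map_def)
    then show ?thesis using x(2) scale_right_imp_eq by blast
  qed
  then show "\<alpha> \<in> Lie_p s p t - {0}" using \<alpha> by (auto simp: Lie_p_def)
qed

context nilpotent_local_algebra
begin

interpretation Op: vector_space "fscale scale :: 'k \<Rightarrow> ('b \<Rightarrow> 'b) \<Rightarrow> _"
  by (rule vector_space_fscale) (rule vector_space_axioms)

lemma Der_add: "D \<in> Der \<Longrightarrow> a \<in> A \<Longrightarrow> b \<in> A \<Longrightarrow> D (a + b) = D a + D b"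
  and Der_diff: "D \<in> Der \<Longrightarrow> a \<in> A \<Longrightarrow> b \<in> A \<Longrightarrow> D (a - b) = D a - D b"
  and Der_scale: "D \<in> Der \<Longrightarrow> a \<in> A \<Longrightarrow> D (scale c a) = scale c (D a)"
  and Der_0: "D \<in> Der \<Longrightarrow> D 0 = 0"
  using linear_on.add[OF Der_linear] linear_on.diff[OF Der_linear] linear_on.scl[OF Der_linear]
    linear_on.zero[OF Der_linear] by blast+

lemmas Der_linear_simps = Der_add Der_diff Der_scale Der_0

text \<open>
  In characteristic \<open>p\<close> the inner derivation of \<open>D\<^sup>p\<close> is the \<open>p\<close>-th power of that of \<open>D\<close>.  This is
  Leibniz' formula for the evaluation \<open>(E, x) \<mapsto> E x\<close>, as \<open>D (E x) = [D, E] x + E (D x)\<close>.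
\<close>

lemma Der_p_power_commutator:
  assumes D: "D \<in> Der" and L: "L \<subseteq> Der" "\<And>E. E \<in> L \<Longrightarrow> commutator D E \<in> L" and E: "E \<in> L"
  shows "((\<lambda>y. if y \<in> L then commutator D y else 0) ^^ p) E = commutator (D ^^ p) E"
proof
  fix x
  let ?a = "\<lambda>y. if y \<in> L then commutator D y else 0"
  have aL: "(?a ^^ i) E \<in> L" for i using E L by (induction i) auto
  show "(?a ^^ p) E x = commutator (D ^^ p) E x"
  proof (cases "x \<in> A")
    case True
    interpret D: linear_on scale A D by (rule Der_linear) fact
    let ?X = "\<lambda>i j. ((?a ^^ i) E) ((D ^^ j) x)"
    have XA: "?X i j \<in> A" for i j using aL L(1) Der_closed by blast
    have DX: "D (?X i j) = ?X (Suc i) j + ?X i (Suc j)" for i j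
      using aL[of i] by (simp add: commutator_def)
    from D.leibniz_char[of p ?X, OF p XA DX] show ?thesis by (simp add: commutator_def)
  next
    case False
    have "(D ^^ n) x = (if n = 0 then x else 0)" for n
      using Der_outside[OF D False] Der_0[OF D] by (induction n) auto
    then have "(D ^^ p) x = 0" "(D ^^ p) 0 = 0"
      using p(2) linear_on.zero[OF linear_on.funpow_linear_on[OF Der_linear[OF D]]] by auto
    moreover have "E x = 0" "E 0 = 0" "(?a ^^ p) E x = 0"
      using Der_outside[OF _ False] Der_0 aL E L(1) by blast+
    ultimately show ?thesis by (simp add: commutator_def)
  qed
qed

lemma jacobi:
  assumes "D \<in> Der" "D' \<in> Der" "E \<in> Der"
  shows "commutator (commutator D D') E = commutator D (commutator D' E) - commutator D' (commutator D E)"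
    "commutator D (commutator D' E) = commutator (commutator D D') E + commutator D' (commutator D E)"
proof -
  show "commutator (commutator D D') E = commutator D (commutator D' E) - commutator D' (commutator D E)"
    using assms by (auto simp: fun_eq_iff commutator_def Der_linear_simps Der_closed)
  then show "commutator D (commutator D' E) = commutator (commutator D D') E + commutator D' (commutator D E)"
    by simp
qed

lemma commutator_0 [simp]: "D \<in> Der \<Longrightarrow> commutator D 0 = 0"
  using Der_0 by (auto simp: fun_eq_iff commutator_def)

lemma commutator_add_left: "E \<in> Der \<Longrightarrow> D \<in> Der \<Longrightarrow> D' \<in> Der \<Longrightarrow>
    commutator (D + D') E = commutator D E + commutator D' E"
  by (auto simp: fun_eq_iff commutator_def Der_linear_simps Der_closed)

lemma commutator_scale_left: "E \<in> Der \<Longrightarrow> D \<in> Der \<Longrightarrow>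
    commutator (fscale scale c D) E = fscale scale c (commutator D E)"
  by (auto simp: fun_eq_iff commutator_def fscale_def Der_linear_simps Der_closed scale_right_diff_distrib)

lemma commutator_scale_right: "E \<in> Der \<Longrightarrow> D \<in> Der \<Longrightarrow>
    commutator D (fscale scale c E) = fscale scale c (commutator D E)"
  by (auto simp: fun_eq_iff commutator_def fscale_def Der_linear_simps Der_closed scale_right_diff_distrib)

lemma normalizer_restricted:
  assumes L: "Op.subspace L" "L \<subseteq> Der"
  shows "restricted_subalgebra scale p {D \<in> Der. \<forall>E\<in>L. commutator D E \<in> L}"
proof -
  let ?M = "{D \<in> Der. \<forall>E\<in>L. commutator D E \<in> L}"
  have cl: "Op.subspace Der" "\<And>D E. D \<in> Der \<Longrightarrow> E \<in> Der \<Longrightarrow> commutator D E \<in> Der"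
    "\<And>D. D \<in> Der \<Longrightarrow> p_map p D \<in> Der"
    using Der_restricted by (auto simp: restricted_subalgebra_def)
  have LD: "E \<in> Der" if "E \<in> L" for E using that L(2) by blast
  have "Op.subspace ?M"
  proof (unfold Op.subspace_def, intro conjI ballI allI CollectI)
    show "commutator 0 E \<in> L" if "E \<in> L" for E
      using Op.subspace_0[OF L(1)] commutator_scale_left[OF LD[OF that] LD[OF that], of 0] by simp
  qed (use cl(1) L(1) LD in \<open>auto simp: Op.subspace_def commutator_add_left commutator_scale_left\<close>)
  moreover have "commutator D D' \<in> ?M" if "D \<in> ?M" "D' \<in> ?M" for D D'
    using that cl(2) jacobi(1)[of D D'] LD Op.subspace_diff[OF L(1)] by auto
  moreover have "p_map p D \<in> ?M" if D: "D \<in> ?M" for D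
  proof -
    let ?a = "\<lambda>y. if y \<in> L then commutator D y else 0"
    have "commutator (p_map p D) E \<in> L" if E: "E \<in> L" for E
    proof -
      have "(?a ^^ i) E \<in> L" for i using E D by (induction i) auto
      moreover have "(?a ^^ p) E = commutator (p_map p D) E"
        unfolding p_map_def using D by (intro Der_p_power_commutator L(2) E) auto
      ultimately show ?thesis by metis
    qed
    then show ?thesis using D cl(3) by auto
  qed
  ultimately show ?thesis unfolding restricted_subalgebra_def by blast
qed

end

text \<open>
  The algebras to be treated are Lie algebras \<open>L\<close> of derivations of \<open>A\<close>, contained in a restricted
  Lie algebra \<open>M\<close> of derivations that normalizes \<open>L\<close>.  If \<open>M\<close> acts faithfully on \<open>L\<close>, it contains
  the minimal \<open>p\<close>-envelope of \<open>L\<close>, so that a torus of the latter acts on \<open>A\<close>.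
\<close>

locale normalized_subalgebra = nilpotent_local_algebra scale p A mul one F K Bs J d y
  for scale :: "'k::alg_closed_field \<Rightarrow> 'b::ab_group_add \<Rightarrow> 'b"
    and p A mul one F K Bs and J :: "'j set" and d y +
  fixes L M :: "('b \<Rightarrow> 'b) set"
  assumes L: "module.subspace (fscale scale) L" "L \<subseteq> M"
    and M: "restricted_subalgebra scale p M" "M \<subseteq> derivations scale mul A"
    and normalizes: "D \<in> M \<Longrightarrow> E \<in> L \<Longrightarrow> commutator D E \<in> L"
    and faithful: "D \<in> M \<Longrightarrow> (\<And>E. E \<in> L \<Longrightarrow> commutator D E = 0) \<Longrightarrow> D = 0"
begin

interpretation Op: vector_space "fscale scale :: 'k \<Rightarrow> ('b \<Rightarrow> 'b) \<Rightarrow> _"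
  by (rule vector_space_fscale) (rule vector_space_axioms)

interpretation Op2: vector_space "fscale (fscale scale) :: 'k \<Rightarrow> (('b \<Rightarrow> 'b) \<Rightarrow> ('b \<Rightarrow> 'b)) \<Rightarrow> _"
  by (rule vector_space_fscale) (rule Op.vector_space_axioms)

lemma M_closed: "Op.subspace M" "D \<in> M \<Longrightarrow> E \<in> M \<Longrightarrow> commutator D E \<in> M"
  "D \<in> M \<Longrightarrow> p_map p D \<in> M"
  using M(1) by (auto simp: restricted_subalgebra_def)

lemma M_Der: "D \<in> M \<Longrightarrow> D \<in> Der" and L_Der: "E \<in> L \<Longrightarrow> E \<in> Der" and L_M: "E \<in> L \<Longrightarrow> E \<in> M"
  using L(2) M(2) by blast+

lemma L_subset: "L \<subseteq> Der"
  using L(2) M(2) by blast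

lemma ad_add:
  assumes "D \<in> M" "D' \<in> M"
  shows "ad L (D + D') = ad L D + ad L D'"
proof (intro ext)
  fix E x
  show "ad L (D + D') E x = (ad L D + ad L D') E x"
    using Der_add[OF L_Der Der_closed[OF M_Der] Der_closed[OF M_Der], of E D D'] assms
    by (simp add: ad_def commutator_def)
qed

lemma ad_scale:
  assumes "D \<in> M"
  shows "ad L (fscale scale c D) = fscale (fscale scale) c (ad L D)"
proof (intro ext)
  fix E x
  show "ad L (fscale scale c D) E x = fscale (fscale scale) c (ad L D) E x"
    using Der_scale[OF L_Der Der_closed[OF M_Der], of E D] assms
    by (simp add: ad_def commutator_def fscale_def scale_right_diff_distrib)
qed

lemma zero_mem: "0 \<in> L" "0 \<in> M"
  using Op.subspace_0 L(1) M_closed(1) by blast+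

lemma ad_0: "ad L 0 = 0"
  using ad_scale[OF zero_mem(2), of 0] by simp

lemma ad_commutator:
  assumes "D \<in> M" "D' \<in> M"
  shows "ad L (commutator D D') = commutator (ad L D) (ad L D')"
proof
  fix E
  have "commutator (ad L D) (ad L D') E = ad L D (ad L D' E) - ad L D' (ad L D E)"
    by (simp add: commutator_def)
  then show "ad L (commutator D D') E = commutator (ad L D) (ad L D') E"
    using assms normalizes jacobi(1)[of D D' E]
    by (cases "E \<in> L") (auto simp: ad_def M_Der L_Der zero_mem)
qed

lemma ad_p_map:
  assumes D: "D \<in> M"
  shows "ad L (p_map p D) = p_map p (ad L D)"
proof
  fix E
  show "ad L (p_map p D) E = p_map p (ad L D) E"
  proof (cases "E \<in> L")
    case True
    then show ?thesis
      using Der_p_power_commutator[OF M_Der[OF D] L_subset normalizes[OF D] True]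
      by (simp add: ad_def[abs_def] p_map_def)
  next
    case False
    have "(ad L D ^^ Suc n) E = 0" for n
      using False by (induction n) (auto simp: ad_def zero_mem M_Der[OF D])
    then have "(ad L D ^^ p) E = 0" using p(2) by (metis Suc_pred)
    then show ?thesis using False by (simp add: p_map_def ad_def)
  qed
qed

lemma ad_derivation:
  assumes D: "D \<in> M"
  shows "ad L D \<in> derivations (fscale scale) commutator L"
proof -
  have LL: "commutator E E' \<in> L" if "E \<in> L" "E' \<in> L" for E E' using that normalizes L_M by blast
  have "commutator D (E + E') = commutator D E + commutator D E'" if "E \<in> L" "E' \<in> L" for E E'
    using that Der_add[OF M_Der[OF D] Der_closed Der_closed] L_Der
    by (auto simp: fun_eq_iff commutator_def)
  moreover have "commutator D (fscale scale c E) = fscale scale c (commutator D E)" if "E \<in> L" for E c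
    using that Der_scale[OF M_Der[OF D] Der_closed] L_Der
    by (auto simp: fun_eq_iff commutator_def fscale_def scale_right_diff_distrib)
  moreover have "commutator D (commutator E E') = commutator (commutator D E) E' + commutator E (commutator D E')"
    if "E \<in> L" "E' \<in> L" for E E'
    by (rule jacobi(2)) (use that D M_Der L_Der in auto)
  ultimately show ?thesis
    using Op.subspace_add[OF L(1)] Op.subspace_scale[OF L(1)] D normalizes LL
    unfolding derivations_def linear_maps_def ad_def by simp
qed

lemma p_envelope_subset: "p_envelope (fscale scale) p L \<subseteq> ad L ` M"
proof -
  have "restricted_subalgebra (fscale scale) p (ad L ` M)"
    unfolding restricted_subalgebra_def Op2.subspace_def
  proof (intro conjI ballI allI)
    show "0 \<in> ad L ` M" using imageI[OF zero_mem(2), of "ad L"] by (simp only: ad_0)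
  next
    fix x y assume "x \<in> ad L ` M" "y \<in> ad L ` M"
    then show "x + y \<in> ad L ` M"
      by (auto simp: ad_add[symmetric] Op.subspace_add[OF M_closed(1)] intro!: imageI)
  next
    fix c x assume "x \<in> ad L ` M"
    then show "fscale (fscale scale) c x \<in> ad L ` M"
      by (auto simp: ad_scale[symmetric] Op.subspace_scale[OF M_closed(1)] intro!: imageI)
  next
    fix x y assume "x \<in> ad L ` M" "y \<in> ad L ` M"
    then show "commutator x y \<in> ad L ` M"
      by (auto simp: ad_commutator[symmetric] M_closed(2) intro!: imageI)
  next
    fix x assume "x \<in> ad L ` M"
    then show "p_map p x \<in> ad L ` M"
      by (auto simp: ad_p_map[symmetric] M_closed(3) intro!: imageI)
  qed
  moreover have "ad L ` M \<subseteq> derivations (fscale scale) commutator L" using ad_derivation by blast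
  moreover have "ad L ` L \<subseteq> ad L ` M" using L(2) by blast
  ultimately show ?thesis unfolding p_envelope_def by blast
qed

lemma ad_inj:
  assumes "D \<in> M" "D' \<in> M" "ad L D = ad L D'"
  shows "D = D'"
proof -
  have DD: "D - D' \<in> M" by (rule Op.subspace_diff[OF M_closed(1) assms(1,2)])
  have "ad L D = ad L (D - D') + ad L D'" using ad_add[OF DD assms(2)] by simp
  then have z: "ad L (D - D') = 0" using assms(3) by simp
  have "commutator (D - D') E = 0" if "E \<in> L" for E
    using fun_cong[OF z, of E] that by (simp add: ad_def)
  then have "D - D' = 0" by (rule faithful[OF DD])
  then show ?thesis by simp
qed

lemma ad_p_map_funpow: "D \<in> M \<Longrightarrow> (p_map p ^^ i) D \<in> M \<and> (p_map p ^^ i) (ad L D) = ad L ((p_map p ^^ i) D)"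
  by (induction i) (auto simp: M_closed ad_p_map)

text \<open>The linear combination of \<open>[p]\<close>-powers is carried back along the injective map \<open>ad\<close>.\<close>

lemma ad_semisimple:
  assumes D: "D \<in> M" and ss: "semisimple_elt (fscale scale) p (ad L D)"
  shows "semisimple_elt scale p D"
proof -
  have "\<exists>D'\<in>M. D' \<in> Op.span {(p_map p ^^ i) D | i. i \<ge> 1} \<and> g = ad L D'"
    if "g \<in> Op2.span {(p_map p ^^ i) (ad L D) | i. i \<ge> 1}" for g
    using that
  proof (induction rule: Op2.span_induct_alt)
    case base
    show ?case by (rule bexI[of _ 0], rule conjI, rule Op.span_zero, rule ad_0[symmetric], rule zero_mem(2))
  next
    case (step c x y)
    then obtain i D' where i: "i \<ge> 1" "x = ad L ((p_map p ^^ i) D)"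
      and D': "D' \<in> M" "D' \<in> Op.span {(p_map p ^^ i) D | i. i \<ge> 1}" "y = ad L D'"
      using ad_p_map_funpow[OF D] by auto
    let ?D = "fscale scale c ((p_map p ^^ i) D) + D'"
    have iM: "(p_map p ^^ i) D \<in> M" using ad_p_map_funpow[OF D] by blast
    have "?D \<in> M" by (intro Op.subspace_add[OF M_closed(1)] Op.subspace_scale[OF M_closed(1)] iM D')
    moreover have "?D \<in> Op.span {(p_map p ^^ i) D | i. i \<ge> 1}"
      by (intro Op.span_add Op.span_scale D' Op.span_base) (use i in blast)
    moreover have "fscale (fscale scale) c x + y = ad L ?D"
      using ad_add[OF Op.subspace_scale[OF M_closed(1) iM] D'(1)] ad_scale[OF iM] i D' by simp
    ultimately show ?case by blast
  qed
  from this[OF ss[unfolded semisimple_elt_def]] obtain D' where D': "D' \<in> M"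
    "D' \<in> Op.span {(p_map p ^^ i) D | i. i \<ge> 1}" "ad L D = ad L D'" by blast
  have "D = D'" by (rule ad_inj[OF D D'(1,3)])
  then show ?thesis using D'(2) by (simp only: semisimple_elt_def)
qed

lemma torus_pullback:
  assumes t: "torus (fscale scale) p t"
  shows "torus scale p {D \<in> M. ad L D \<in> t}"
proof -
  have sub: "Op2.subspace t" and cl: "\<And>x y. x \<in> t \<Longrightarrow> y \<in> t \<Longrightarrow> commutator x y \<in> t"
    "\<And>x. x \<in> t \<Longrightarrow> p_map p x \<in> t" and ab: "\<And>x y. x \<in> t \<Longrightarrow> y \<in> t \<Longrightarrow> commutator x y = 0"
    and ss: "\<And>x. x \<in> t \<Longrightarrow> semisimple_elt (fscale scale) p x"
    using t by (auto simp: torus_def restricted_subalgebra_def)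
  have "Op.subspace {D \<in> M. ad L D \<in> t}"
    unfolding Op.subspace_def
    using M_closed(1) zero_mem ad_0 Op2.subspace_0[OF sub]
    by (auto simp: Op.subspace_add Op.subspace_scale ad_add ad_scale Op2.subspace_add[OF sub]
        Op2.subspace_scale[OF sub])
  moreover have "commutator D D' = 0" if "D \<in> M" "D' \<in> M" "ad L D \<in> t" "ad L D' \<in> t" for D D'
    using ad_inj[OF M_closed(2)[OF that(1,2)] zero_mem(2)] ad_0 ab[OF that(3,4)]
      ad_commutator[OF that(1,2)] by simp
  ultimately show ?thesis
    unfolding torus_def restricted_subalgebra_def
    using M_closed cl ad_semisimple ss zero_mem ad_0 Op2.subspace_0[OF sub] by (simp add: ad_p_map)
qed

text \<open>
  Both the torus and its characters are pulled back along \<open>ad\<close>, which is injective on \<open>M\<close>.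
  What remains to be shown concerns a torus of derivations of \<open>A\<close>.
\<close>

theorem weights_eq_Lie_p:
  assumes t: "t \<subseteq> p_envelope (fscale scale) p L" "torus (fscale scale) p t"
    and occurs: "\<And>T \<alpha>. torus scale p T \<Longrightarrow> torus (fscale scale) p (ad L ` T) \<Longrightarrow> T \<subseteq> M \<Longrightarrow> \<alpha> \<in> Lie_p scale p T \<Longrightarrow>
      \<exists>D\<in>T. \<alpha> D \<noteq> 0 \<Longrightarrow> \<exists>E\<in>L. E \<noteq> 0 \<and> (\<forall>D\<in>T. commutator D E = fscale scale (\<alpha> D) E)"
  shows "weights (fscale scale) L t = Lie_p (fscale scale) p t - {0}"
proof
  have tM: "t \<subseteq> ad L ` M" using t(1) p_envelope_subset by blast
  have "t \<subseteq> linear_maps (fscale scale) (fscale scale) L L"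
    using tM ad_derivation by (auto simp: derivations_def)
  moreover have "p_map p h \<in> t" if "h \<in> t" for h
    using t(2) that by (auto simp: torus_def restricted_subalgebra_def)
  ultimately show "weights (fscale scale) L t \<subseteq> Lie_p (fscale scale) p t - {0}"
    by (rule weights_subset_Lie_p[OF Op.vector_space_axioms L(1)])
  show "Lie_p (fscale scale) p t - {0} \<subseteq> weights (fscale scale) L t"
  proof
    fix \<alpha> assume "\<alpha> \<in> Lie_p (fscale scale) p t - {0}"
    then have \<alpha>: "\<alpha> \<in> dual_space (fscale (fscale scale)) t" "\<And>h. h \<in> t \<Longrightarrow> \<alpha> (p_map p h) = \<alpha> h ^ p"
      and \<alpha>0: "\<alpha> \<noteq> 0" by (auto simp: Lie_p_def)
    have lin: "\<And>x y. x \<in> t \<Longrightarrow> y \<in> t \<Longrightarrow> \<alpha> (x + y) = \<alpha> x + \<alpha> y"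
      "\<And>c x. x \<in> t \<Longrightarrow> \<alpha> (fscale (fscale scale) c x) = c * \<alpha> x" "\<And>x. x \<notin> t \<Longrightarrow> \<alpha> x = 0"
      using \<alpha>(1) by (auto simp: dual_space_def linear_maps_def)
    define T where "T = {D \<in> M. ad L D \<in> t}"
    have T: "torus scale p T" unfolding T_def by (rule torus_pullback) fact
    then have T_cl: "\<And>x y. x \<in> T \<Longrightarrow> y \<in> T \<Longrightarrow> x + y \<in> T" "\<And>c x. x \<in> T \<Longrightarrow> fscale scale c x \<in> T"
      "\<And>x. x \<in> T \<Longrightarrow> p_map p x \<in> T"
      by (auto simp: torus_def restricted_subalgebra_def Op.subspace_def)
    have "ad L ` T = t" using tM by (auto simp: T_def)
    then have adT: "torus (fscale scale) p (ad L ` T)" using t(2) by simp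
    let ?\<beta> = "\<lambda>D. if D \<in> T then \<alpha> (ad L D) else 0"
    have TM: "D \<in> M \<and> ad L D \<in> t" if "D \<in> T" for D using that by (simp add: T_def)
    have "?\<beta> \<in> Lie_p scale p T"
      using T_cl TM lin \<alpha>(2)
      by (auto simp: Lie_p_def dual_space_def linear_maps_def ad_add ad_scale ad_p_map)
    moreover have "\<exists>D\<in>T. ?\<beta> D \<noteq> 0"
    proof -
      obtain h where "\<alpha> h \<noteq> 0" using \<alpha>0 by (auto simp: fun_eq_iff)
      then show ?thesis using lin(3) tM by (fastforce simp: T_def)
    qed
    ultimately obtain E where E: "E \<in> L" "E \<noteq> 0"
      and w: "\<And>D. D \<in> T \<Longrightarrow> commutator D E = fscale scale (?\<beta> D) E"
      using occurs[OF T adT, of ?\<beta>] by (auto simp: T_def)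
    have "h E = fscale scale (\<alpha> h) E" if "h \<in> t" for h
    proof -
      obtain D where "D \<in> M" "h = ad L D" using tM \<open>h \<in> t\<close> by blast
      then show ?thesis using w[of D] E(1) that by (simp add: T_def ad_def)
    qed
    then have "E \<in> weight_space (fscale scale) L t \<alpha>" using E by (simp add: weight_space_def)
    then show "\<alpha> \<in> weights (fscale scale) L t" using \<alpha>(1) \<alpha>0 E(2) by (auto simp: weights_def)
  qed
qed


lemma torus_span_joint_eigenvectors_of_ad:
  assumes T: "torus scale p T" "torus (fscale scale) p (ad L ` T)" "T \<subseteq> M"
  shows "L \<subseteq> Op.span {E \<in> L. \<forall>D\<in>T. \<exists>c. commutator D E = fscale scale c E}"
proof -
  obtain B where B: "finite B" "B \<subseteq> T" "T \<subseteq> Op.span B"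
    using finite_spanning_subset[of T] T(3) M(2) by blast
  have "L \<subseteq> Op.span {E \<in> L. \<forall>b\<in>ad L ` B. \<exists>c. b E = fscale scale c E}"
  proof (rule commuting_semisimple_span_joint_eigenvectors[OF Op.vector_space_axioms p(1)])
    show "finite (ad L ` B)" using B(1) by simp
    show "linear_on (fscale scale) L b" if "b \<in> ad L ` B" for b
    proof -
      have "b \<in> linear_maps (fscale scale) (fscale scale) L L"
        using that B(2) T(3) ad_derivation by (auto simp: derivations_def)
      then show ?thesis
        using L(1) Op.vector_space_axioms
        by (auto simp: linear_maps_def linear_on_def linear_on_axioms_def)
    qed
    show "b (b' E) = b' (b E)" if "b \<in> ad L ` B" "b' \<in> ad L ` B" for b b' E
    proof -
      have "commutator b b' = 0" using that B(2) T(2) unfolding torus_def by blast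
      then have "commutator b b' E = 0" by simp
      then show ?thesis by (simp add: commutator_def)
    qed
    show "semisimple_elt (fscale scale) p b" if "b \<in> ad L ` B" for b
      using that B(2) T(2) unfolding torus_def by blast
  qed
  also have "\<dots> \<subseteq> Op.span {E \<in> L. \<forall>D\<in>T. \<exists>c. commutator D E = fscale scale c E}"
  proof (intro Op.span_mono subsetI CollectI conjI ballI)
    fix E D assume E: "E \<in> {E \<in> L. \<forall>b\<in>ad L ` B. \<exists>c. b E = fscale scale c E}" and D: "D \<in> T"
    have "D \<in> M \<and> (\<exists>c. commutator D E = fscale scale c E)" if "D \<in> Op.span B" for D
      using that
    proof (induction rule: Op.span_induct_alt)
      case base
      have "commutator 0 E = fscale scale 0 E"
        using E commutator_scale_left[of E E 0] L_Der by simp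
      then show ?case using zero_mem by blast
    next
      case (step c x y)
      then obtain a' where a': "commutator y E = fscale scale a' E" by blast
      have "ad L x E = commutator x E" using E by (simp add: ad_def)
      moreover have "\<exists>a. ad L x E = fscale scale a E" using E step(1) by blast
      ultimately obtain a where a: "commutator x E = fscale scale a E" by metis
      have M: "x \<in> M" "y \<in> M" using step B(2) T(3) by auto
      have "fscale scale c x \<in> M" by (rule Op.subspace_scale[OF M_closed(1) M(1)])
      moreover from this have "commutator (fscale scale c x + y) E = fscale scale (c * a + a') E"
        using E M a a' by (simp add: commutator_add_left commutator_scale_left M_Der L_Der
            Op.scale_left_distrib)
      ultimately show ?case using Op.subspace_add[OF M_closed(1)] M by blast
    qed
    then show "\<exists>c. commutator D E = fscale scale c E" using D B(3) by blast
  qed auto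
  finally show ?thesis .
qed

text \<open>
  If \<open>L\<close> is an \<open>A\<close>-module not contained in \<open>\<mm> Der(A)\<close>, it contains a weight vector \<open>E\<close> outside
  \<open>\<mm> Der(A)\<close>.  Then \<open>f \<mapsto> f E\<close> is injective and shifts weights by that of \<open>E\<close>, and every
  character is a weight on \<open>A\<close>.
\<close>

theorem weights_eq_Lie_p_if_module:
  assumes t: "t \<subseteq> p_envelope (fscale scale) p L" "torus (fscale scale) p t"
    and module: "\<And>f E. f \<in> A \<Longrightarrow> E \<in> L \<Longrightarrow> (\<lambda>x. mul f (E x)) \<in> L"
    and E0: "E0 \<in> L" "x0 \<in> A" "E0 x0 \<notin> \<mm>"
  shows "weights (fscale scale) L t = Lie_p (fscale scale) p t - {0}"
proof (rule weights_eq_Lie_p[OF t])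
  fix T \<alpha> assume T: "torus scale p T" "torus (fscale scale) p (ad L ` T)" "T \<subseteq> M"
    and \<alpha>: "\<alpha> \<in> Lie_p scale p T"
  let ?E = "{E \<in> L. \<forall>D\<in>T. \<exists>c. commutator D E = fscale scale c E}"
  have T_cl: "Op.subspace T" "\<And>D. D \<in> T \<Longrightarrow> p_map p D \<in> T"
    using T(1) by (auto simp: torus_def restricted_subalgebra_def)
  have "\<exists>E\<in>?E. E x0 \<notin> \<mm>"
  proof (rule ccontr)
    assume neg: "\<not> ?thesis"
    have "E x0 \<in> \<mm>" if "E \<in> Op.span ?E" for E
      using that
    proof (induction rule: Op.span_induct_alt)
      case (step c E E')
      then have "E x0 \<in> \<mm>" using neg by blast
      then show ?case using step by (auto simp: fscale_def intro!: subspace_add[OF F] subspace_scale[OF F])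
    qed (simp add: subspace_0[OF F])
    then show False using E0 torus_span_joint_eigenvectors_of_ad[OF T] by blast
  qed
  then obtain E where E: "E \<in> L" "E x0 \<notin> \<mm>"
    and "\<forall>D\<in>T. \<exists>c. commutator D E = fscale scale c E" by blast
  then obtain c where c: "\<And>D. D \<in> T \<Longrightarrow> commutator D E = fscale scale (c D) E" by metis
  have ED: "E \<in> Der" using E L_Der by blast
  have TD: "D \<in> Der" if "D \<in> T" for D using that T(3) M_Der by blast
  have "E \<noteq> 0" using E(2) subspace_0[OF F] by auto
  then have c_eqI: "a = b" if "fscale scale a E = fscale scale b E" for a b
    using that by (metis Op.scale_right_imp_eq)
  have c_add: "c (D + D') = c D + c D'" if "D \<in> T" "D' \<in> T" for D D'
    using that Op.subspace_add[OF T_cl(1) that]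
    by (intro c_eqI) (simp add: Op.scale_left_distrib commutator_add_left ED TD flip: c)
  have c_scale: "c (fscale scale r D) = r * c D" if "D \<in> T" for D r
    using that Op.subspace_scale[OF T_cl(1) that] c[OF that]
    by (intro c_eqI) (simp add: commutator_scale_left ED TD flip: c Op.scale_scale)
  have c_pow: "c (p_map p D) = c D ^ p" if D: "D \<in> T" for D
  proof (rule c_eqI)
    let ?a = "\<lambda>y. if y \<in> L then commutator D y else 0"
    have "(?a ^^ i) E = fscale scale (c D ^ i) E" for i
      using Op.subspace_scale[OF L(1) E(1)] c[OF D]
      by (induction i) (auto simp: commutator_scale_right ED TD[OF D] mult.commute)
    moreover have "(?a ^^ p) E = commutator (p_map p D) E"
      unfolding p_map_def using T(3) D normalizes
      by (intro Der_p_power_commutator L_subset TD E(1)) auto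
    ultimately show "fscale scale (c (p_map p D)) E = fscale scale (c D ^ p) E"
      using c[OF T_cl(2)[OF D]] by metis
  qed
  let ?\<beta> = "\<lambda>D. if D \<in> T then \<alpha> D - c D else 0"
  have "(a - b) ^ p = a ^ p - b ^ p" for a b :: 'k
  proof -
    have "((a - b) + b) ^ p = (a - b) ^ p + b ^ p"
      by (rule freshmans_dream) (use p prime_p in simp_all)
    then show ?thesis by (simp add: algebra_simps)
  qed
  then have "?\<beta> \<in> Lie_p scale p T"
    using \<alpha> T_cl(2) Op.subspace_add[OF T_cl(1)] Op.subspace_scale[OF T_cl(1)]
    by (auto simp: Lie_p_def dual_space_def linear_maps_def c_add c_scale c_pow right_diff_distrib)
  moreover have "T \<subseteq> Der" using TD by blast
  ultimately obtain f where f: "f \<in> A" "f \<noteq> 0" "\<And>D. D \<in> T \<Longrightarrow> D f = scale (\<alpha> D - c D) f"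
    using weight_in_algebra[OF T(1), of ?\<beta>] by auto
  let ?fE = "\<lambda>x. mul f (E x)"
  have "?fE \<noteq> 0"
  proof
    assume "?fE = 0"
    then have "mul f (E x0) = 0" by (simp add: fun_eq_iff)
    moreover obtain v where "mul (E x0) v = one" using unit[OF Der_closed[OF ED] E(2)] by blast
    ultimately have "f = 0" by (metis f(1) mul_assoc mul_one_right mul_0(2))
    then show False using f(2) by simp
  qed
  moreover have "commutator D ?fE = fscale scale (\<alpha> D) ?fE" if D: "D \<in> T" for D
  proof
    fix x
    have "commutator D ?fE x = mul (D f) (E x) + mul f (commutator D E x)"
      using Der_mul[OF TD[OF D] f(1) Der_closed[OF ED]] by (simp add: commutator_def mul_diff)
    also have "\<dots> = fscale scale (\<alpha> D) ?fE x"
      by (simp add: f(3)[OF D] c[OF D] fscale_def mul_scale mul_scale2 mul_diff2 scale_left_diff_distrib)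
    finally show "commutator D ?fE x = fscale scale (\<alpha> D) ?fE x" .
  qed
  ultimately show "\<exists>E\<in>L. E \<noteq> 0 \<and> (\<forall>D\<in>T. commutator D E = fscale scale (\<alpha> D) E)"
    using module[OF f(1) E(1)] by blast
qed

end

section \<open>Algebras with a basis of monomials\<close>

definition twisted_mult :: "(nat \<Rightarrow> nat) set \<Rightarrow> ((nat \<Rightarrow> nat) \<Rightarrow> (nat \<Rightarrow> nat) \<Rightarrow> 'k) \<Rightarrow>
    'k::field coeffs \<Rightarrow> 'k coeffs \<Rightarrow> 'k coeffs" where
  "twisted_mult I w f g =
    (\<lambda>c. if c \<in> I then \<Sum>a\<in>I. \<Sum>b\<in>I. if a + b = c then w a b * f a * g b else 0 else 0)"

lemma finite_exponents: "finite (exponents p m n)"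
proof (rule finite_subset)
  show "exponents p m n \<subseteq> {f. \<forall>x. (x \<in> {..<m} \<longrightarrow> f x \<in> (\<Union>i<m. {..<p ^ n i})) \<and> (x \<notin> {..<m} \<longrightarrow> f x = 0)}"
    by (auto simp: exponents_def)
qed (rule finite_set_of_finite_funs, auto)

lemma twisted_mult_sum_pairs:
  assumes "finite I"
  shows "twisted_mult I w f g = (\<lambda>c. if c \<in> I then
     \<Sum>(a, b) \<in> {(a, b). a \<in> I \<and> b \<in> I \<and> a + b = c}. w a b * f a * g b else 0)"
proof
  fix c
  have "(\<Sum>a\<in>I. \<Sum>b\<in>I. if a + b = c then w a b * f a * g b else 0)
      = (\<Sum>x\<in>I \<times> I. if fst x + snd x = c then w (fst x) (snd x) * f (fst x) * g (snd x) else 0)"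
    by (simp add: sum.cartesian_product case_prod_beta)
  also have "\<dots> = (\<Sum>x\<in>{x \<in> I \<times> I. fst x + snd x = c}. w (fst x) (snd x) * f (fst x) * g (snd x))"
    by (rule sum.inter_filter[symmetric]) (use assms in auto)
  also have "\<dots> = (\<Sum>(a, b) \<in> {(a, b). a \<in> I \<and> b \<in> I \<and> a + b = c}. w a b * f a * g b)"
    by (rule sum.cong) auto
  finally show "twisted_mult I w f g c = (if c \<in> I then
     \<Sum>(a, b) \<in> {(a, b). a \<in> I \<and> b \<in> I \<and> a + b = c}. w a b * f a * g b else 0)"
    by (simp only: twisted_mult_def)
qed

lemma sum_delta_pair:
  assumes "finite S" "a \<in> S" "b \<in> S"
  shows "(\<Sum>x\<in>S. \<Sum>y\<in>S. if x = a \<and> y = b then f x y else 0) = f a b"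
proof -
  have "(\<Sum>y\<in>S. if x = a \<and> y = b then f x y else 0) = (if x = a then f a b else 0)" for x
    using assms by (cases "x = a") auto
  then show ?thesis using assms by simp
qed

text \<open>
  Both the divided power algebra and the truncated polynomial algebra have a basis of monomials
  \<open>x\<^sup>a\<close> with \<open>x\<^sup>a x\<^sup>b = w(a,b) x\<^sup>a\<^sup>+\<^sup>b\<close> for a symmetric \<open>2\<close>-cocycle \<open>w\<close>: a product of binomial
  coefficients in the one case, \<open>1\<close> in the other.
\<close>

locale monomial_algebra =
  fixes p m :: nat and n :: "nat \<Rightarrow> nat" and w :: "(nat \<Rightarrow> nat) \<Rightarrow> (nat \<Rightarrow> nat) \<Rightarrow> 'k::alg_closed_field"
  assumes p: "CHAR('k) = p" "p > 0"
    and w_comm: "w a b = w b a"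
    and w_assoc: "w a b * w (a + b) c = w b c * w a (b + c)"
    and w_0: "w 0 a = 1"
begin

abbreviation "I \<equiv> exponents p m n"
abbreviation "A \<equiv> coeff_space I :: 'k coeffs set"
abbreviation "mul \<equiv> twisted_mult I w"
abbreviation "sc \<equiv> fscale (*) :: 'k \<Rightarrow> 'k coeffs \<Rightarrow> 'k coeffs"
abbreviation mon :: "(nat \<Rightarrow> nat) \<Rightarrow> 'k coeffs" where "mon \<equiv> basis_elt"

interpretation vector_space sc
  by (rule vector_space_fscale[OF vector_space_mult])

lemma zero_I [simp]: "0 \<in> I"
  using p(2) by (simp add: exponents_def)

lemma I_down: "a + b \<in> I \<Longrightarrow> a \<in> I" "a + b \<in> I \<Longrightarrow> b \<in> I"
  by (auto simp: exponents_def intro: le_less_trans)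

lemma A_subspace: "subspace A"
  by (auto simp: subspace_def coeff_space_def fscale_def)

lemma mul_mem: "mul f g \<in> A"
  by (simp add: twisted_mult_def coeff_space_def)

lemma mul_commute: "mul f g = mul g f"
proof
  fix c
  show "mul f g c = mul g f c"
    unfolding twisted_mult_def
    by (subst sum.swap) (auto intro!: sum.cong simp: add.commute w_comm mult_ac)
qed

text \<open>Written out like this, a product of three factors is seen to be associative.\<close>

lemma mul_mul_coeff:
  assumes "e \<in> I"
  shows "mul (mul f g) h e = (\<Sum>a\<in>I. \<Sum>b\<in>I. \<Sum>c\<in>I.
    if a + b + c = e then w a b * w (a + b) c * f a * g b * h c else 0)"
proof -
  let ?X = "\<lambda>a b c. w a b * w (a + b) c * f a * g b * h c"
  have "(if s + c = e then w s c * mul f g s * h c else 0) = (\<Sum>a\<in>I. \<Sum>b\<in>I.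
      if s = a + b then (if a + b + c = e then ?X a b c else 0) else 0)" if "s \<in> I" for s c
  proof (cases "s + c = e")
    case True
    then show ?thesis
      using that unfolding twisted_mult_def
      by (auto intro!: sum.cong simp: sum_distrib_left sum_distrib_right mult_ac)
  next
    case False
    then have "(if s = a + b then (if a + b + c = e then ?X a b c else 0) else 0) = 0" for a b by auto
    then show ?thesis using False by simp
  qed
  then have "mul (mul f g) h e = (\<Sum>s\<in>I. \<Sum>c\<in>I. \<Sum>a\<in>I. \<Sum>b\<in>I.
      if s = a + b then (if a + b + c = e then ?X a b c else 0) else 0)"
    using assms by (subst twisted_mult_def) simp
  also have "\<dots> = (\<Sum>c\<in>I. \<Sum>s\<in>I. \<Sum>a\<in>I. \<Sum>b\<in>I.
      if s = a + b then (if a + b + c = e then ?X a b c else 0) else 0)"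
    by (rule sum.swap)
  also have "\<dots> = (\<Sum>c\<in>I. \<Sum>a\<in>I. \<Sum>s\<in>I. \<Sum>b\<in>I.
      if s = a + b then (if a + b + c = e then ?X a b c else 0) else 0)"
    by (intro sum.cong refl sum.swap)
  also have "\<dots> = (\<Sum>c\<in>I. \<Sum>a\<in>I. \<Sum>b\<in>I. \<Sum>s\<in>I.
      if s = a + b then (if a + b + c = e then ?X a b c else 0) else 0)"
    by (intro sum.cong refl sum.swap)
  also have "\<dots> = (\<Sum>c\<in>I. \<Sum>a\<in>I. \<Sum>b\<in>I. if a + b + c = e then ?X a b c else 0)"
    using assms I_down(1) finite_exponents by (intro sum.cong refl) (auto simp: sum.delta)
  also have "\<dots> = (\<Sum>a\<in>I. \<Sum>c\<in>I. \<Sum>b\<in>I. if a + b + c = e then ?X a b c else 0)"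
    by (rule sum.swap)
  also have "\<dots> = (\<Sum>a\<in>I. \<Sum>b\<in>I. \<Sum>c\<in>I. if a + b + c = e then ?X a b c else 0)"
    by (intro sum.cong refl sum.swap)
  finally show ?thesis .
qed

lemma mul_associative: "mul (mul f g) h = mul f (mul g h)"
proof
  fix e
  show "mul (mul f g) h e = mul f (mul g h) e"
  proof (cases "e \<in> I")
    case True
    have "mul f (mul g h) e = mul (mul g h) f e" by (simp add: mul_commute)
    also have "\<dots> = (\<Sum>b\<in>I. \<Sum>c\<in>I. \<Sum>a\<in>I.
        if b + c + a = e then w b c * w (b + c) a * g b * h c * f a else 0)"
      by (rule mul_mul_coeff) fact
    also have "\<dots> = (\<Sum>b\<in>I. \<Sum>a\<in>I. \<Sum>c\<in>I.
        if b + c + a = e then w b c * w (b + c) a * g b * h c * f a else 0)"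
      by (intro sum.cong refl sum.swap)
    also have "\<dots> = (\<Sum>a\<in>I. \<Sum>b\<in>I. \<Sum>c\<in>I.
        if b + c + a = e then w b c * w (b + c) a * g b * h c * f a else 0)"
      by (rule sum.swap)
    also have "\<dots> = (\<Sum>a\<in>I. \<Sum>b\<in>I. \<Sum>c\<in>I.
        if a + b + c = e then w a b * w (a + b) c * f a * g b * h c else 0)"
    proof (intro sum.cong refl)
      fix a b c
      have "w b c * w (b + c) a = w a b * w (a + b) c"
        using w_assoc[of a b c] w_comm[of a "b + c"] by simp
      then show "(if b + c + a = e then w b c * w (b + c) a * g b * h c * f a else 0) =
          (if a + b + c = e then w a b * w (a + b) c * f a * g b * h c else 0)"
        by (simp add: add_ac mult_ac)
    qed
    also have "\<dots> = mul (mul f g) h e" by (rule mul_mul_coeff[symmetric]) fact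
    finally show ?thesis by simp
  qed (simp add: twisted_mult_def)
qed

lemma mul_add_right: "mul f (g + h) = mul f g + mul f h"
  by (auto simp: fun_eq_iff twisted_mult_def distrib_left sum.distrib if_distrib[of "\<lambda>x. x + _"]
      simp flip: sum.distrib intro!: sum.cong)

lemma mul_scale_right: "mul f (sc r g) = sc r (mul f g)"
  by (auto simp: fun_eq_iff twisted_mult_def fscale_def sum_distrib_left mult_ac intro!: sum.cong)

lemma mon_mem: "a \<in> I \<Longrightarrow> mon a \<in> A"
  by (auto simp: coeff_space_def basis_elt_def)

lemma mul_mon:
  assumes "a \<in> I" "b \<in> I"
  shows "mul (mon a) (mon b) = (if a + b \<in> I then sc (w a b) (mon (a + b)) else 0)"
proof
  fix c
  have "(\<Sum>a'\<in>I. \<Sum>b'\<in>I. if a' + b' = c then w a' b' * mon a a' * mon b b' else 0)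
      = (\<Sum>a'\<in>I. \<Sum>b'\<in>I. if a' = a \<and> b' = b then if a' + b' = c then w a' b' else 0 else 0)"
    by (intro sum.cong refl) (auto simp: basis_elt_def)
  also have "\<dots> = (if a + b = c then w a b else 0)"
    by (rule sum_delta_pair) (use assms finite_exponents in auto)
  finally have "mul (mon a) (mon b) c = (if c \<in> I \<and> a + b = c then w a b else 0)"
    by (simp add: twisted_mult_def)
  then show "mul (mon a) (mon b) c = (if a + b \<in> I then sc (w a b) (mon (a + b)) else 0) c"
    by (auto simp: fscale_def basis_elt_def)
qed

lemma mon_expansion:
  assumes "f \<in> A"
  shows "f = (\<Sum>a\<in>I. sc (f a) (mon a))"
proof
  fix b
  have "(\<Sum>a\<in>I. sc (f a) (mon a)) b = (\<Sum>a\<in>I. if a = b then f b else 0)"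
    unfolding sum_apply by (intro sum.cong) (auto simp: fscale_def basis_elt_def)
  also have "\<dots> = f b" using assms finite_exponents by (auto simp: coeff_space_def)
  finally show "f b = (\<Sum>a\<in>I. sc (f a) (mon a)) b" by simp
qed

lemma A_span: "A \<subseteq> span (mon ` I)"
proof
  fix f assume "f \<in> A"
  then have "f = (\<Sum>a\<in>I. sc (f a) (mon a))" by (rule mon_expansion)
  also have "\<dots> \<in> span (mon ` I)" by (intro span_sum span_scale span_base imageI)
  finally show "f \<in> span (mon ` I)" .
qed

lemma mul_one_left:
  assumes "f \<in> A"
  shows "mul (mon 0) f = f"
proof
  fix c
  show "mul (mon 0) f c = f c"
  proof (cases "c \<in> I")
    case True
    have "(\<Sum>a\<in>I. \<Sum>b\<in>I. if a + b = c then w a b * mon 0 a * f b else 0)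
        = (\<Sum>a\<in>I. \<Sum>b\<in>I. if a = 0 \<and> b = c then f b else 0)"
      by (intro sum.cong refl) (auto simp: basis_elt_def w_0)
    also have "\<dots> = f c"
      by (rule sum_delta_pair) (use True finite_exponents in auto)
    finally show ?thesis using True by (simp add: twisted_mult_def)
  qed (use assms in \<open>auto simp: twisted_mult_def coeff_space_def\<close>)
qed

lemma derivation_if_on_monomials:
  assumes lin: "linear_on sc A D" and out: "\<And>f. f \<notin> A \<Longrightarrow> D f = 0"
    and mon: "\<And>a b. a \<in> I \<Longrightarrow> b \<in> I \<Longrightarrow>
      D (mul (mon a) (mon b)) = mul (D (mon a)) (mon b) + mul (mon a) (D (mon b))"
  shows "D \<in> derivations sc mul A"
proof -
  interpret D: linear_on sc A D by (rule lin)
  have mul_lin: "linear_on sc A (mul f)" for f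
    by unfold_locales (auto simp: A_subspace mul_mem mul_add_right mul_scale_right)
  have lin2: "linear_on sc A (\<lambda>g. D (mul f g) - (mul (D f) g + mul f (D g)))" for f
    by unfold_locales
      (auto simp: A_subspace mul_mem D.Vd D.Va D.Vs D.closed D.add D.scl mul_add_right mul_scale_right
        scale_right_diff_distrib scale_right_distrib)
  have 1: "D (mul (mon a) g) - (mul (D (mon a)) g + mul (mon a) (D g)) \<in> {0}"
    if "a \<in> I" "g \<in> A" for a g
    by (rule linear_on.span_image_subset[OF lin2 _ subspace_single_0 _ subsetD[OF A_span that(2)]])
       (use that mon mon_mem in auto)
  have "D (mul g f) - (mul (D g) f + mul g (D f)) \<in> {0}" if "f \<in> A" "g \<in> A" for f g
  proof (rule linear_on.span_image_subset[OF lin2 _ subspace_single_0 _ subsetD[OF A_span that(1)]])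
    fix x assume "x \<in> mon ` I"
    then show "D (mul g x) - (mul (D g) x + mul g (D x)) \<in> {0}"
      using 1[OF _ that(2)] by (auto simp: mul_commute[of g] mul_commute[of "D g"] add.commute)
  qed (use mon_mem in auto)
  then have leib: "D (mul g f) = mul (D g) f + mul g (D f)" if "f \<in> A" "g \<in> A" for f g
    using that by (simp only: singleton_iff eq_iff_diff_eq_0[symmetric])
  show ?thesis
    unfolding derivations_def linear_maps_def
    by (intro CollectI conjI ballI allI impI; (rule D.closed D.add D.scl out leib; assumption))
qed

text \<open>
  The partial derivative with \<open>\<partial>\<^sub>i x\<^sup>a = \<kappa>(a\<^sub>i) x\<^sup>a\<^sup>-\<^sup>\<epsilon>\<^sup>i\<close>: here \<open>\<kappa>\<close> is \<open>1\<close> for divided powers and the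
  inclusion of the natural numbers for ordinary powers.
\<close>

definition partial :: "(nat \<Rightarrow> 'k) \<Rightarrow> nat \<Rightarrow> 'k coeffs \<Rightarrow> 'k coeffs" where
  "partial \<kappa> i f = (if f \<in> A then \<lambda>a. \<kappa> (Suc (a i)) * f (a + unit_exponent i) else 0)"

lemma partial_mem: "partial \<kappa> i f \<in> A"
  using I_down(1)[of _ "unit_exponent i"] by (auto simp: partial_def coeff_space_def)

lemma partial_linear_on: "linear_on sc A (partial \<kappa> i)"
proof unfold_locales
  show "partial \<kappa> i (f + g) = partial \<kappa> i f + partial \<kappa> i g" if "f \<in> A" "g \<in> A" for f g
    using that subspace_add[OF A_subspace that] by (simp add: partial_def fun_eq_iff distrib_left)
  show "partial \<kappa> i (sc c f) = sc c (partial \<kappa> i f)" if "f \<in> A" for c f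
    using that subspace_scale[OF A_subspace that, of c]
    by (simp add: partial_def fun_eq_iff fscale_def mult_ac)
qed (rule A_subspace partial_mem)+

lemma partial_mon:
  assumes "a \<in> I"
  shows "partial \<kappa> i (mon a) = (if a i = 0 then 0 else sc (\<kappa> (a i)) (mon (a - unit_exponent i)))"
proof
  fix b
  have "b + unit_exponent i = a \<longleftrightarrow> a i \<noteq> 0 \<and> b = a - unit_exponent i"
    by (auto simp: fun_eq_iff unit_exponent_def)
  then show "partial \<kappa> i (mon a) b
      = (if a i = 0 then 0 else sc (\<kappa> (a i)) (mon (a - unit_exponent i))) b"
    using mon_mem[OF assms]
    by (auto simp: partial_def basis_elt_def fscale_def unit_exponent_def)
qed

lemma I_diff: "a \<in> I \<Longrightarrow> a - b \<in> I"
  by (auto simp: exponents_def intro: le_less_trans[OF diff_le_self])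

text \<open>
  The hypothesis is the product rule for two monomials.  Its case \<open>a + b \<notin> I\<close> says that the
  terms of \<open>\<partial>\<^sub>i x\<^sup>a x\<^sup>b + x\<^sup>a \<partial>\<^sub>i x\<^sup>b\<close> that survive the truncation cancel, as \<open>x\<^sup>a x\<^sup>b = 0\<close>.
\<close>

lemma partial_derivation:
  assumes \<kappa>: "\<And>a b. a \<in> I \<Longrightarrow> b \<in> I \<Longrightarrow> a i + b i \<noteq> 0 \<Longrightarrow> a + b - unit_exponent i \<in> I \<Longrightarrow>
      (if a i = 0 then 0 else \<kappa> (a i) * w (a - unit_exponent i) b) +
      (if b i = 0 then 0 else \<kappa> (b i) * w a (b - unit_exponent i)) =
      (if a + b \<in> I then w a b * \<kappa> (a i + b i) else 0)"
  shows "partial \<kappa> i \<in> derivations sc mul A"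
proof (rule derivation_if_on_monomials[OF partial_linear_on])
  interpret P: linear_on sc A "partial \<kappa> i" by (rule partial_linear_on)
  show "partial \<kappa> i f = 0" if "f \<notin> A" for f using that by (simp add: partial_def)
  fix a b assume ab: "a \<in> I" "b \<in> I"
  let ?\<epsilon> = "unit_exponent i :: nat \<Rightarrow> nat"
  have mul_0: "mul x 0 = 0" "mul 0 x = 0" for x
    using mul_scale_right[of x 0 0] by (simp_all add: mul_commute[of 0])
  have scl: "mul (sc r x) y = sc r (mul x y)" for r x y
    using mul_scale_right[of y r x] by (simp add: mul_commute[of _ y])
  show "partial \<kappa> i (mul (mon a) (mon b))
      = mul (partial \<kappa> i (mon a)) (mon b) + mul (mon a) (partial \<kappa> i (mon b))"
  proof (cases "a i + b i = 0")
    case True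
    then show ?thesis
      using ab mon_mem by (auto simp: mul_mon partial_mon P.scl P.zero mul_0)
  next
    case False
    define c where "c = a + b - ?\<epsilon>"
    have ca: "a - ?\<epsilon> + b = c" if "a i \<noteq> 0"
      using that by (auto simp: c_def fun_eq_iff unit_exponent_def)
    have cb: "a + (b - ?\<epsilon>) = c" if "b i \<noteq> 0"
      using that by (auto simp: c_def fun_eq_iff unit_exponent_def)
    have cI: "c \<in> I" if "a + b \<in> I" using I_diff[OF that] by (simp add: c_def)
    have 1: "partial \<kappa> i (mul (mon a) (mon b)) = (if a + b \<in> I then sc (w a b * \<kappa> (a i + b i)) (mon c) else 0)"
      using False ab mon_mem by (auto simp: mul_mon P.scl P.zero partial_mon simp flip: c_def)
    have 2: "mul (partial \<kappa> i (mon a)) (mon b)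
        = (if a i = 0 \<or> c \<notin> I then 0 else sc (\<kappa> (a i) * w (a - ?\<epsilon>) b) (mon c))"
      using ab ca by (auto simp: partial_mon mul_0 scl mul_mon I_diff)
    have 3: "mul (mon a) (partial \<kappa> i (mon b))
        = (if b i = 0 \<or> c \<notin> I then 0 else sc (\<kappa> (b i) * w a (b - ?\<epsilon>)) (mon c))"
      using ab cb by (auto simp: partial_mon mul_0 mul_scale_right mul_mon I_diff)
    show ?thesis
    proof (cases "c \<in> I")
      case True
      have "mul (partial \<kappa> i (mon a)) (mon b) + mul (mon a) (partial \<kappa> i (mon b))
          = sc ((if a i = 0 then 0 else \<kappa> (a i) * w (a - ?\<epsilon>) b) +
              (if b i = 0 then 0 else \<kappa> (b i) * w a (b - ?\<epsilon>))) (mon c)"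
        using True unfolding 2 3 by (auto simp: scale_left_distrib)
      also have "\<dots> = partial \<kappa> i (mul (mon a) (mon b))"
        unfolding 1 using \<kappa>[OF ab False] True by (simp add: c_def)
      finally show ?thesis by simp
    next
      case False
      then show ?thesis using cI unfolding 1 2 3 by auto
    qed
  qed
qed

definition degree where "degree a = (\<Sum>i<m. a i)" for a :: "nat \<Rightarrow> nat"

definition order_at_least :: "nat \<Rightarrow> 'k coeffs set" where
  "order_at_least k = {f \<in> A. \<forall>a. degree a < k \<longrightarrow> f a = 0}"

lemma degree_add: "degree (a + b) = degree a + degree b"
  by (simp add: degree_def sum.distrib)

lemma degree_0: "a \<in> I \<Longrightarrow> degree a = 0 \<longleftrightarrow> a = 0"
proof
  assume "a \<in> I" "degree a = 0"
  then have "a i = 0" for i by (cases "i < m") (auto simp: degree_def exponents_def)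
  then show "a = 0" by (simp add: fun_eq_iff)
qed (simp add: degree_def)

lemma degree_bound: "a \<in> I \<Longrightarrow> degree a \<le> (\<Sum>i<m. p ^ n i)"
  unfolding degree_def by (intro sum_mono) (auto simp: exponents_def less_imp_le)

lemma mul_order:
  assumes "f \<in> order_at_least i" "g \<in> order_at_least j"
  shows "mul f g \<in> order_at_least (i + j)"
proof -
  have "mul f g c = 0" if "degree c < i + j" for c
  proof -
    have "w a b * f a * g b = 0" if "a + b = c" for a b
    proof -
      have "degree a < i \<or> degree b < j" using \<open>degree c < i + j\<close> that degree_add[of a b] by auto
      then show ?thesis using assms by (auto simp: order_at_least_def)
    qed
    then have "(\<Sum>a\<in>I. \<Sum>b\<in>I. if a + b = c then w a b * f a * g b else 0) = 0"
      by (intro sum.neutral ballI) (simp del: mult_eq_0_iff)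
    then show ?thesis by (simp only: twisted_mult_def if_cancel)
  qed
  then show ?thesis by (simp add: order_at_least_def mul_mem)
qed

end

text \<open>
  The coordinates are the monomials with exponents \<open>e j\<close>, and \<open>d j\<close> is a derivation taking the
  value \<open>1\<close> at the origin on the \<open>j\<close>-th coordinate and \<open>0\<close> on the others.
\<close>

locale monomial_algebra_coordinates = monomial_algebra p m n w
  for p m n and w :: "(nat \<Rightarrow> nat) \<Rightarrow> (nat \<Rightarrow> nat) \<Rightarrow> 'k::alg_closed_field" +
  fixes J :: "'j set" and e :: "'j \<Rightarrow> nat \<Rightarrow> nat" and d :: "'j \<Rightarrow> 'k coeffs \<Rightarrow> 'k coeffs"
  assumes J: "finite J"
    and e: "j \<in> J \<Longrightarrow> e j \<in> I" "inj_on e J"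
    and d: "j \<in> J \<Longrightarrow> d j \<in> derivations sc mul A" "j \<in> J \<Longrightarrow> f \<in> A \<Longrightarrow> d j f 0 = f (e j)"
    and generators: "a \<in> I \<Longrightarrow> a \<noteq> 0 \<Longrightarrow> \<exists>j\<in>J. \<exists>b\<in>I. e j \<noteq> 0 \<and> a = e j + b \<and> w (e j) b \<noteq> 0"
begin

interpretation vector_space sc
  by (rule vector_space_fscale[OF vector_space_mult])

lemma derivation_zero_if_zero_on_coordinates:
  assumes D: "D \<in> derivations sc mul A" "\<And>j. j \<in> J \<Longrightarrow> D (mon (e j)) = 0" and f: "f \<in> A"
  shows "D f = 0"
proof -
  have lin: "linear_on sc A D"
    using D(1) A_subspace vector_space_axioms
    by (auto simp: derivations_def linear_maps_def linear_on_def linear_on_axioms_def)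
  have D_mul: "D (mul x y) = mul (D x) y + mul x (D y)" if "x \<in> A" "y \<in> A" for x y
    using D(1) that by (simp add: derivations_def)
  have mul_0: "mul x 0 = 0" for x
    using mul_scale_right[of x 0 0] by simp
  have "D (mon a) = 0" if "a \<in> I" for a
    using that
  proof (induction "degree a" arbitrary: a rule: less_induct)
    case less
    show ?case
    proof (cases "a = 0")
      case True
      have "D (mul (mon 0) (mon 0)) = D (mon 0) + D (mon 0)"
        using D_mul[OF mon_mem mon_mem, of 0 0] linear_on.closed[OF lin mon_mem, of 0]
        by (simp add: mul_one_left mul_commute[of "D (mon 0)"])
      then show ?thesis using mul_one_left[OF mon_mem, of 0] True by simp
    next
      case False
      then obtain j b where j: "j \<in> J" "b \<in> I" "e j \<noteq> 0" "a = e j + b" "w (e j) b \<noteq> 0"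
        using generators less.prems by blast
      have "degree (e j) \<noteq> 0" using degree_0[OF e(1)[OF j(1)]] j(3) by simp
      then have b: "D (mon b) = 0" using j by (intro less.hyps) (auto simp: degree_add)
      have "sc (w (e j) b) (D (mon a)) = D (mul (mon (e j)) (mon b))"
        using less.prems j e(1) linear_on.scl[OF lin mon_mem[OF less.prems]] by (simp add: mul_mon)
      also have "\<dots> = 0"
        using D_mul[OF mon_mem mon_mem] j e(1) D(2) b by (simp add: mul_0 mul_commute[of 0])
      finally show ?thesis using j(5) by (simp add: scale_eq_0_iff)
    qed
  qed
  then have "D f \<in> {0}"
    by (intro linear_on.span_image_subset[OF lin _ subspace_single_0 _ subsetD[OF A_span f]])
       (auto simp: mon_mem)
  then show ?thesis by simp
qed

sublocale nilpotent_local_algebra sc p A mul "mon 0" order_at_least "Suc (\<Sum>i<m. p ^ n i)"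
  "mon ` I" J d "\<lambda>j. mon (e j)"
proof unfold_locales
  show "subspace A" by (rule A_subspace)
  show "mul a b \<in> A" "mul a b = mul b a" "mul (mul a b) c = mul a (mul b c)"
    "mul a (b + c) = mul a b + mul a c" "mul a (sc r b) = sc r (mul a b)" for a b c r
    by (rule mul_mem mul_commute mul_associative mul_add_right mul_scale_right)+
  show "mon 0 \<in> A" by (simp add: mon_mem)
  show "mon 0 \<noteq> 0" by (auto simp: basis_elt_def fun_eq_iff)
  show "a \<in> A \<Longrightarrow> mul (mon 0) a = a" for a by (rule mul_one_left)
  show "subspace (order_at_least k)" for k
    using A_subspace by (auto simp: subspace_def order_at_least_def fscale_def)
  show "order_at_least (Suc k) \<subseteq> order_at_least k" for k by (auto simp: order_at_least_def)
  show "order_at_least 0 = A" by (auto simp: order_at_least_def)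
  show "order_at_least (Suc (\<Sum>i<m. p ^ n i)) = {0}"
  proof -
    have "f = 0" if "f \<in> order_at_least (Suc (\<Sum>i<m. p ^ n i))" for f
    proof
      fix a show "f a = 0 a"
        using that degree_bound[of a]
        by (cases "a \<in> I") (auto simp: order_at_least_def coeff_space_def less_Suc_eq_le)
    qed
    then show ?thesis using subspace_0[OF A_subspace] by (auto simp: order_at_least_def)
  qed
  show "mul a b \<in> order_at_least (Suc k)"
    if "a \<in> order_at_least (Suc 0)" "b \<in> order_at_least k" for a b k
    using mul_order[OF that] by simp
  have in_m: "a - sc (a 0) (mon 0) \<in> order_at_least (Suc 0)" if "a \<in> A" for a
  proof -
    have "(a - sc (a 0) (mon 0)) b = 0" if "degree b = 0" for b
      using \<open>a \<in> A\<close> that degree_0[of b] by (cases "b \<in> I") (auto simp: fscale_def basis_elt_def coeff_space_def)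
    then show ?thesis
      using subspace_diff[OF A_subspace that subspace_scale[OF A_subspace mon_mem[OF zero_I]]]
      by (simp add: order_at_least_def)
  qed
  then show "\<exists>c. a - sc c (mon 0) \<in> order_at_least (Suc 0)" if "a \<in> A" for a using that by blast
  show "finite (mon ` I)" by (simp add: finite_exponents)
  show "mon ` I \<subseteq> A" using mon_mem by blast
  show "A \<subseteq> span (mon ` I)" by (rule A_span)
  show "mon (e j) \<in> A" if "j \<in> J" for j using that by (simp add: mon_mem e)
  show "d i (mon (e j)) - (if i = j then mon 0 else 0) \<in> order_at_least (Suc 0)"
    if "i \<in> J" "j \<in> J" for i j
  proof -
    have A: "d i (mon (e j)) \<in> A"
      using d(1)[OF that(1)] mon_mem[OF e(1)[OF that(2)]] by (auto simp: derivations_def linear_maps_def)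
    have "d i (mon (e j)) 0 = (if i = j then 1 else 0)"
      using d(2)[OF that(1) mon_mem[OF e(1)[OF that(2)]]] that e(2)
      by (auto simp: basis_elt_def inj_on_def)
    then have "sc (d i (mon (e j)) 0) (mon 0) = (if i = j then mon 0 else 0)" by auto
    then show ?thesis using in_m[OF A] by simp
  qed
qed (use p J d derivation_zero_if_zero_on_coordinates in auto)

lemma maximal_ideal_iff: "f \<in> A \<Longrightarrow> f \<in> order_at_least (Suc 0) \<longleftrightarrow> f 0 = 0"
proof -
  assume f: "f \<in> A"
  have "f b = 0" if "f 0 = 0" "degree b = 0" for b
    using f that degree_0[of b] by (cases "b \<in> I") (auto simp: coeff_space_def)
  moreover have "degree 0 = 0" by (simp add: degree_def)
  ultimately show ?thesis using f by (auto simp: order_at_least_def)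
qed

end

section \<open>The generalized Witt algebras\<close>

lemma prime_dvd_choose_prime_power:
  fixes p :: nat
  assumes "prime p" "0 < k" "k < p ^ j"
  shows "p dvd p ^ j choose k"
proof (rule ccontr)
  assume "\<not> p dvd p ^ j choose k"
  then have "coprime (p ^ j) (p ^ j choose k)"
    using assms(1) by (simp add: prime_imp_coprime)
  moreover have "p ^ j dvd k * (p ^ j choose k)"
    using times_binomial_minus1_eq[OF assms(2), of "p ^ j"] by simp
  ultimately have "p ^ j dvd k" by (simp add: coprime_dvd_mult_left_iff)
  then show False using assms by (auto dest: dvd_imp_le)
qed

text \<open>
  The inductive step of a special case of Lucas' theorem, by which \<open>a choose p ^ j\<close> is congruent to
  \<open>a div p ^ j\<close>.
\<close>

lemma choose_prime_power_add:
  fixes p :: nat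
  assumes "prime p"
  shows "[(p ^ j + a) choose (p ^ j) = (a choose (p ^ j)) + 1] (mod p)"
proof -
  have "p dvd (\<Sum>k\<in>{..p ^ j} - {0, p ^ j}. (p ^ j choose k) * (a choose (p ^ j - k)))"
    using assms prime_dvd_choose_prime_power[OF assms] by (intro dvd_sum) (auto intro!: dvd_mult2)
  then obtain q where "(\<Sum>k\<in>{..p ^ j} - {0, p ^ j}. (p ^ j choose k) * (a choose (p ^ j - k))) = p * q"
    by (elim dvdE)
  moreover have "p ^ j > 0" using assms by (simp add: prime_gt_0_nat)
  then have "(\<Sum>k\<le>p ^ j. (p ^ j choose k) * (a choose (p ^ j - k)))
      = (\<Sum>k\<in>{..p ^ j} - {0, p ^ j}. (p ^ j choose k) * (a choose (p ^ j - k)))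
        + (\<Sum>k\<in>{0, p ^ j}. (p ^ j choose k) * (a choose (p ^ j - k)))"
    by (intro sum.subset_diff) auto
  moreover have "(\<Sum>k\<in>{0, p ^ j}. (p ^ j choose k) * (a choose (p ^ j - k))) = (a choose (p ^ j)) + 1"
    using \<open>p ^ j > 0\<close> by simp
  ultimately show ?thesis
    unfolding cong_def vandermonde[symmetric] by (simp only: add.assoc mod_mult_self4)
qed

lemma choose_leading_digit:
  fixes p :: nat
  assumes p: "prime p" and a: "p ^ j \<le> a" "a < p ^ Suc j"
  shows "\<not> p dvd a choose (p ^ j)"
proof -
  have "[a choose (p ^ j) = a div p ^ j] (mod p)" for a
  proof (induction a rule: less_induct)
    case (less a)
    have q: "p ^ j > 0" using p by (simp add: prime_gt_0_nat)
    show ?case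
    proof (cases "a < p ^ j")
      case True
      then show ?thesis by (simp add: binomial_eq_0)
    next
      case False
      then obtain b where b: "a = p ^ j + b" by (metis le_Suc_ex not_le)
      then have "[b choose (p ^ j) = b div p ^ j] (mod p)" using q by (intro less) simp
      then have "[(b choose (p ^ j)) + 1 = b div p ^ j + 1] (mod p)" by (intro cong_add) auto
      moreover have "a div p ^ j = b div p ^ j + 1" using q by (simp add: b)
      ultimately show ?thesis using choose_prime_power_add[OF p, of j b] by (simp add: b cong_def)
    qed
  qed
  then have "p dvd a choose (p ^ j) \<longleftrightarrow> p dvd a div p ^ j" by (rule cong_dvd_iff)
  moreover have "0 < a div p ^ j" "a div p ^ j < p"
    using a p by (auto simp: div_greater_zero_iff prime_gt_0_nat less_mult_imp_div_less mult.commute)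
  ultimately show ?thesis by (auto dest: dvd_imp_le)
qed

definition binomial_cocycle :: "nat \<Rightarrow> (nat \<Rightarrow> nat) \<Rightarrow> (nat \<Rightarrow> nat) \<Rightarrow> 'k::field" where
  "binomial_cocycle m a b = of_nat (\<Prod>i<m. (a i + b i) choose a i)"

lemma divided_power_mult_eq:
  "divided_power_mult p m n = twisted_mult (exponents p m n) (binomial_cocycle m)"
  by (intro ext) (simp only: divided_power_mult_def twisted_mult_sum_pairs[OF finite_exponents]
      binomial_cocycle_def)

lemma binomial_cocycle_assoc:
  "binomial_cocycle m a b * binomial_cocycle m (a + b) c
    = (binomial_cocycle m b c * binomial_cocycle m a (b + c) :: 'k::field)"
proof -
  have "((x + y) choose x) * ((x + y + z) choose (x + y)) = ((y + z) choose y) * ((x + (y + z)) choose x)"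
    for x y z :: nat
    using choose_mult[of x "x + y" "x + y + z"] by (simp add: mult.commute add.assoc)
  then show ?thesis
    unfolding binomial_cocycle_def of_nat_mult[symmetric] prod.distrib[symmetric] by simp
qed

locale divided_power_algebra =
  fixes p m :: nat and n :: "nat \<Rightarrow> nat" and L :: "('k::alg_closed_field coeffs \<Rightarrow> 'k coeffs) set"
  assumes char: "CHAR('k) = p" "p > 0" and m: "m \<ge> 1" and n: "i < m \<Longrightarrow> n i \<ge> 1" and L_eq: "L = W p m n"
begin

sublocale monomial_algebra p m n "binomial_cocycle m :: _ \<Rightarrow> _ \<Rightarrow> 'k"
proof
  show "binomial_cocycle m a b * binomial_cocycle m (a + b) c
    = (binomial_cocycle m b c * binomial_cocycle m a (b + c) :: 'k)" for a b c
    by (rule binomial_cocycle_assoc)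
  show "binomial_cocycle m a b = (binomial_cocycle m b a :: 'k)" for a b
  proof -
    have "((x + y) choose x) = ((y + x) choose y)" for x y :: nat
      using binomial_symmetric[of x "x + y"] by (simp add: add.commute)
    then show ?thesis by (simp add: binomial_cocycle_def)
  qed
qed (auto simp: char binomial_cocycle_def)

interpretation vector_space sc
  by (rule vector_space_fscale[OF vector_space_mult])

lemma prime_char: "prime p"
  using char prime_CHAR_semidom[where ?'a = 'k] by simp

abbreviation pd :: "nat \<Rightarrow> 'k coeffs \<Rightarrow> 'k coeffs" where "pd \<equiv> partial (\<lambda>_. 1)"

text \<open>
  Pascal's rule in the \<open>i\<close>-th exponent.  At the first exponent cut off by the truncation the sum is \<open>p ^ n i\<close>,
  and the binomial coefficients on the two sides add up to a multiple of \<open>p\<close>.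
\<close>

lemma pd_derivation:
  assumes i: "i < m"
  shows "pd i \<in> derivations sc mul A"
proof (rule partial_derivation)
  fix a b assume ab: "a \<in> I" "b \<in> I" "a i + b i \<noteq> 0" "a + b - unit_exponent i \<in> I"
  let ?w = "binomial_cocycle m :: _ \<Rightarrow> _ \<Rightarrow> 'k" and ?\<epsilon> = "unit_exponent i :: nat \<Rightarrow> nat"
  let ?R = "\<Prod>j\<in>{..<m} - {i}. (a j + b j) choose a j"
  have split: "?w a' b' = of_nat ((a' i + b' i) choose a' i) * of_nat ?R"
    if "\<And>j. j \<noteq> i \<Longrightarrow> a' j = a j \<and> b' j = b j" for a' b'
  proof -
    have "(\<Prod>j\<in>{..<m} - {i}. (a' j + b' j) choose a' j) = ?R" using that by (intro prod.cong) auto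
    then show ?thesis
      using i unfolding binomial_cocycle_def of_nat_mult[symmetric]
      by (subst prod.remove[of "{..<m}" i]) auto
  qed
  have e: "(a - ?\<epsilon>) i = a i - 1" "(b - ?\<epsilon>) i = b i - 1" by (auto simp: unit_exponent_def)
  have w1: "?w (a - ?\<epsilon>) b = of_nat ((a i - 1 + b i) choose (a i - 1)) * of_nat ?R"
    using split[of "a - ?\<epsilon>" b] by (simp add: unit_exponent_def)
  have w2: "?w a (b - ?\<epsilon>) = of_nat ((a i + (b i - 1)) choose a i) * of_nat ?R"
    using split[of a "b - ?\<epsilon>"] by (simp add: unit_exponent_def)
  have w3: "?w a b = of_nat ((a i + b i) choose a i) * of_nat ?R"
    by (rule split) auto
  have "(if a i = 0 then 0 else 1 * ?w (a - ?\<epsilon>) b) + (if b i = 0 then 0 else 1 * ?w a (b - ?\<epsilon>)) = ?w a b"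
  proof (cases "a i = 0 \<or> b i = 0")
    case True
    then show ?thesis using ab(3) unfolding w1 w2 w3 by auto
  next
    case False
    then obtain x y where xy: "a i = Suc x" "b i = Suc y" by (metis not0_implies_Suc)
    show ?thesis unfolding w1 w2 w3 using xy by (simp add: distrib_right)
  qed
  moreover have "?w a b = 0" if "a + b \<notin> I"
  proof -
    have "\<exists>l<m. a l + b l \<ge> p ^ n l"
    proof (rule ccontr)
      assume "\<not> ?thesis"
      then have "a + b \<in> I" using ab(1,2) by (auto simp: exponents_def not_le)
      then show False using that by simp
    qed
    then obtain l where l: "l < m" "a l + b l \<ge> p ^ n l" by blast
    have "(a + b - ?\<epsilon>) l < p ^ n l" using ab(4) l(1) by (auto simp: exponents_def)
    then have li: "l = i" and sum: "a i + b i = p ^ n i"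
      using l(2) by (auto simp: unit_exponent_def split: if_splits)
    have "a i < p ^ n i" "b i < p ^ n i" using ab(1,2) i by (auto simp: exponents_def)
    then have "p dvd (a i + b i) choose a i"
      unfolding sum using sum by (intro prime_dvd_choose_prime_power[OF prime_char]) auto
    then have "(of_nat ((a i + b i) choose a i) :: 'k) = 0"
      using char by (simp add: of_nat_eq_0_iff_char_dvd)
    then show ?thesis unfolding w3 by simp
  qed
  ultimately show "(if a i = 0 then 0 else 1 * ?w (a - ?\<epsilon>) b) + (if b i = 0 then 0 else 1 * ?w a (b - ?\<epsilon>))
      = (if a + b \<in> I then ?w a b * 1 else 0)" by simp
qed

text \<open>
  As an algebra \<open>A(m,n)\<close> is generated by the divided powers of the \<open>x\<^sub>i\<close> with exponents \<open>p ^ j\<close>,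
  \<open>j < n i\<close>, because the leading digit of an exponent in base \<open>p\<close> can be split off.  The
  matching derivations are the \<open>p ^ j\<close>-th powers of the \<open>\<partial>\<^sub>i\<close>.
\<close>

abbreviation "coords \<equiv> SIGMA i:{..<m}. {..<n i}"

definition coord_exponent :: "nat \<times> nat \<Rightarrow> nat \<Rightarrow> nat" where
  "coord_exponent = (\<lambda>(i, j) l. if l = i then p ^ j else 0)"

abbreviation coord_derivation :: "nat \<times> nat \<Rightarrow> 'k coeffs \<Rightarrow> 'k coeffs" where
  "coord_derivation \<equiv> \<lambda>(i, j). (p_map p ^^ j) (pd i)"

lemma pd_funpow: "f \<in> A \<Longrightarrow> (pd i ^^ k) f \<in> A \<and> (pd i ^^ k) f a = f (\<lambda>l. a l + (if l = i then k else 0))"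
proof (induction k arbitrary: a)
  case (Suc k)
  then have "(pd i ^^ k) f \<in> A" by blast
  then have "pd i ((pd i ^^ k) f) a = (pd i ^^ k) f (a + unit_exponent i)"
    by (subst partial_def) simp
  then have "(pd i ^^ Suc k) f a = (pd i ^^ k) f (a + unit_exponent i)"
    by simp
  also have "\<dots> = f (\<lambda>l. (a + unit_exponent i) l + (if l = i then k else 0))" using Suc by blast
  also have "(\<lambda>l. (a + unit_exponent i) l + (if l = i then k else 0))
      = (\<lambda>l. a l + (if l = i then Suc k else 0))"
    by (auto simp: unit_exponent_def)
  finally show ?case using partial_mem by simp
qed simp

sublocale monomial_algebra_coordinates p m n "binomial_cocycle m :: _ \<Rightarrow> _ \<Rightarrow> 'k"
  coords coord_exponent coord_derivation
proof
  have p1: "p > 1" using prime_char by (rule prime_gt_1_nat)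
  show "finite coords" by auto
  show "coord_exponent j \<in> I" if "j \<in> coords" for j
    using that p1 by (auto simp: exponents_def coord_exponent_def)
  show "inj_on coord_exponent coords"
  proof (rule inj_onI, clarify)
    fix i j i' j' assume eq: "coord_exponent (i, j) = coord_exponent (i', j')"
    have "i = i'"
      using fun_cong[OF eq, of i] p1 by (auto simp: coord_exponent_def split: if_splits)
    moreover from this have "p ^ j = p ^ j'"
      using fun_cong[OF eq, of i] by (simp add: coord_exponent_def)
    ultimately show "i = i' \<and> j = j'" using p1 by simp
  qed
  show "coord_derivation j \<in> derivations sc mul A" if "j \<in> coords" for j
  proof -
    have "restricted_subalgebra sc p (derivations sc mul A)"
    proof (rule restricted_subalgebra_derivations[OF vector_space_axioms A_subspace char])
      have "mul (f + g) h = mul f h + mul g h" for f g h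
        by (simp add: mul_commute[of _ h] mul_add_right)
      then show "mul (f + g) h = mul f h + mul g h" for f g h .
      show "mul (sc c f) g = sc c (mul f g)" for c f g
        by (simp add: mul_commute[of _ g] mul_scale_right)
    qed (rule mul_mem mul_add_right mul_scale_right)+
    then have closed: "p_map p D \<in> derivations sc mul A" if "D \<in> derivations sc mul A" for D
      using that by (simp add: restricted_subalgebra_def)
    have "(p_map p ^^ l) D \<in> derivations sc mul A" if "D \<in> derivations sc mul A" for D l
      by (induction l) (auto intro: closed that)
    then show ?thesis using that pd_derivation by auto
  qed
  show "coord_derivation j f 0 = f (coord_exponent j)" if "j \<in> coords" "f \<in> A" for j f
    using that(2) by (auto simp: p_map_funpow pd_funpow coord_exponent_def split: prod.splits)
  show "\<exists>j\<in>coords. \<exists>b\<in>I. coord_exponent j \<noteq> 0 \<and> a = coord_exponent j + b \<and>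
      binomial_cocycle m (coord_exponent j) b \<noteq> (0 :: 'k)" if a: "a \<in> I" "a \<noteq> 0" for a
  proof -
    obtain i where i: "a i \<noteq> 0" using a(2) by (auto simp: fun_eq_iff)
    have "\<forall>i\<ge>m. a i = 0" using a(1) by (simp add: exponents_def)
    then have im: "i < m" using i by (meson not_le)
    then have ain: "a i < p ^ n i" using a(1) by (simp add: exponents_def)
    obtain j where j: "p ^ j \<le> a i" "a i < p ^ Suc j"
      using ex_power_ivl1[of p "a i"] p1 i by auto
    have "p ^ j < p ^ n i" using j(1) ain by simp
    then have jn: "j < n i" using p1 by simp
    let ?e = "coord_exponent (i, j)"
    define b where "b = a - ?e"
    have ab: "a = ?e + b" using j(1) by (auto simp: b_def coord_exponent_def fun_eq_iff)
    have "(\<Prod>l<m. (?e l + b l) choose ?e l) = (\<Prod>l<m. if l = i then a i choose p ^ j else 1)"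
      using fun_cong[OF ab, of i] by (intro prod.cong) (auto simp: coord_exponent_def)
    also have "\<dots> = a i choose p ^ j" using im by simp
    finally have "binomial_cocycle m ?e b \<noteq> (0 :: 'k)"
      using choose_leading_digit[OF prime_char j] char
      by (simp add: binomial_cocycle_def of_nat_eq_0_iff_char_dvd)
    moreover have "b \<in> I" using a(1) by (simp add: b_def I_diff)
    moreover have "?e \<noteq> 0"
      using p1 by (auto simp: coord_exponent_def fun_eq_iff)
    ultimately show ?thesis using ab im jn by (intro bexI[of _ "(i, j)"]) auto
  qed
qed


interpretation Op: vector_space "fscale sc :: 'k \<Rightarrow> ('k coeffs \<Rightarrow> 'k coeffs) \<Rightarrow> _"
  by (rule vector_space_fscale) (rule vector_space_axioms)

definition vector_field :: "(nat \<Rightarrow> 'k coeffs) \<Rightarrow> 'k coeffs \<Rightarrow> 'k coeffs" where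
  "vector_field u f = (\<Sum>i<m. mul (u i) (pd i f))"

lemma L_vector_fields: "L = {vector_field u | u. \<forall>i<m. u i \<in> A}"
proof -
  have "(\<lambda>f. if f \<in> A then \<Sum>i<m. divided_power_mult p m n (u i) (divided_power_partial i f) else 0)
      = vector_field u" for u
    by (auto simp: fun_eq_iff vector_field_def divided_power_mult_eq partial_def divided_power_partial_def)
  then show ?thesis unfolding L_eq W_def by simp
qed

lemma vector_field_in_Der: "vector_field u \<in> Der"
proof -
  have "vector_field u = (\<Sum>i<m. (\<lambda>f. mul (u i) (pd i f)))"
    by (rule ext) (simp only: vector_field_def sum_apply)
  also have "\<dots> \<in> Der"
    by (intro Op.subspace_sum[OF Der_subspace] multiple_in_Der pd_derivation) simp
  finally show ?thesis .
qed

lemma pd_commute: "f \<in> A \<Longrightarrow> pd i (pd j f) = pd j (pd i f)"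
  using partial_mem[of "\<lambda>_. 1" i f] partial_mem[of "\<lambda>_. 1" j f]
  by (simp add: partial_def[of _ i "pd j f"] partial_def[of _ j "pd i f"])
     (simp add: partial_def add.assoc add.commute[of "unit_exponent i :: nat \<Rightarrow> nat"])

lemma commutator_vector_field:
  "commutator (vector_field u) (vector_field v) = vector_field (\<lambda>j. vector_field u (v j) - vector_field v (u j))"
  if uv: "\<And>i. i < m \<Longrightarrow> u i \<in> A" "\<And>i. i < m \<Longrightarrow> v i \<in> A"
proof
  fix f
  have second: "vector_field u (vector_field v f)
      = (\<Sum>i<m. mul (vector_field u (v i)) (pd i f)) + (\<Sum>i<m. \<Sum>j<m. mul (mul (u j) (v i)) (pd j (pd i f)))"
    if "\<And>i. i < m \<Longrightarrow> u i \<in> A" "\<And>i. i < m \<Longrightarrow> v i \<in> A" for u v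
  proof -
    have lin: "linear_on sc A (vector_field u)" by (rule Der_linear[OF vector_field_in_Der])
    have "vector_field u (vector_field v f) = (\<Sum>i<m. vector_field u (mul (v i) (pd i f)))"
      unfolding vector_field_def[of v] by (rule linear_on.sum[OF lin]) simp
    also have "\<dots> = (\<Sum>i<m. mul (vector_field u (v i)) (pd i f) + mul (v i) (vector_field u (pd i f)))"
      using that by (intro sum.cong refl Der_mul[OF vector_field_in_Der]) (auto simp: partial_mem)
    also have "\<dots> = (\<Sum>i<m. mul (vector_field u (v i)) (pd i f) + (\<Sum>j<m. mul (mul (u j) (v i)) (pd j (pd i f))))"
      unfolding vector_field_def[of u "pd _ f"] mul_sum
      by (intro sum.cong refl arg_cong2[where f = "(+)"]) (simp only: mul_assoc mul_left_comm)
    finally show ?thesis by (simp add: sum.distrib)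
  qed
  show "commutator (vector_field u) (vector_field v) f
      = vector_field (\<lambda>j. vector_field u (v j) - vector_field v (u j)) f"
  proof (cases "f \<in> A")
    case True
    have "(\<Sum>i<m. \<Sum>j<m. mul (mul (u j) (v i)) (pd j (pd i f)))
        = (\<Sum>i<m. \<Sum>j<m. mul (mul (v j) (u i)) (pd j (pd i f)))"
      by (subst sum.swap, intro sum.cong refl) (simp only: mul_comm[of "u _"] pd_commute[OF True])
    moreover have "vector_field (\<lambda>j. vector_field u (v j) - vector_field v (u j)) f
        = (\<Sum>i<m. mul (vector_field u (v i)) (pd i f)) - (\<Sum>i<m. mul (vector_field v (u i)) (pd i f))"
      unfolding vector_field_def[of _ f] mul_diff2 sum_subtractf ..
    ultimately show ?thesis
      using second[of u v, OF uv] second[of v u, OF uv(2,1)] by (simp add: commutator_def)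
  next
    case False
    have "vector_field w f = 0" for w by (rule Der_outside[OF vector_field_in_Der False])
    then show ?thesis using Der_0[OF vector_field_in_Der] by (simp add: commutator_def)
  qed
qed

lemma L_subspace: "Op.subspace L"
proof (unfold Op.subspace_def, intro conjI ballI allI)
  have "vector_field (\<lambda>_. 0) = 0" by (simp add: fun_eq_iff vector_field_def)
  then show "0 \<in> L" unfolding L_vector_fields by (intro CollectI exI[of _ "\<lambda>_. 0"]) auto
next
  fix D E assume "D \<in> L" "E \<in> L"
  then obtain u v where uv: "D = vector_field u" "E = vector_field v" "\<forall>i<m. u i \<in> A" "\<forall>i<m. v i \<in> A"
    by (auto simp: L_vector_fields)
  then have "D + E = vector_field (\<lambda>i. u i + v i)"
    by (auto simp: fun_eq_iff vector_field_def mul_add2 sum.distrib)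
  then show "D + E \<in> L" using uv unfolding L_vector_fields by (intro CollectI exI[of _ "\<lambda>i. u i + v i"]) auto
next
  fix c D assume "D \<in> L"
  then obtain u where u: "D = vector_field u" "\<forall>i<m. u i \<in> A" by (auto simp: L_vector_fields)
  have "fscale sc c D = vector_field (\<lambda>i. sc c (u i))"
    unfolding u(1) fscale_def[of sc] vector_field_def mul_scale2 scale_sum_right ..
  then show "fscale sc c D \<in> L" using u unfolding L_vector_fields by (intro CollectI exI[of _ "\<lambda>i. sc c (u i)"]) auto
qed

lemma L_module: "a \<in> A \<Longrightarrow> E \<in> L \<Longrightarrow> (\<lambda>x. mul a (E x)) \<in> L"
proof -
  assume "a \<in> A" "E \<in> L"
  then obtain u where u: "E = vector_field u" "\<forall>i<m. u i \<in> A" by (auto simp: L_vector_fields)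
  then have "(\<lambda>x. mul a (E x)) = vector_field (\<lambda>i. mul a (u i))"
    by (auto simp: vector_field_def mul_sum mul_assoc)
  then show ?thesis unfolding L_vector_fields by (intro CollectI exI[of _ "\<lambda>i. mul a (u i)"]) auto
qed

lemma pd_in_L: "pd 0 \<in> L"
proof -
  have "vector_field (\<lambda>i. if i = 0 then mon 0 else 0) f = pd 0 f" for f
  proof -
    have "vector_field (\<lambda>i. if i = 0 then mon 0 else 0) f = (\<Sum>i<m. if i = 0 then pd 0 f else 0)"
      unfolding vector_field_def using partial_mem by (intro sum.cong) (auto simp: mul_one)
    then show ?thesis using m by simp
  qed
  then have "pd 0 = vector_field (\<lambda>i. if i = 0 then mon 0 else 0)" by auto
  then show ?thesis
    unfolding L_vector_fields using mon_mem[OF zero_I]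
    by (intro CollectI exI[of _ "\<lambda>i. if i = 0 then mon 0 else 0"]) auto
qed

abbreviation (input) "normalizer \<equiv> {D \<in> Der. \<forall>E\<in>L. commutator D E \<in> L}"

lemma pd_coordinate: "unit_exponent 0 \<in> I" "pd 0 (mon (unit_exponent 0)) = mon 0"
proof -
  have "p ^ 1 \<le> p ^ n 0" using n[of 0] m char by (intro power_increasing) auto
  then show "unit_exponent 0 \<in> I"
    using m prime_gt_1_nat[OF prime_char] by (auto simp: exponents_def unit_exponent_def)
  then show "pd 0 (mon (unit_exponent 0)) = mon 0"
    by (simp add: partial_mon) (simp add: unit_exponent_def fun_eq_iff zero_fun_def)
qed

sublocale normalized_subalgebra sc p A mul "mon 0" order_at_least "Suc (\<Sum>i<m. p ^ n i)"
  "mon ` I" coords coord_derivation "\<lambda>j. mon (coord_exponent j)" L normalizer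
proof
  have LD: "L \<subseteq> Der" by (auto simp: L_vector_fields vector_field_in_Der)
  show "Op.subspace L" by (rule L_subspace)
  show "L \<subseteq> normalizer"
  proof (intro subsetI CollectI conjI ballI)
    fix D E assume "D \<in> L" "E \<in> L"
    then obtain u v where uv: "D = vector_field u" "E = vector_field v" "\<forall>i<m. u i \<in> A" "\<forall>i<m. v i \<in> A"
      by (auto simp: L_vector_fields)
    have "commutator D E = vector_field (\<lambda>j. vector_field u (v j) - vector_field v (u j))"
      unfolding uv(1,2) using uv(3,4) by (intro commutator_vector_field) auto
    then show "commutator D E \<in> L"
      unfolding L_vector_fields using Der_closed[OF vector_field_in_Der] uv(3,4) by auto
  qed (use LD in auto)
  show "restricted_subalgebra sc p normalizer" by (rule normalizer_restricted[OF L_subspace LD])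
  (* If D commutes with the first partial derivative and with its multiple by a, then D a = 0. *)
  fix D assume D: "D \<in> normalizer" and zero: "\<And>E. E \<in> L \<Longrightarrow> commutator D E = 0"
  have "D a = 0" if a: "a \<in> A" for a
  proof -
    let ?x = "mon (unit_exponent 0)"
    have xA: "?x \<in> A" using pd_coordinate(1) by (rule mon_mem)
    have "0 = commutator D (\<lambda>x. mul a (pd 0 x)) ?x"
      using zero[OF L_module[OF a pd_in_L]] by simp
    also have "\<dots> = D (mul a (mon 0)) - mul a (pd 0 (D ?x))"
      by (simp add: commutator_def pd_coordinate)
    also have "pd 0 (D ?x) = D (pd 0 ?x)"
      using fun_cong[OF zero[OF pd_in_L], of ?x] by (simp add: commutator_def)
    also have "\<dots> = 0" unfolding pd_coordinate(2) using D Der_one by blast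
    finally have "0 = D (mul a (mon 0)) - mul a 0" .
    then show ?thesis unfolding mul_one_right[OF a] mul_0 diff_zero by (rule sym)
  qed
  then show "D = 0" using D Der_outside by (auto simp: fun_eq_iff)
qed auto

theorem witt_weights:
  assumes "t \<subseteq> p_envelope op_scale p L" "torus op_scale p t"
  shows "weights op_scale L t = Lie_p op_scale p t - {0}"
proof (rule weights_eq_Lie_p_if_module[OF assms L_module pd_in_L])
  show "mon (unit_exponent 0) \<in> A" by (rule mon_mem) (rule pd_coordinate)
  show "pd 0 (mon (unit_exponent 0)) \<notin> order_at_least (Suc 0)"
    unfolding pd_coordinate maximal_ideal_iff[OF mon_mem[OF zero_I]] by (simp add: basis_elt_def)
qed

end

section \<open>The Hamiltonian algebra\<close>

lemma B2_mult_eq: "B2_mult p = twisted_mult (B2_exponents p) (\<lambda>_ _. 1)"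
  by (intro ext) (simp add: B2_mult_def twisted_mult_sum_pairs[OF finite_exponents])

locale hamiltonian_algebra =
  fixes p :: nat and n :: "nat \<Rightarrow> nat" and L :: "('k::alg_closed_field coeffs \<Rightarrow> 'k coeffs) set"
  assumes char: "CHAR('k) = p" "p > 2" and n: "n = (\<lambda>_. 1)" and L_eq: "L = H2_tau_derived p"
begin

sublocale monomial_algebra p 2 n "\<lambda>_ _. 1 :: 'k"
  by unfold_locales (use char in auto)

interpretation vector_space sc
  by (rule vector_space_fscale[OF vector_space_mult])

abbreviation pd :: "nat \<Rightarrow> 'k coeffs \<Rightarrow> 'k coeffs" where "pd \<equiv> partial of_nat"

text \<open>
  At the first exponent cut off by the truncation the sum is \<open>p\<close>, which vanishes in \<open>k\<close>.
\<close>

lemma pd_derivation: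
  assumes i: "i < 2"
  shows "pd i \<in> derivations sc mul A"
proof (rule partial_derivation)
  fix a b assume ab: "a \<in> I" "b \<in> I" "a i + b i \<noteq> 0" "a + b - unit_exponent i \<in> I"
  have "(of_nat (a i + b i) :: 'k) = 0" if "a + b \<notin> I"
  proof -
    have "\<exists>l<2. a l + b l \<ge> p"
    proof (rule ccontr)
      assume "\<not> ?thesis"
      then have "a + b \<in> I" using ab(1,2) by (auto simp: exponents_def n not_le)
      then show False using that by simp
    qed
    then obtain l where l: "l < 2" "a l + b l \<ge> p" by blast
    have "(a + b - unit_exponent i) l < p" using ab(4) l(1) by (auto simp: exponents_def n)
    then have "a i + b i = p" using l(2) by (auto simp: unit_exponent_def split: if_splits)
    then show ?thesis using char(1) of_nat_CHAR[where ?'a = 'k] by simp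
  qed
  then show "(if a i = 0 then 0 else of_nat (a i) * 1) + (if b i = 0 then 0 else of_nat (b i) * 1)
      = (if a + b \<in> I then 1 * of_nat (a i + b i) else (0 :: 'k))" by auto
qed

sublocale monomial_algebra_coordinates p 2 n "\<lambda>_ _. 1 :: 'k" "{0, Suc 0}" unit_exponent pd
proof
  show "unit_exponent j \<in> I" if "j \<in> {0, Suc 0}" for j
    using that char(2) by (auto simp: exponents_def n unit_exponent_def)
  show "inj_on unit_exponent {0, Suc 0}"
    by (auto simp: inj_on_def unit_exponent_def fun_eq_iff split: if_splits)
  show "pd j \<in> derivations sc mul A" if "j \<in> {0, Suc 0}" for j
    using that by (intro pd_derivation) auto
  show "pd j f 0 = f (unit_exponent j)" if "f \<in> A" for j f
    using that by (simp add: partial_def)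
  show "\<exists>j\<in>{0, Suc 0}. \<exists>b\<in>I. unit_exponent j \<noteq> 0 \<and> a = unit_exponent j + b \<and> (1 :: 'k) \<noteq> 0"
    if a: "a \<in> I" "a \<noteq> 0" for a
  proof -
    obtain i where i: "a i \<noteq> 0" using a(2) by (auto simp: fun_eq_iff)
    have "\<forall>l\<ge>2. a l = 0" using a(1) by (simp add: exponents_def n)
    then have "i < 2" using i by (meson not_le)
    moreover have "a = unit_exponent i + (a - unit_exponent i)"
      using i by (auto simp: fun_eq_iff unit_exponent_def)
    moreover have "unit_exponent i i \<noteq> (0 :: nat)" by (simp add: unit_exponent_def)
    then have "(unit_exponent i :: nat \<Rightarrow> nat) \<noteq> 0" by (metis zero_fun_apply)
    ultimately show ?thesis using I_diff[OF a(1)] by (intro bexI[of _ i]) auto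
  qed
qed auto

interpretation Op: vector_space "fscale sc :: 'k \<Rightarrow> ('k coeffs \<Rightarrow> 'k coeffs) \<Rightarrow> _"
  by (rule vector_space_fscale) (rule vector_space_axioms)

abbreviation "H \<equiv> H2_tau p :: ('k coeffs \<Rightarrow> 'k coeffs) set"
abbreviation "x1 \<equiv> mon (unit_exponent 0)"
abbreviation "x2 \<equiv> mon (unit_exponent (Suc 0))"
abbreviation "e1 \<equiv> mon 0"

definition top_exponent :: "nat \<Rightarrow> nat" where "top_exponent = (\<lambda>i. if i < 2 then p - 1 else 0)"

abbreviation "z \<equiv> mon top_exponent"

lemma W2_eq: "W2 p = Der"
  by (simp add: W2_def B2_mult_eq B2_def n)

lemma unit_I: "unit_exponent 0 \<in> I" "unit_exponent (Suc 0) \<in> I" "top_exponent \<in> I"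
  using char(2) by (auto simp: exponents_def n unit_exponent_def top_exponent_def)

lemma x_A [simp]: "x1 \<in> A" "x2 \<in> A" "z \<in> A" "e1 \<in> A"
  using unit_I by (auto simp: mon_mem)

lemma pd_Der: "pd 0 \<in> Der" "pd (Suc 0) \<in> Der"
  by (rule pd_derivation, simp)+

lemma pd_A [simp]: "pd i f \<in> A"
  by (rule partial_mem)

lemma pd_x: "pd 0 x1 = e1" "pd (Suc 0) x1 = 0" "pd 0 x2 = 0" "pd (Suc 0) x2 = e1"
proof -
  have "unit_exponent i - unit_exponent i = (0 :: nat \<Rightarrow> nat)" for i by (simp add: fun_eq_iff)
  then show "pd 0 x1 = e1" "pd (Suc 0) x1 = 0" "pd 0 x2 = 0" "pd (Suc 0) x2 = e1"
    by (simp_all add: partial_mon[OF unit_I(1)] partial_mon[OF unit_I(2)]) (simp_all add: unit_exponent_def)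
qed

lemma pd_commute:
  assumes f: "f \<in> A"
  shows "pd 0 (pd (Suc 0) f) = pd (Suc 0) (pd 0 f)"
proof
  fix a
  have pd_apply: "pd i g b = of_nat (Suc (b i)) * g (b + unit_exponent i)" if "g \<in> A" for i g b
    using that by (simp add: partial_def)
  have "a + unit_exponent 0 + unit_exponent (Suc 0) = a + unit_exponent (Suc 0) + unit_exponent 0"
    by (simp only: add_ac)
  moreover have "unit_exponent 0 (Suc 0) = (0 :: nat)" "unit_exponent (Suc 0) 0 = (0 :: nat)"
    by (simp_all add: unit_exponent_def)
  ultimately show "pd 0 (pd (Suc 0) f) a = pd (Suc 0) (pd 0 f) a"
    by (simp add: pd_apply f del: of_nat_Suc)
qed

lemma mul_minus: "mul a (- b) = - mul a b"
  using mul_diff[of a 0 b] by simp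

lemma two_nonzero: "a + a = 0 \<Longrightarrow> a = 0" for a :: "'k coeffs"
proof -
  assume "a + a = 0"
  then have "sc (of_nat 2) a = 0" using scale_left_distrib[of 1 1 a] by simp
  moreover have "(of_nat 2 :: 'k) \<noteq> 0"
    using char by (auto simp: of_nat_eq_0_iff_char_dvd simp del: of_nat_numeral dest: dvd_imp_le)
  ultimately show "a = 0" using scale_eq_0_iff by blast
qed

lemma z_mul: "mul z z = 0" "mul z x1 = 0" "mul z x2 = 0"
proof -
  have "mul z (mon b) = 0" if "b \<in> I" "i < 2" "b i > 0" for b i
  proof -
    have "(top_exponent + b) i \<ge> p" using that char(2) by (simp add: top_exponent_def)
    then have "top_exponent + b \<notin> I" using that(2) by (auto simp: exponents_def n)
    then show ?thesis using unit_I(3) that(1) by (simp add: mul_mon)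
  qed
  from this[of top_exponent 0] this[of "unit_exponent 0" 0] this[of "unit_exponent (Suc 0)" "Suc 0"]
  show "mul z z = 0" "mul z x1 = 0" "mul z x2 = 0"
    using unit_I char(2) by (auto simp: top_exponent_def unit_exponent_def)
qed

lemma z_Der: "D \<in> Der \<Longrightarrow> mul z (D z) = 0"
proof -
  assume D: "D \<in> Der"
  have "mul z (D z) + mul z (D z) = D (mul z z)"
    using Der_mul[OF D, of z z] by (simp add: mul_comm[of "D z"])
  also have "\<dots> = 0" by (simp add: z_mul Der_0[OF D])
  finally show ?thesis by (rule two_nonzero)
qed

text \<open>
  The bracket is the Poisson bracket of \<open>\<omega>\<close>: \<open>df \<and> dg = {f, g} \<omega>\<close>, where \<open>1 - z\<close> is the inverse
  of the coefficient \<open>1 + z\<close> of \<open>\<omega>\<close>.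
\<close>

definition jacobian where "jacobian f g = mul (pd 0 f) (pd (Suc 0) g) - mul (pd (Suc 0) f) (pd 0 g)"

definition poisson where "poisson f g = mul (e1 - z) (jacobian f g)"

definition divergence where "divergence D = pd 0 (D x1) + pd (Suc 0) (D x2)"

lemma jacobian_A [simp]: "jacobian f g \<in> A" and poisson_A [simp]: "poisson f g \<in> A"
  by (simp_all add: jacobian_def poisson_def)

lemma poisson_alt: "poisson f g = jacobian f g - mul z (jacobian f g)"
  by (simp add: poisson_def mul_diff2 mul_one)

text \<open>
  The bracket of \<open>\<partial>\<^sub>i\<close> with \<open>D\<close> is a derivation, so it is enough to compare values at \<open>x\<^sub>1\<close> and \<open>x\<^sub>2\<close>.
\<close>

lemma pd_Der_commutator:
  assumes D: "D \<in> Der" and f: "f \<in> A" and i: "i \<in> {0, Suc 0}"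
  shows "pd i (D f) = D (pd i f) + mul (pd i (D x1)) (pd 0 f) + mul (pd i (D x2)) (pd (Suc 0) f)"
proof -
  have piD: "pd i \<in> Der" using i pd_Der by auto
  let ?E = "commutator (pd i) D - (\<lambda>f. mul (pd i (D x1)) (pd 0 f)) - (\<lambda>f. mul (pd i (D x2)) (pd (Suc 0) f))"
  have "commutator (pd i) D \<in> Der"
    using Der_restricted piD D by (simp add: restricted_subalgebra_def)
  then have E: "?E \<in> Der"
    by (intro Op.subspace_diff[OF Der_subspace] multiple_in_Der pd_Der)
  have c: "D (pd i x1) = 0" "D (pd i x2) = 0"
    using i pd_x Der_one[OF D] Der_0[OF D] by auto
  have "?E f = 0"
  proof (rule derivation_zero_if_zero_on_coordinates[OF E _ f])
    show "?E (mon (unit_exponent j)) = 0" if "j \<in> {0, Suc 0}" for j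
      using that pd_x c by (auto simp: commutator_def mul_one_right)
  qed
  then show ?thesis by (simp add: commutator_def algebra_simps)
qed

text \<open>
  This is the Lie derivative along \<open>D\<close> of \<open>df \<and> dg\<close>, the product of the Jacobian and
  \<open>dx\<^sub>1 \<and> dx\<^sub>2\<close>.
\<close>

lemma Der_jacobian:
  assumes D: "D \<in> Der" and fg: "f \<in> A" "g \<in> A"
  shows "D (jacobian f g) = jacobian (D f) g + jacobian f (D g) - mul (divergence D) (jacobian f g)"
proof -
  have "D (jacobian f g) = mul (D (pd 0 f)) (pd (Suc 0) g) + mul (pd 0 f) (D (pd (Suc 0) g))
      - (mul (D (pd (Suc 0) f)) (pd 0 g) + mul (pd (Suc 0) f) (D (pd 0 g)))"
    by (simp add: jacobian_def Der_diff[OF D] Der_mul[OF D])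
  then show ?thesis
    unfolding jacobian_def divergence_def
    using pd_Der_commutator[OF D fg(1), of 0] pd_Der_commutator[OF D fg(1), of "Suc 0"]
      pd_Der_commutator[OF D fg(2), of 0] pd_Der_commutator[OF D fg(2), of "Suc 0"]
    by (simp add: mul_add mul_add2 mul_diff mul_diff2 mul_assoc mul_comm mul_left_comm algebra_simps)
qed

text \<open>
  The Lie derivative of \<open>\<omega>\<close> is \<open>D z + div D + z div D\<close>.  If either this or \<open>D z + div D\<close> is zero,
  multiplication by \<open>z\<close> shows that \<open>z div D = 0\<close>, since \<open>z\<^sup>2 = 0\<close> and \<open>z D z = 0\<close>.
\<close>

lemma H2_tau_iff_divergence:
  assumes D: "D \<in> Der"
  shows "D \<in> H \<longleftrightarrow> D z + divergence D = 0"
proof -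
  have zero_exp: "(\<lambda>_. 0) = (0 :: nat \<Rightarrow> nat)" by (simp add: fun_eq_iff)
  have omega: "omega_tau p = e1 + z" unfolding omega_tau_def zero_exp top_exponent_def ..
  have B2_pd: "B2_partial i f = pd i f" if "f \<in> A" for i f
    using that by (simp add: B2_partial_def partial_def)
  have DA: "D x1 \<in> A" "D x2 \<in> A" using Der_closed[OF D] by auto
  have "lie_derivative_2form p D (omega_tau p) = D (e1 + z) + mul (e1 + z) (divergence D)"
    unfolding lie_derivative_2form_def wedge_def ext_deriv_def B2_gen_def omega B2_mult_eq n[symmetric] fst_conv snd_conv
    using DA by (simp add: B2_pd pd_x mul_one mul_one_right divergence_def)
  also have "\<dots> = D z + divergence D + mul z (divergence D)"
    by (simp add: Der_add[OF D] Der_one[OF D] mul_add2 mul_one divergence_def)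
  finally have eq: "lie_derivative_2form p D (omega_tau p) = D z + divergence D + mul z (divergence D)" .
  have "mul z (divergence D) = 0" if "D z + divergence D + mul z (divergence D) = 0 \<or> D z + divergence D = 0"
  proof -
    have "mul z (D z + divergence D + mul z (divergence D)) = mul z (divergence D)"
      "mul z (D z + divergence D) = mul z (divergence D)"
      by (simp_all add: mul_add z_Der[OF D] z_mul flip: mul_assoc)
    then show ?thesis using that by (metis mul_0(1))
  qed
  then show ?thesis
    unfolding H2_tau_def W2_eq using D eq by auto
qed

text \<open>
  This makes it evident that \<open>{D. D \<omega> = 0}\<close> is closed under the \<open>[p]\<close>-map: it consists of the
  derivations of two algebra structures.
\<close>

lemma H2_tau_iff_poisson: "D \<in> H \<longleftrightarrow> D \<in> Der \<and> D \<in> derivations sc poisson A"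
proof (cases "D \<in> Der")
  case D: True
  have "D \<in> derivations sc poisson A \<longleftrightarrow>
      (\<forall>f\<in>A. \<forall>g\<in>A. D (poisson f g) = poisson (D f) g + poisson f (D g))"
    using D by (auto simp: derivations_def)
  also have "\<dots> \<longleftrightarrow> D z + divergence D = 0"
  proof
    assume P: "\<forall>f\<in>A. \<forall>g\<in>A. D (poisson f g) = poisson (D f) g + poisson f (D g)"
    have "jacobian x1 x2 = e1" by (simp add: jacobian_def pd_x mul_one)
    then have "poisson x1 x2 = e1 - z" by (simp add: poisson_def mul_one_right)
    moreover have "jacobian (D x1) x2 + jacobian x1 (D x2) = divergence D"
      by (simp add: jacobian_def divergence_def pd_x mul_one mul_one_right)
    then have "poisson (D x1) x2 + poisson x1 (D x2) = mul (e1 - z) (divergence D)"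
      by (simp only: poisson_def flip: mul_add)
    then have "poisson (D x1) x2 + poisson x1 (D x2) = divergence D - mul z (divergence D)"
      by (simp add: mul_diff2 mul_one divergence_def)
    ultimately have e: "- D z = divergence D - mul z (divergence D)"
      using P[rule_format, of x1 x2] by (simp add: Der_diff[OF D] Der_one[OF D])
    then have "mul z (- D z) = mul z (divergence D - mul z (divergence D))" by simp
    moreover have "mul z (- D z) = 0" using z_Der[OF D] mul_diff[of z 0 "D z"] by simp
    ultimately have "mul z (divergence D) = 0"
      by (simp add: mul_diff z_mul flip: mul_assoc)
    then show "D z + divergence D = 0" using e by (simp add: neg_eq_iff_add_eq_0)
  next
    assume e: "D z + divergence D = 0"
    then have "mul z (D z + divergence D) = 0" by simp
    then have zd: "mul z (divergence D) = 0" by (simp add: mul_add z_Der[OF D])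
    have dz: "D z = - divergence D" using e by (simp add: eq_neg_iff_add_eq_0)
    show "\<forall>f\<in>A. \<forall>g\<in>A. D (poisson f g) = poisson (D f) g + poisson f (D g)"
    proof (intro ballI)
      fix f g assume fg: "f \<in> A" "g \<in> A"
      let ?J = "jacobian f g" and ?S = "jacobian (D f) g + jacobian f (D g)"
      have zJ: "mul z (mul (divergence D) ?J) = 0" by (simp add: zd flip: mul_assoc)
      have "D (poisson f g) = D (?J) - (mul (D z) ?J + mul z (D ?J))"
        by (simp add: poisson_alt Der_diff[OF D] Der_mul[OF D])
      also have "\<dots> = ?S - mul z ?S - (mul (D z) ?J + mul (divergence D) ?J)"
        by (simp add: Der_jacobian[OF D fg] mul_diff mul_add zJ algebra_simps)
      also have "mul (D z) ?J + mul (divergence D) ?J = 0"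
        using e by (simp flip: mul_add2)
      finally have "D (poisson f g) = ?S - mul z ?S" by (simp only: diff_zero)
      then show "D (poisson f g) = poisson (D f) g + poisson f (D g)"
        unfolding poisson_alt[of "D f"] poisson_alt[of f "D g"] mul_add by (simp only: add_diff_add)
    qed
  qed
  finally show ?thesis using H2_tau_iff_divergence[OF D] D by blast
next
  case False
  then show ?thesis by (auto simp: H2_tau_def W2_eq)
qed

lemma poisson_linear:
  assumes "f \<in> A" "f' \<in> A"
  shows "poisson (f + f') g = poisson f g + poisson f' g" "poisson g (f + f') = poisson g f + poisson g f'"
    "poisson (sc c f) g = sc c (poisson f g)" "poisson g (sc c f) = sc c (poisson g f)"
  using assms
  by (simp_all add: poisson_def jacobian_def Der_add[OF pd_Der(1)] Der_add[OF pd_Der(2)]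
      Der_scale[OF pd_Der(1)] Der_scale[OF pd_Der(2)] mul_add mul_add2 mul_diff mul_scale
      mul_scale2 scale_right_diff_distrib algebra_simps)

lemma H2_tau_restricted: "restricted_subalgebra sc p H"
proof -
  have "restricted_subalgebra sc p (derivations sc poisson A)"
    by (rule restricted_subalgebra_derivations[OF vector_space_axioms A_subspace char(1)])
       (use char in \<open>auto simp: poisson_linear\<close>)
  moreover have "H = Der \<inter> derivations sc poisson A" using H2_tau_iff_poisson by blast
  ultimately show ?thesis
    using Der_restricted by (auto simp: restricted_subalgebra_def Op.subspace_def)
qed

lemma H2_tau_Der: "D \<in> H \<Longrightarrow> D \<in> Der"
  using H2_tau_iff_poisson by blast

lemma poisson_outside: "g \<notin> A \<Longrightarrow> poisson f g = 0"
  by (simp add: poisson_def jacobian_def Der_outside[OF pd_Der(1)] Der_outside[OF pd_Der(2)])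

lemma poisson_in_H2_tau:
  assumes f: "f \<in> A"
  shows "poisson f \<in> H"
proof -
  have "poisson f = (\<lambda>g. mul (e1 - z) (((\<lambda>g. mul (pd 0 f) (pd (Suc 0) g)) - (\<lambda>g. mul (pd (Suc 0) f) (pd 0 g))) g))"
    by (simp add: fun_eq_iff poisson_def jacobian_def)
  also have "\<dots> \<in> Der"
    by (intro multiple_in_Der Op.subspace_diff[OF Der_subspace] pd_Der)
  finally have D: "poisson f \<in> Der" .
  have zpd: "mul z (pd 0 z) = 0" "mul z (pd (Suc 0) z) = 0" using z_Der pd_Der by blast+
  have "mul z (jacobian f z) = 0"
    unfolding jacobian_def mul_diff mul_left_comm[of z] zpd by simp
  then have Dz: "poisson f z = jacobian f z" by (simp add: poisson_alt)
  have px: "poisson f x1 = mul z (pd (Suc 0) f) - pd (Suc 0) f" "poisson f x2 = pd 0 f - mul z (pd 0 f)"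
    by (simp_all add: poisson_def jacobian_def pd_x mul_one_right mul_one mul_diff2 mul_diff mul_minus)
  have "divergence (poisson f) = mul (pd 0 z) (pd (Suc 0) f) - mul (pd (Suc 0) z) (pd 0 f)"
    unfolding divergence_def px
    by (simp add: Der_diff[OF pd_Der(1)] Der_diff[OF pd_Der(2)] Der_mul[OF pd_Der(1)]
        Der_mul[OF pd_Der(2)] pd_commute[OF f, simplified])
  then have "poisson f z + divergence (poisson f) = 0"
    unfolding Dz jacobian_def by (simp add: mul_comm)
  then show ?thesis using H2_tau_iff_divergence[OF D] by blast
qed

lemma commutator_poisson:
  assumes "D \<in> H" "f \<in> A"
  shows "commutator D (poisson f) = poisson (D f)"
proof
  fix g
  have D: "D \<in> Der" using assms H2_tau_Der by blast
  show "commutator D (poisson f) g = poisson (D f) g"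
  proof (cases "g \<in> A")
    case True
    then have "D (poisson f g) = poisson (D f) g + poisson f (D g)"
      using assms H2_tau_iff_poisson by (auto simp: derivations_def)
    then show ?thesis by (simp add: commutator_def)
  next
    case False
    have "poisson f 0 = 0" using poisson_linear(4)[of 0 0 f 0] by simp
    then show ?thesis using False by (simp add: commutator_def poisson_outside Der_outside[OF D] Der_0[OF D])
  qed
qed

lemma pd_zero_if_poisson_zero:
  assumes "poisson f = 0"
  shows "pd 0 f = 0" "pd (Suc 0) f = 0"
proof -
  have inv: "a = 0" if "a - mul z a = 0" for a
  proof -
    have "mul z (a - mul z a) = 0" using that by simp
    then have "mul z a = 0" by (simp add: mul_diff z_mul flip: mul_assoc)
    then show ?thesis using that by simp
  qed
  have "poisson f x2 = 0" "poisson f x1 = 0" using assms by auto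
  then have "pd 0 f - mul z (pd 0 f) = 0" "pd (Suc 0) f - mul z (pd (Suc 0) f) = 0"
    by (simp_all add: poisson_def jacobian_def pd_x mul_one_right mul_one mul_diff2 mul_diff mul_minus)
  then show "pd 0 f = 0" "pd (Suc 0) f = 0" using inv by blast+
qed

lemma L_span: "L = Op.span {commutator D E | D E. D \<in> H \<and> E \<in> H}"
  by (simp add: L_eq H2_tau_derived_def derived_algebra_def)

lemma commutator_in_L: "D \<in> H \<Longrightarrow> E \<in> H \<Longrightarrow> commutator D E \<in> L"
  unfolding L_span by (rule Op.span_base) blast

lemma poisson_in_L: "f \<in> A \<Longrightarrow> g \<in> A \<Longrightarrow> poisson (poisson f g) \<in> L"
  using commutator_in_L[OF poisson_in_H2_tau poisson_in_H2_tau, of f g]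
    commutator_poisson[OF poisson_in_H2_tau, of f g] by simp

text \<open>
  These brackets put into \<open>L\<close> what is needed to see that only \<open>0\<close> centralizes it.
\<close>

lemma coordinate_brackets:
  "poisson x1 (mul x1 x2) = x1" "poisson x1 (mul (mul x1 x1) x2) = mul x1 x1"
  "poisson (mul x1 x2) x2 = x2" "poisson (mul x1 (mul x2 x2)) x2 = mul x2 x2"
  by (simp_all add: poisson_alt jacobian_def pd_x Der_mul[OF pd_Der(1)]
      Der_mul[OF pd_Der(2)] mul_one mul_one_right z_mul flip: mul_assoc)

sublocale normalized_subalgebra sc p A mul e1 order_at_least "Suc (\<Sum>i<2. p ^ n i)"
  "mon ` I" "{0, Suc 0}" pd "\<lambda>j. mon (unit_exponent j)" L "H"
proof
  have H: "Op.subspace (H)" "\<And>D E. D \<in> H \<Longrightarrow> E \<in> H \<Longrightarrow> commutator D E \<in> H"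
    using H2_tau_restricted by (auto simp: restricted_subalgebra_def)
  show "Op.subspace L" unfolding L_span by (rule Op.subspace_span)
  show LH: "L \<subseteq> H" unfolding L_span by (rule Op.span_minimal[OF _ H(1)]) (use H(2) in auto)
  show "restricted_subalgebra sc p (H)" by (rule H2_tau_restricted)
  show "H \<subseteq> Der" using H2_tau_Der by blast
  show "commutator D E \<in> L" if "D \<in> H" "E \<in> L" for D E
    using that LH by (intro commutator_in_L) auto
  fix D assume D: "D \<in> H" and zero: "\<And>E. E \<in> L \<Longrightarrow> commutator D E = 0"
  have DD: "D \<in> Der" using D by (rule H2_tau_Der)
  have "poisson (D (poisson f g)) = 0" if "f \<in> A" "g \<in> A" for f g
    using zero[OF poisson_in_L[OF that]] commutator_poisson[OF D, of "poisson f g"] by simp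
  then have const: "pd 0 (D (poisson f g)) = 0" "pd (Suc 0) (D (poisson f g)) = 0" if "f \<in> A" "g \<in> A" for f g
    using that pd_zero_if_poisson_zero by blast+
  (* x and x^2 are brackets, so D x and D (x^2) = 2 x D x both have vanishing partial derivatives. *)
  have vanish: "D x = 0"
    if x: "x \<in> A" "pd i x = e1" and i: "i \<in> {0, Suc 0}" and c: "pd i (D x) = 0" "pd i (D (mul x x)) = 0" for x i
  proof -
    have pi: "pd i \<in> Der" using i pd_Der by auto
    have DA: "D x \<in> A" by (rule Der_closed[OF DD])
    have "D (mul x x) = mul x (D x) + mul x (D x)"
      using Der_mul[OF DD x(1) x(1)] by (simp add: mul_comm[of "D x"])
    then have "pd i (D (mul x x)) = pd i (mul x (D x)) + pd i (mul x (D x))"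
      using Der_add[OF pi, of "mul x (D x)" "mul x (D x)"] by (simp only: mul_closed simp_thms)
    moreover have "pd i (mul x (D x)) = D x"
      using Der_mul[OF pi x(1) DA] x DA c(1) by (simp add: mul_one)
    ultimately have "D x + D x = 0" using c(2) by (simp only:)
    then show ?thesis by (rule two_nonzero)
  qed
  have "D x1 = 0"
    using const[of x1 "mul x1 x2"] const[of x1 "mul (mul x1 x1) x2"] coordinate_brackets pd_x
    by (intro vanish[of _ 0]) auto
  moreover have "D x2 = 0"
    using const[of "mul x1 x2" x2] const[of "mul x1 (mul x2 x2)" x2] coordinate_brackets pd_x
    by (intro vanish[of _ "Suc 0"]) auto
  ultimately have "D f = 0" if "f \<in> A" for f
    by (intro derivation_zero_if_zero_on_coordinates[OF DD _ that]) auto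
  then show "D = 0" using Der_outside[OF DD] by (metis ext zero_fun_apply)
qed

text \<open>
  The map \<open>u \<mapsto> {u, -}\<close> commutes with the torus, and its kernel consists of constants, which have
  weight \<open>0\<close>.  A derivation \<open>{u, -}\<close> of nonzero weight is a multiple of its bracket with an element
  of the torus, and therefore in the derived algebra.
\<close>

theorem hamiltonian_weights:
  assumes "t \<subseteq> p_envelope op_scale p L" "torus op_scale p t"
  shows "weights op_scale L t = Lie_p op_scale p t - {0}"
proof (rule weights_eq_Lie_p[OF assms])
  fix T \<alpha> assume T: "torus sc p T" "T \<subseteq> H" and \<alpha>: "\<alpha> \<in> Lie_p sc p T" "\<exists>D\<in>T. \<alpha> D \<noteq> 0"
  obtain D where D: "D \<in> T" "\<alpha> D \<noteq> 0" using \<alpha>(2) by blast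
  have "T \<subseteq> Der" using T(2) H2_tau_Der by blast
  then obtain u where u: "u \<in> A" "u \<noteq> 0" "\<And>D. D \<in> T \<Longrightarrow> D u = sc (\<alpha> D) u"
    using weight_in_algebra[OF T(1) _ \<alpha>(1)] by blast
  have comm: "commutator D' (poisson u) = fscale sc (\<alpha> D') (poisson u)" if "D' \<in> T" for D'
  proof -
    have "commutator D' (poisson u) = poisson (sc (\<alpha> D') u)"
      using commutator_poisson[of D' u] T(2) that u by auto
    then show ?thesis using u(1) by (simp add: fun_eq_iff fscale_def[of sc] poisson_linear(3)[OF u(1) u(1)])
  qed
  have "fscale sc (inverse (\<alpha> D)) (commutator D (poisson u)) \<in> L"
    using commutator_in_L[OF _ poisson_in_H2_tau[OF u(1)]] D(1) T(2)
    unfolding L_span by (intro Op.span_scale) blast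
  then have "poisson u \<in> L" using D by (simp add: comm)
  moreover have "poisson u \<noteq> 0"
  proof
    assume "poisson u = 0"
    then have z: "pd 0 u = 0" "pd (Suc 0) u = 0" by (rule pd_zero_if_poisson_zero)+
    obtain v where "D = (\<lambda>x. \<Sum>j\<in>{0, Suc 0}. mul (v j) (pd j x))"
      using derivation_combination[of D] D(1) T(2) H2_tau_Der by blast
    then have "D u = 0" using z by simp
    then show False using u(2) u(3)[OF D(1)] D(2) by (simp add: scale_eq_0_iff)
  qed
  ultimately show "\<exists>E\<in>L. E \<noteq> 0 \<and> (\<forall>D\<in>T. commutator D E = fscale sc (\<alpha> D) E)"
    using comm by blast
qed

end

section \<open>All characters are weights\<close>

theorem corollary7p5:
  fixes p :: nat
    and L :: "('k::alg_closed_field coeffs \<Rightarrow> 'k coeffs) set"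
    and t :: "(('k coeffs \<Rightarrow> 'k coeffs) \<Rightarrow> ('k coeffs \<Rightarrow> 'k coeffs)) set"
  assumes "CHAR('k) = p" and "p > 3"
    and "L = H2_tau_derived p \<or>
         (\<exists>m n. m \<ge> 1 \<and> (\<forall>i<m. n i \<ge> 1) \<and> (\<exists>i<m. n i \<noteq> 1) \<and> L = W p m n)"
    and "t \<subseteq> p_envelope op_scale p L"
    and "torus op_scale p t"
  shows "weights op_scale L t = Lie_p op_scale p t - {0}"
  using assms(3)
proof (elim disjE exE conjE)
  assume "L = H2_tau_derived p"
  then interpret hamiltonian_algebra p "\<lambda>_. 1" L
    using assms(1,2) by unfold_locales auto
  show ?thesis by (rule hamiltonian_weights[OF assms(4,5)])
next
  fix m n assume "m \<ge> 1" "\<forall>i<m. n i \<ge> 1" "L = W p m n"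
  then interpret divided_power_algebra p m n L
    using assms(1,2) by unfold_locales auto
  show ?thesis by (rule witt_weights[OF assms(4,5)])
qed

end
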